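(* For any $\sigma>0$, the operator $\mathcal{T}_6$ is bounded from $(L^{2,\sigma})^5$ to $L^{2,\sigma+\delta}$ with $\delta=\sigma/(1+\sigma)>0$; that is, there is a constant $C$ (depending on $\sigma$) such that $\|\mathcal{T}_6(f_1,\dots,f_5)\|_{L^{2,\sigma+\delta}}\le C\prod_{k=1}^5\|f_k\|_{L^{2,\sigma}}$ for all $f_1,\dots,f_5\in L^{2,\sigma}$.
   Context: All functions are $\mathbb{R}\to\mathbb{C}$. With $\langle x\rangle=\sqrt{1+x^2}$, $\|f\|_{L^{2,\sigma}}=\|\langle x\rangle^\sigma f\|_{L^2}$. $H=-\Delta+x^2$ on $L^2(\mathbb{R})$, and $e^{itH}$ is the unitary propagator of $iu_t+Hu=0$ (so $e^{itH}\phi_n=e^{it(2n+1)}\phi_n$ for the Hermite functions $\phi_n$, $H\phi_n=(2n+1)\phi_n$). Define $$\mathcal{T}_6(f_1,\dots,f_5)=\frac{12}{\pi}\int_{-\pi/4}^{\pi/4}e^{-itH}\left[(e^{itH}f_1)(e^{itH}f_2)(e^{itH}f_3)\overline{(e^{itH}f_4)(e^{itH}f_5)}\right]dt ,$$ equivalently, by duality, $\int_{\mathbb{R}}\mathcal{T}_6(f_1,\dots,f_5)\overline{g}\,dx=\frac{12}{\pi}\int_{-\pi/4}^{\pi/4}\int_{\mathbb{R}}(e^{itH}f_1)(e^{itH}f_2)(e^{itH}f_3)\overline{(e^{itH}f_4)(e^{itH}f_5)(e^{itH}g)}\,dx\,dt$ for $g\in L^2$. *)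

theory Defs
  imports "HOL-Analysis.Analysis"
begin

text \<open>
  Elements of $L^2(\mathbb{R})$ are represented by Lebesgue measurable functions, not by
  almost-everywhere equivalence classes; equality in $L^2$ is equality almost everywhere.
\<close>

definition L2 :: "(real \<Rightarrow> complex) set" where
  "L2 = {f. f \<in> borel_measurable lebesgue \<and> integrable lebesgue (\<lambda>x. (norm (f x))\<^sup>2)}"

definition L2_norm :: "(real \<Rightarrow> complex) \<Rightarrow> real" where
  "L2_norm f = sqrt (\<integral>x. (norm (f x))\<^sup>2 \<partial>lebesgue)"

definition L2_inner :: "(real \<Rightarrow> complex) \<Rightarrow> (real \<Rightarrow> complex) \<Rightarrow> complex" where
  "L2_inner f g = (\<integral>x. f x * cnj (g x) \<partial>lebesgue)"

definition japanese :: "real \<Rightarrow> real" where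
  "japanese x = sqrt (1 + x\<^sup>2)"

definition weighted :: "real \<Rightarrow> (real \<Rightarrow> complex) \<Rightarrow> real \<Rightarrow> complex" where
  "weighted \<sigma> f = (\<lambda>x. complex_of_real (japanese x powr \<sigma>) * f x)"

definition wL2 :: "real \<Rightarrow> (real \<Rightarrow> complex) set" where
  "wL2 \<sigma> = {f. weighted \<sigma> f \<in> L2}"

definition wL2_norm :: "real \<Rightarrow> (real \<Rightarrow> complex) \<Rightarrow> real" where
  "wL2_norm \<sigma> f = L2_norm (weighted \<sigma> f)"

text \<open>
  Physicists' Hermite polynomials and the $L^2$-normalised Hermite functions. The latter are an
  orthonormal basis of $L^2(\mathbb{R})$ made of eigenfunctions of $H = -\Delta + x^2$.
\<close>

fun hermite_poly :: "nat \<Rightarrow> real \<Rightarrow> real" where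
  "hermite_poly 0 x = 1"
| "hermite_poly (Suc 0) x = 2 * x"
| "hermite_poly (Suc (Suc n)) x =
     2 * x * hermite_poly (Suc n) x - 2 * real (Suc n) * hermite_poly n x"

definition hermite_fun :: "nat \<Rightarrow> real \<Rightarrow> real" where
  "hermite_fun n x = hermite_poly n x * exp (- x\<^sup>2 / 2) / sqrt (2 ^ n * fact n * sqrt pi)"

lemma hermite_poly_deriv:
  "((\<lambda>x. hermite_poly n x) has_real_derivative 2 * real n * hermite_poly (n - 1) x) (at x)"
proof (induction n arbitrary: x rule: less_induct)
  case (less n)
  consider "n = 0" | "n = 1" | "n = 2" | m where "n = Suc (Suc (Suc m))"
    by (metis One_nat_def Suc_1 not0_implies_Suc)
  then show ?case
  proof cases
    case 4
    have a: "((\<lambda>x. hermite_poly (Suc (Suc m)) x) has_real_derivative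
               2 * real (Suc (Suc m)) * hermite_poly (Suc m) x) (at x)"
      using less.IH[of "Suc (Suc m)" x] 4 by simp
    have b: "((\<lambda>x. hermite_poly (Suc m) x) has_real_derivative
               2 * real (Suc m) * hermite_poly m x) (at x)"
      using less.IH[of "Suc m" x] 4 by simp
    show ?thesis
      unfolding 4 hermite_poly.simps(3)[of "Suc m"]
      by (rule derivative_eq_intros a b refl | simp add: algebra_simps)+
  qed (auto simp: numeral_2_eq_2 intro!: derivative_eq_intros)
qed

lemma hermite_fun_eigen:
  "- deriv (deriv (hermite_fun n)) x + x\<^sup>2 * hermite_fun n x = (2 * real n + 1) * hermite_fun n x"
proof -
  define c where "c = sqrt (2 ^ n * fact n * sqrt pi)"
  have c: "c \<noteq> 0" by (simp add: c_def)
  have hf: "hermite_fun n = (\<lambda>x. hermite_poly n x * exp (- x\<^sup>2 / 2) / c)"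
    by (auto simp: hermite_fun_def c_def)
  have "(hermite_fun n has_real_derivative
     (2 * real n * hermite_poly (n - 1) y - y * hermite_poly n y) * exp (- y\<^sup>2 / 2) / c) (at y)" for y
    unfolding hf
    by (rule derivative_eq_intros hermite_poly_deriv refl | simp add: c field_simps)+
  then have d1: "deriv (hermite_fun n) =
     (\<lambda>y. (2 * real n * hermite_poly (n - 1) y - y * hermite_poly n y) * exp (- y\<^sup>2 / 2) / c)"
    by (auto intro!: DERIV_imp_deriv)
  have "(deriv (hermite_fun n) has_real_derivative
     (2 * real n * (2 * real (n - 1) * hermite_poly (n - 1 - 1) x)
        - hermite_poly n x - x * (2 * real n * hermite_poly (n - 1) x)
        - x * (2 * real n * hermite_poly (n - 1) x - x * hermite_poly n x))
      * exp (- x\<^sup>2 / 2) / c) (at x)"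
    unfolding d1
    by (rule derivative_eq_intros hermite_poly_deriv refl | simp add: c field_simps)+
  then have d2: "deriv (deriv (hermite_fun n)) x =
     (2 * real n * (2 * real (n - 1) * hermite_poly (n - 1 - 1) x)
        - hermite_poly n x - x * (2 * real n * hermite_poly (n - 1) x)
        - x * (2 * real n * hermite_poly (n - 1) x - x * hermite_poly n x))
      * exp (- x\<^sup>2 / 2) / c"
    by (rule DERIV_imp_deriv)
  consider "n = 0" | "n = 1" | m where "n = Suc (Suc m)"
    by (metis One_nat_def not0_implies_Suc)
  then show ?thesis
    unfolding d2 unfolding hf
    by cases (simp_all add: c field_simps power2_eq_square)
qed

text \<open>
  The unitary propagator $e^{itH}$, defined by the spectral decomposition of $H$: the sum
  $\sum_n e^{it(2n+1)} \langle f, \phi_n\rangle \phi_n$, convergent in $L^2$. For each $t$ it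
  determines an element of $L^2$ up to null sets, from which a representative is chosen.
\<close>

definition propagator :: "real \<Rightarrow> (real \<Rightarrow> complex) \<Rightarrow> real \<Rightarrow> complex" where
  "propagator t f = (SOME u. u \<in> L2 \<and>
     (\<lambda>N. L2_norm (\<lambda>x. u x - (\<Sum>n<N. cis (t * (2 * real n + 1))
         * L2_inner f (\<lambda>y. complex_of_real (hermite_fun n y))
         * complex_of_real (hermite_fun n x)))) \<longlonglongrightarrow> 0)"

definition T6_density ::
  "(real \<Rightarrow> complex) \<Rightarrow> (real \<Rightarrow> complex) \<Rightarrow> (real \<Rightarrow> complex) \<Rightarrow> (real \<Rightarrow> complex) \<Rightarrow>
   (real \<Rightarrow> complex) \<Rightarrow> (real \<Rightarrow> complex) \<Rightarrow> real \<Rightarrow> real \<Rightarrow> complex" where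
  "T6_density f1 f2 f3 f4 f5 g t x =
     propagator t f1 x * propagator t f2 x * propagator t f3 x
       * cnj (propagator t f4 x * propagator t f5 x * propagator t g x)"

text \<open>
  For $f_k \in L^2$ the product of the five propagated functions need not lie in $L^2$ for fixed
  $t$, so the time integral defining $\mathcal{T}_6$ is read weakly, by duality with $L^2$. As the
  Bochner integral of a non-integrable function is 0 by convention, convergence of the iterated
  integral is required explicitly.
\<close>

definition is_T6 ::
  "(real \<Rightarrow> complex) \<Rightarrow> (real \<Rightarrow> complex) \<Rightarrow> (real \<Rightarrow> complex) \<Rightarrow> (real \<Rightarrow> complex) \<Rightarrow>
   (real \<Rightarrow> complex) \<Rightarrow> (real \<Rightarrow> complex) \<Rightarrow> bool" where
  "is_T6 f1 f2 f3 f4 f5 h \<longleftrightarrow> h \<in> L2 \<and>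
     (\<forall>g\<in>L2.
        (AE t in lebesgue_on {- pi / 4..pi / 4}. integrable lebesgue (T6_density f1 f2 f3 f4 f5 g t)) \<and>
        integrable (lebesgue_on {- pi / 4..pi / 4})
          (\<lambda>t. \<integral>x. T6_density f1 f2 f3 f4 f5 g t x \<partial>lebesgue) \<and>
        L2_inner h g = complex_of_real (12 / pi) *
          (\<integral>t. (\<integral>x. T6_density f1 f2 f3 f4 f5 g t x \<partial>lebesgue) \<partial>lebesgue_on {- pi / 4..pi / 4}))"

definition T6 ::
  "(real \<Rightarrow> complex) \<Rightarrow> (real \<Rightarrow> complex) \<Rightarrow> (real \<Rightarrow> complex) \<Rightarrow> (real \<Rightarrow> complex) \<Rightarrow>
   (real \<Rightarrow> complex) \<Rightarrow> real \<Rightarrow> complex" where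
  "T6 f1 f2 f3 f4 f5 = (SOME h. is_T6 f1 f2 f3 f4 f5 h)"

end

theory Submission
  imports Defs "HOL-Probability.Probability" "HOL-Complex_Analysis.Complex_Analysis"
begin

text \<open>
  The propagator maps the coherent state \<open>exp (- x\<^sup>2 / 2 + 2 s x - s\<^sup>2)\<close> to \<open>cis t\<close> times the
  coherent state with parameter \<open>s cis (2 t)\<close>. Hence on coherent states two forms are explicit
  Gaussian integrals: the space-time integral of \<open>u\<^sub>1 u\<^sub>2 u\<^sub>3 cnj (u\<^sub>4 u\<^sub>5 u\<^sub>6)\<close>, and the integral over
  \<open>\<theta>\<close> and \<open>y \<in> \<real>\<^sup>3\<close> of \<open>(f\<^sub>1 \<otimes> f\<^sub>2 \<otimes> f\<^sub>3) (R\<^sub>\<theta> y) cnj ((f\<^sub>4 \<otimes> f\<^sub>5 \<otimes> f\<^sub>6) y)\<close>, where \<open>R\<^sub>\<theta>\<close> rotates about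
  \<open>(1, 1, 1)\<close>. Both reduce to the same Bessel-type integral, so they agree up to a constant.
  Coherent states are total in \<open>L\<^sup>2\<close>; one slot at a time the identity extends first to functions
  with bounded evolution, where it yields the \<open>L\<^sup>6\<close> Strichartz estimate, and then to all of \<open>L\<^sup>2\<close>.

  In the rotation form the dual variable \<open>z\<close> satisfies \<open>|z| \<le> |x|\<close> with \<open>x = R\<^sub>\<theta> y\<close>, so one \<open>x\<^sub>j\<close> is
  comparable to \<open>z\<close> and pays for \<open>\<langle>z\<rangle>\<^sup>\<sigma>\<close>. Either another variable exceeds \<open>\<langle>z\<rangle>\<^sup>\<alpha>\<close> with
  \<open>\<alpha> = 1 / (1 + \<sigma>)\<close> and pays for \<open>\<langle>z\<rangle>\<^sup>\<delta>\<close> since \<open>\<alpha> \<sigma> = \<delta>\<close>, or \<open>R\<^sub>\<theta>\<close> nearly maps one axis to another, which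
  confines \<open>\<theta>\<close> to a set of measure of order \<open>\<langle>z\<rangle>\<^sup>-\<^sup>\<delta>\<close> since \<open>1 - \<alpha> = \<delta>\<close>. In the latter case
  \<open>\<langle>x\<^sub>j\<rangle>\<close> and \<open>\<langle>z\<rangle>\<close> are comparable, and the Cauchy-Schwarz inequality with the factor \<open>\<langle>z\<rangle>\<^sup>\<delta>\<close> split evenly
  between the two triples lets the \<open>\<theta>\<close>-integral absorb it.
\<close>

section \<open>Hermite functions\<close>

text \<open>The time integral oscillates and the weight does not commute with the propagator, so
  weights cannot be inserted in the space-time form. The rotation form has a nonnegative kernel:
  absolute values and weights enter pointwise, and the estimate becomes an inequality between
  \<langle>z\<rangle> and the five other variables. Rotations about the diagonal appear because on
  coherent states the space-time form sees only the sum and the squared length of each parameter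
  triple, which such rotations preserve. The detour through bounded evolutions avoids a circle:
  extending the identity by continuity needs an L^6 bound, which is itself a consequence of the
  identity. With five bounded evolutions the L^2 bound for the flow is enough. Two questions of
  representation shape the rest. \<open>propagator\<close> picks a function separately at each time,
  so Fubini's theorem is applied to \<open>flow\<close>, a jointly measurable function equal to it
  almost everywhere at each time. \<open>T6\<close> is chosen by a weak condition, so an explicit
  function is estimated and uniqueness transfers the estimate.\<close>

lemma abs_le_exp_square:
  fixes e x :: real
  assumes "0 < e"
  shows "\<bar>x\<bar> \<le> (1 + 1 / e) * exp (e * x\<^sup>2)"
proof -
  have "\<bar>x\<bar> \<le> 1 + x\<^sup>2"
    using sum_squares_bound[of 1 "\<bar>x\<bar>"] by auto
  also have "\<dots> \<le> (1 + 1 / e) * (1 + e * x\<^sup>2)"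
    using assms by (simp add: field_simps)
  also have "\<dots> \<le> (1 + 1 / e) * exp (e * x\<^sup>2)"
    using assms by (intro mult_left_mono exp_ge_add_one_self) auto
  finally show ?thesis .
qed

text \<open>The factor x of the recursion is traded for an exponential by
  \<open>abs_le_exp_square\<close>. The rate is split, \<open>e/2\<close> for that factor and
  \<open>e/2\<close> for the polynomial, so the induction runs over all \<open>e\<close>.\<close>

lemma hermite_poly_bound:
  assumes "0 < e"
  shows "\<exists>C\<ge>0. \<forall>x. \<bar>hermite_poly n x\<bar> \<le> C * exp (e * x\<^sup>2)"
  using assms
proof (induction n arbitrary: e rule: less_induct)
  case (less n)
  consider "n = 0" | "n = 1" | m where "n = Suc (Suc m)"
    by (metis One_nat_def not0_implies_Suc)
  then show ?case
  proof cases
    case 1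
    then show ?thesis using less by (auto intro!: exI[of _ 1])
  next
    case 2
    show ?thesis
    proof (intro exI[of _ "2 * (1 + 1/e)"] conjI allI)
      fix x show "\<bar>hermite_poly n x\<bar> \<le> 2 * (1 + 1 / e) * exp (e * x\<^sup>2)"
        using abs_le_exp_square[OF less.prems, of x] 2 by (simp add: abs_mult mult.assoc del: distrib_right_numeral) (simp add: algebra_simps)
    qed (use less in auto)
  next
    case 3
    obtain C where C: "C \<ge> 0" "\<And>x. \<bar>hermite_poly (Suc m) x\<bar> \<le> C * exp (e/2 * x\<^sup>2)"
      using less.IH[of "Suc m" "e/2"] less.prems 3 by auto
    obtain D where D: "D \<ge> 0" "\<And>x. \<bar>hermite_poly m x\<bar> \<le> D * exp (e * x\<^sup>2)"
      using less.IH[of m e] less.prems 3 by auto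
    let ?B = "2 * (1 + 1 / (e/2)) * C + 2 * real (Suc m) * D"
    show ?thesis
    proof (intro exI[of _ ?B] conjI allI)
      fix x
      have "\<bar>hermite_poly n x\<bar> \<le> 2 * (\<bar>x\<bar> * \<bar>hermite_poly (Suc m) x\<bar>) + 2 * real (Suc m) * \<bar>hermite_poly m x\<bar>"
        unfolding 3 hermite_poly.simps
        by (rule order.trans[OF abs_triangle_ineq4]) (simp add: abs_mult)
      also have "\<dots> \<le> 2 * (((1 + 1 / (e/2)) * exp (e/2 * x\<^sup>2)) * (C * exp (e/2 * x\<^sup>2)))
           + 2 * real (Suc m) * (D * exp (e * x\<^sup>2))"
        using less.prems C(1) abs_le_exp_square[of "e/2" x]
        by (intro add_mono mult_left_mono mult_mono C D) auto
      also have "\<dots> = 2 * (1 + 1 / (e/2)) * C * (exp (e/2 * x\<^sup>2) * exp (e/2 * x\<^sup>2))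
           + 2 * real (Suc m) * D * exp (e * x\<^sup>2)"
        by (simp only: mult_ac)
      also have "exp (e/2 * x\<^sup>2) * exp (e/2 * x\<^sup>2) = exp (e * x\<^sup>2)"
        by (simp flip: exp_add)
      also have "2 * (1 + 1 / (e/2)) * C * exp (e * x\<^sup>2) + 2 * real (Suc m) * D * exp (e * x\<^sup>2) = ?B * exp (e * x\<^sup>2)"
        by (simp only: distrib_right)
      finally show "\<bar>hermite_poly n x\<bar> \<le> ?B * exp (e * x\<^sup>2)" .
    qed (use less C D in auto)
  qed
qed

section \<open>Gaussian decay, integration by parts and orthogonality\<close>

lemma integrable_gauss: "integrable lborel (\<lambda>x::real. exp (- x\<^sup>2 / 2))"
proof -
  have "integrable lborel (\<lambda>x. sqrt (2*pi) * std_normal_density x)"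
    by (intro integrable_mult_right) (simp add: integrable_normal_density)
  then show ?thesis by (simp add: std_normal_density_def)
qed

lemma gauss_tendsto_0:
  "((\<lambda>x::real. exp (- x\<^sup>2 / 2)) \<longlongrightarrow> 0) at_top" "((\<lambda>x::real. exp (- x\<^sup>2 / 2)) \<longlongrightarrow> 0) at_bot"
  by real_asymp+

text \<open>The fundamental theorem of calculus on the whole line: the bound on \<open>F\<close>
  makes both boundary terms vanish, the bound on \<open>F'\<close> gives integrability.\<close>

lemma integral_deriv_eq_0:
  fixes F F' :: "real \<Rightarrow> real"
  assumes F: "\<And>x. (F has_real_derivative F' x) (at x)" and cont: "\<And>x. isCont F' x"
    and bF: "\<And>x. \<bar>F x\<bar> \<le> C * exp (- x\<^sup>2 / 2)" and bF': "\<And>x. \<bar>F' x\<bar> \<le> D * exp (- x\<^sup>2 / 2)"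
  shows "integral\<^sup>L lborel F' = 0"
proof -
  have [measurable]: "F' \<in> borel_measurable borel"
    by (intro borel_measurable_continuous_onI continuous_at_imp_continuous_on) (use cont in auto)
  have int: "integrable lborel F'"
    by (rule Bochner_Integration.integrable_bound[OF integrable_mult_right[OF integrable_gauss, of D]])
      (use bF' in \<open>auto intro!: order.trans[OF _ abs_ge_self]\<close>)
  have ev: "\<forall>\<^sub>F x in G. norm (F x) \<le> C * exp (- x\<^sup>2 / 2)" for G
    by (intro always_eventually allI) (simp only: real_norm_def bF)
  have t: "(F \<longlongrightarrow> 0) at_top" "(F \<longlongrightarrow> 0) at_bot"
    using Lim_null_comparison[OF ev tendsto_mult_right_zero] gauss_tendsto_0 by metis+
  have "(LBINT x=-\<infinity>..\<infinity>. F' x) = 0 - 0"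
  proof (rule interval_integral_FTC_integrable)
    show "((F \<circ> real_of_ereal) \<longlongrightarrow> 0) (at_left \<infinity>)" "((F \<circ> real_of_ereal) \<longlongrightarrow> 0) (at_right (-\<infinity>))"
      using t by (simp_all add: ereal_tendsto_simps)
  qed (use F cont int in \<open>auto simp: has_real_derivative_iff_has_vector_derivative set_integrable_def\<close>)
  then show ?thesis by (simp add: interval_lebesgue_integral_def set_lebesgue_integral_def)
qed

lemma integrable_gauss_bound:
  fixes F :: "real \<Rightarrow> 'a :: {banach, second_countable_topology}"
  assumes [measurable]: "F \<in> borel_measurable borel" and b: "\<And>x. norm (F x) \<le> C * exp (- x\<^sup>2 / 2)"
  shows "integrable lborel F"
  by (rule Bochner_Integration.integrable_bound[OF integrable_mult_right[OF integrable_gauss, of C]])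
    (use b in \<open>auto intro!: order.trans[OF _ abs_ge_self]\<close>)

lemma continuous_hermite_poly [continuous_intros]:
  "continuous_on A f \<Longrightarrow> continuous_on A (\<lambda>x. hermite_poly n (f x))"
proof -
  have "continuous_on UNIV (hermite_poly n)"
    using hermite_poly_deriv[of n] by (meson DERIV_continuous_on has_field_derivative_at_within)
  then show "continuous_on A f \<Longrightarrow> continuous_on A (\<lambda>x. hermite_poly n (f x))"
    using continuous_on_compose2 by blast
qed

lemma borel_measurable_hermite_poly [measurable]: "hermite_poly n \<in> borel_measurable borel"
  by (intro borel_measurable_continuous_onI continuous_intros)

lemma borel_measurable_hermite_fun [measurable]: "hermite_fun n \<in> borel_measurable borel"
  unfolding hermite_fun_def[abs_def] by measurable

lemma hermite_poly_Suc:
  "hermite_poly (Suc n) x = 2 * x * hermite_poly n x - 2 * real n * hermite_poly (n - 1) x"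
  by (cases n) auto

text \<open>Since H_n' - 2 x H_n = - H_(n+1), the difference of the two integrands is the derivative
  of H_n q exp(-x^2). The rate 1/8, used for q and for the polynomial, leaves the decay exp(-3/4
  x^2).\<close>

lemma hermite_poly_ibp:
  fixes q q' :: "real \<Rightarrow> real"
  assumes q: "\<And>x. (q has_real_derivative q' x) (at x)" and cont: "continuous_on UNIV q'"
    and bq: "\<And>x. \<bar>q x\<bar> \<le> C * exp (x\<^sup>2 / 8)" and bq': "\<And>x. \<bar>q' x\<bar> \<le> D * exp (x\<^sup>2 / 8)"
  shows "(\<integral>x. hermite_poly (Suc n) x * q x * exp (- x\<^sup>2) \<partial>lborel) =
         (\<integral>x. hermite_poly n x * q' x * exp (- x\<^sup>2) \<partial>lborel)"
proof -
  have cq: "continuous_on UNIV q"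
    using q by (meson DERIV_continuous_on has_field_derivative_at_within)
  have bound: "\<exists>K. \<forall>x. \<bar>hermite_poly m x * r x * exp (- x\<^sup>2)\<bar> \<le> K * exp (- x\<^sup>2 / 2)"
    if "\<And>x. \<bar>r x\<bar> \<le> E * exp (x\<^sup>2 / 8)" for m E and r :: "real \<Rightarrow> real"
  proof -
    obtain B where B: "B \<ge> 0" "\<And>x. \<bar>hermite_poly m x\<bar> \<le> B * exp (1/8 * x\<^sup>2)"
      using hermite_poly_bound[of "1/8" m] by auto
    have "E \<ge> 0" using that[of 0] by auto
    have "\<bar>hermite_poly m x * r x * exp (- x\<^sup>2)\<bar> \<le> B * E * exp (- x\<^sup>2 / 2)" for x
    proof -
      have "\<bar>hermite_poly m x * r x * exp (- x\<^sup>2)\<bar>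
          \<le> (B * exp (1/8 * x\<^sup>2)) * (E * exp (x\<^sup>2 / 8)) * exp (- x\<^sup>2)"
        unfolding abs_mult using B that \<open>E \<ge> 0\<close> by (intro mult_mono) auto
      also have "\<dots> = B * E * (exp (1/8 * x\<^sup>2) * exp (x\<^sup>2 / 8) * exp (- x\<^sup>2))"
        by (simp only: mult_ac)
      also have "exp (1/8 * x\<^sup>2) * exp (x\<^sup>2 / 8) * exp (- x\<^sup>2) = exp (- 3/4 * x\<^sup>2)"
        by (simp flip: exp_add)
      also have "B * E * exp (- 3/4 * x\<^sup>2) \<le> B * E * exp (- x\<^sup>2 / 2)"
        using B(1) \<open>E \<ge> 0\<close> by (intro mult_left_mono) auto
      finally show ?thesis .
    qed
    then show ?thesis by blast
  qed
  obtain K1 where K1: "\<And>x. \<bar>hermite_poly (Suc n) x * q x * exp (- x\<^sup>2)\<bar> \<le> K1 * exp (- x\<^sup>2 / 2)"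
    using bound[OF bq] by blast
  obtain K2 where K2: "\<And>x. \<bar>hermite_poly n x * q' x * exp (- x\<^sup>2)\<bar> \<le> K2 * exp (- x\<^sup>2 / 2)"
    using bound[OF bq'] by blast
  obtain K3 where K3: "\<And>x. \<bar>hermite_poly n x * q x * exp (- x\<^sup>2)\<bar> \<le> K3 * exp (- x\<^sup>2 / 2)"
    using bound[OF bq] by blast
  have [measurable]: "q \<in> borel_measurable borel" "q' \<in> borel_measurable borel"
    using cq cont by (auto intro: borel_measurable_continuous_onI)
  have int1: "integrable lborel (\<lambda>x. hermite_poly n x * q' x * exp (- x\<^sup>2))"
    by (rule integrable_gauss_bound[where C=K2]) (measurable, simp only: real_norm_def K2)
  have int2: "integrable lborel (\<lambda>x. hermite_poly (Suc n) x * q x * exp (- x\<^sup>2))"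
    by (rule integrable_gauss_bound[where C=K1]) (measurable, simp only: real_norm_def K1)
  have "(\<integral>x. hermite_poly n x * q' x * exp (- x\<^sup>2) - hermite_poly (Suc n) x * q x * exp (- x\<^sup>2) \<partial>lborel) = 0"
  proof (rule integral_deriv_eq_0)
    show "((\<lambda>x. hermite_poly n x * q x * exp (- x\<^sup>2)) has_real_derivative
        hermite_poly n x * q' x * exp (- x\<^sup>2) - hermite_poly (Suc n) x * q x * exp (- x\<^sup>2)) (at x)" for x
    proof -
      have "((\<lambda>x. exp (- x\<^sup>2)) has_real_derivative - 2 * x * exp (- x\<^sup>2)) (at x)"
        by (auto intro!: derivative_eq_intros)
      from DERIV_mult[OF DERIV_mult[OF hermite_poly_deriv[of n x] q[of x]] this] show ?thesis
        by (rule DERIV_cong) (simp add: hermite_poly_Suc algebra_simps)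
    qed
    show "isCont (\<lambda>x. hermite_poly n x * q' x * exp (- x\<^sup>2) - hermite_poly (Suc n) x * q x * exp (- x\<^sup>2)) x" for x
    proof -
      have "continuous_on UNIV (\<lambda>x. hermite_poly n x * q' x * exp (- x\<^sup>2) - hermite_poly (Suc n) x * q x * exp (- x\<^sup>2))"
        by (intro continuous_intros cont cq)
      then show ?thesis by (simp add: continuous_on_eq_continuous_at)
    qed
    show "\<bar>hermite_poly n x * q x * exp (- x\<^sup>2)\<bar> \<le> K3 * exp (- x\<^sup>2 / 2)" for x
      by (rule K3)
    show "\<bar>hermite_poly n x * q' x * exp (- x\<^sup>2) - hermite_poly (Suc n) x * q x * exp (- x\<^sup>2)\<bar>
        \<le> (K1 + K2) * exp (- x\<^sup>2 / 2)" for x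
      using order.trans[OF abs_triangle_ineq4 add_mono[OF K2[of x] K1[of x]]] by (simp add: distrib_right)
  qed
  then show ?thesis
    unfolding Bochner_Integration.integral_diff[OF int1 int2] right_minus_eq by (rule sym)
qed

text \<open>Completing the square gives a multiple of the normal density with mean b/a and variance
  1/(2a).\<close>

lemma gauss_integral_real:
  fixes a b :: real
  assumes "a > 0"
  shows "has_bochner_integral lborel (\<lambda>x. exp (- a * x\<^sup>2 + 2 * b * x)) (sqrt (pi / a) * exp (b\<^sup>2 / a))"
proof -
  define \<sigma> where "\<sigma> = 1 / sqrt (2 * a)"
  have s: "\<sigma> > 0" "\<sigma>\<^sup>2 = 1 / (2 * a)" using assms by (auto simp: \<sigma>_def power_divide)
  have "has_bochner_integral lborel (\<lambda>x. sqrt (pi / a) * exp (b\<^sup>2 / a) * normal_density (b/a) \<sigma> x)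
     (sqrt (pi / a) * exp (b\<^sup>2 / a) * 1)"
    using integral_normal_density[OF s(1)] integrable_normal_density[OF s(1)]
    by (intro has_bochner_integral_mult_right) (simp add: has_bochner_integral_iff)
  also have "(\<lambda>x. sqrt (pi / a) * exp (b\<^sup>2 / a) * normal_density (b/a) \<sigma> x) = (\<lambda>x. exp (- a * x\<^sup>2 + 2 * b * x))"
  proof
    fix x
    have "b\<^sup>2 / a + - (x - b/a)\<^sup>2 / (2 * \<sigma>\<^sup>2) = - a * x\<^sup>2 + 2 * b * x"
    proof -
      have "- (x - b/a)\<^sup>2 / (2 * \<sigma>\<^sup>2) = - (a * (x - b/a)\<^sup>2)"
        unfolding s(2) using assms by simp
      also have "\<dots> = - a * x\<^sup>2 + 2 * b * x - b\<^sup>2 / a"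
        using assms by (simp add: power2_eq_square field_simps)
      finally show ?thesis by simp
    qed
    then show "sqrt (pi / a) * exp (b\<^sup>2 / a) * normal_density (b/a) \<sigma> x = exp (- a * x\<^sup>2 + 2 * b * x)"
      using assms by (simp add: normal_density_def s real_sqrt_divide flip: exp_add)
  qed
  finally show ?thesis by simp
qed

lemma hermite_poly_orthogonal:
  "(\<integral>x. hermite_poly n x * hermite_poly m x * exp (- x\<^sup>2) \<partial>lborel) = (if n = m then 2 ^ n * fact n * sqrt pi else 0)"
proof -
  \<comment> \<open>Integration by parts turns the raised index n into a derivative of H_m, which is
    2 m H_(m-1), so both indices drop together. For m = 0 the factor 2 m vanishes and the truncated
    \<open>m - 1\<close> is harmless.\<close>
  have step: "(\<integral>x. hermite_poly (Suc n) x * hermite_poly m x * exp (- x\<^sup>2) \<partial>lborel) =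
     2 * real m * (\<integral>x. hermite_poly n x * hermite_poly (m - 1) x * exp (- x\<^sup>2) \<partial>lborel)" for n m
  proof -
    obtain C where C: "\<And>x. \<bar>hermite_poly m x\<bar> \<le> C * exp (1/8 * x\<^sup>2)"
      using hermite_poly_bound[of "1/8" m] by auto
    obtain D where D: "\<And>x. \<bar>hermite_poly (m - 1) x\<bar> \<le> D * exp (1/8 * x\<^sup>2)"
      using hermite_poly_bound[of "1/8" "m - 1"] by auto
    have "(\<integral>x. hermite_poly (Suc n) x * hermite_poly m x * exp (- x\<^sup>2) \<partial>lborel) =
       (\<integral>x. hermite_poly n x * (2 * real m * hermite_poly (m - 1) x) * exp (- x\<^sup>2) \<partial>lborel)"
    proof (rule hermite_poly_ibp)
      show "\<bar>hermite_poly m x\<bar> \<le> C * exp (x\<^sup>2 / 8)" for x using C[of x] by simp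
      show "\<bar>2 * real m * hermite_poly (m - 1) x\<bar> \<le> (2 * real m * D) * exp (x\<^sup>2 / 8)" for x
        using mult_left_mono[OF D[of x], of "2 * real m"] by (simp add: abs_mult mult.assoc)
    qed (rule hermite_poly_deriv, intro continuous_intros)
    also have "\<dots> = (\<integral>x. 2 * real m * (hermite_poly n x * hermite_poly (m - 1) x * exp (- x\<^sup>2)) \<partial>lborel)"
      by (simp add: algebra_simps)
    finally show ?thesis by (simp only: integral_mult_right_zero)
  qed
  have comm: "(\<integral>x. hermite_poly n x * hermite_poly m x * exp (- x\<^sup>2) \<partial>lborel) =
     (\<integral>x. hermite_poly m x * hermite_poly n x * exp (- x\<^sup>2) \<partial>lborel)" for n m
    by (simp add: mult.commute)
  show ?thesis
  proof (induction n arbitrary: m)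
    case 0
    show ?case
    proof (cases m)
      case 0
      then show ?thesis using gauss_integral_real[of 1 0] by (simp add: has_bochner_integral_iff)
    next
      case (Suc k)
      then show ?thesis using step[of k 0] by (subst comm) simp
    qed
  next
    case (Suc n)
    show ?case unfolding step Suc.IH by (cases m) auto
  qed
qed

definition hermite_norm :: "nat \<Rightarrow> real" where
  "hermite_norm n = sqrt (2 ^ n * fact n * sqrt pi)"

lemma hermite_norm_pos [simp]: "hermite_norm n > 0"
  by (simp add: hermite_norm_def)

lemma hermite_norm_square: "hermite_norm n * hermite_norm n = 2 ^ n * fact n * sqrt pi"
  by (simp add: hermite_norm_def flip: real_sqrt_mult)

lemma hermite_fun_eq: "hermite_fun n x = hermite_poly n x * exp (- x\<^sup>2 / 2) / hermite_norm n"
  by (simp add: hermite_fun_def hermite_norm_def)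

text \<open>Rate 1/4 for the polynomial uses up half of the Gaussian; the product of two such bounds
  is a multiple of the function in \<open>integrable_gauss\<close>.\<close>

lemma hermite_fun_bound: "\<exists>C\<ge>0. \<forall>x. \<bar>hermite_fun n x\<bar> \<le> C * exp (- x\<^sup>2 / 4)"
proof -
  obtain C where C: "C \<ge> 0" "\<And>x. \<bar>hermite_poly n x\<bar> \<le> C * exp (1/4 * x\<^sup>2)"
    using hermite_poly_bound[of "1/4" n] by auto
  have "\<bar>hermite_fun n x\<bar> \<le> (C / hermite_norm n) * exp (- x\<^sup>2 / 4)" for x
  proof -
    have "\<bar>hermite_fun n x\<bar> \<le> C * exp (1/4 * x\<^sup>2) * exp (- x\<^sup>2 / 2) / hermite_norm n"
      unfolding hermite_fun_eq using C(2)[of x]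
      by (simp add: abs_mult divide_right_mono less_imp_le)
    also have "\<dots> = (C / hermite_norm n) * (exp (1/4 * x\<^sup>2) * exp (- x\<^sup>2 / 2))"
      by simp
    also have "exp (1/4 * x\<^sup>2) * exp (- x\<^sup>2 / 2) = exp (- x\<^sup>2 / 4)"
      by (simp flip: exp_add)
    finally show ?thesis .
  qed
  then show ?thesis using C(1) by (intro exI[of _ "C / hermite_norm n"]) (auto simp: less_imp_le)
qed

lemma integrable_hermite_fun_mult: "integrable lborel (\<lambda>x. hermite_fun n x * hermite_fun m x)"
proof -
  obtain C where C: "C \<ge> 0" "\<And>x. \<bar>hermite_fun n x\<bar> \<le> C * exp (- x\<^sup>2 / 4)"
    using hermite_fun_bound by blast
  obtain D where D: "D \<ge> 0" "\<And>x. \<bar>hermite_fun m x\<bar> \<le> D * exp (- x\<^sup>2 / 4)"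
    using hermite_fun_bound by blast
  show ?thesis
  proof (rule integrable_gauss_bound)
    fix x
    have "norm (hermite_fun n x * hermite_fun m x) \<le> (C * exp (- x\<^sup>2 / 4)) * (D * exp (- x\<^sup>2 / 4))"
      unfolding real_norm_def abs_mult using C D by (intro mult_mono) auto
    also have "\<dots> = (C * D) * (exp (- x\<^sup>2 / 4) * exp (- x\<^sup>2 / 4))"
      by (simp only: mult_ac)
    also have "exp (- x\<^sup>2 / 4) * exp (- x\<^sup>2 / 4) = exp (- x\<^sup>2 / 2)"
      by (simp flip: exp_add)
    finally show "norm (hermite_fun n x * hermite_fun m x) \<le> (C * D) * exp (- x\<^sup>2 / 2)" .
  qed measurable
qed

lemma hermite_fun_orthonormal:
  "(\<integral>x. hermite_fun n x * hermite_fun m x \<partial>lborel) = (if n = m then 1 else 0)"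
proof -
  have "(\<integral>x. hermite_fun n x * hermite_fun m x \<partial>lborel) =
    (\<integral>x. (1 / (hermite_norm n * hermite_norm m)) * (hermite_poly n x * hermite_poly m x * exp (- x\<^sup>2)) \<partial>lborel)"
  proof (intro Bochner_Integration.integral_cong refl)
    fix x :: real
    have "exp (- x\<^sup>2) = exp (- x\<^sup>2 / 2) * exp (- x\<^sup>2 / 2)"
      by (simp flip: exp_add)
    then show "hermite_fun n x * hermite_fun m x =
        (1 / (hermite_norm n * hermite_norm m)) * (hermite_poly n x * hermite_poly m x * exp (- x\<^sup>2))"
      unfolding hermite_fun_eq by simp
  qed
  also have "\<dots> = (if n = m then 1 else 0)"
    unfolding integral_mult_right_zero hermite_poly_orthogonal
    by (auto simp: hermite_norm_square)
  finally show ?thesis .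
qed

text \<open>The generating function of the Hermite polynomials times the Gaussian, an unnormalised
  coherent state of the oscillator. The parameter is complex because the evolution rotates it and
  because imaginary parameters produce Fourier characters.\<close>

definition coherent :: "complex \<Rightarrow> real \<Rightarrow> complex" where
  "coherent w x = exp (- (of_real x)\<^sup>2 / 2 + 2 * w * of_real x - w\<^sup>2)"

text \<open>The Hermite polynomials are the Taylor coefficients at 0, up to factorials, of the
  entire function G. Differentiating G' = (2 x - 2 z) G repeatedly gives a recurrence that at z = 0
  is \<open>hermite_poly_Suc\<close>.\<close>

lemma hermite_generating_function:
  "(\<lambda>n. z ^ n / fact n * complex_of_real (hermite_poly n x)) sums exp (2 * z * of_real x - z\<^sup>2)"
proof -
  define G where "G = (\<lambda>z. exp (2 * z * complex_of_real x - z\<^sup>2))"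
  have hol: "G holomorphic_on A" for A
    unfolding G_def by (intro holomorphic_intros)
  have dG: "((deriv ^^ n) G has_field_derivative (deriv ^^ Suc n) G z) (at z)" for n z
    using holomorphic_higher_deriv[OF hol[of UNIV] open_UNIV, of n]
    by (simp add: holomorphic_derivI)
  have rec: "(deriv ^^ Suc n) G z = (2 * of_real x - 2 * z) * (deriv ^^ n) G z
      - 2 * of_nat n * (deriv ^^ (n - 1)) G z" for n z
  proof (induction n arbitrary: z)
    case 0
    have "(G has_field_derivative (2 * of_real x - 2 * z) * G z) (at z)"
      unfolding G_def by (auto intro!: derivative_eq_intros simp: algebra_simps)
    then show ?case by (simp add: DERIV_imp_deriv)
  next
    case (Suc n)
    have "((\<lambda>z. (2 * of_real x - 2 * z) * (deriv ^^ n) G z - 2 * of_nat n * (deriv ^^ (n - 1)) G z)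
      has_field_derivative (2 * of_real x - 2 * z) * (deriv ^^ Suc n) G z
      - 2 * of_nat (Suc n) * (deriv ^^ n) G z) (at z)"
      by (rule derivative_eq_intros dG refl)+ (cases n; simp add: algebra_simps)
    also have "(\<lambda>z. (2 * of_real x - 2 * z) * (deriv ^^ n) G z - 2 * of_nat n * (deriv ^^ (n - 1)) G z)
      = (deriv ^^ Suc n) G" using Suc by auto
    finally show ?case using DERIV_imp_deriv by fastforce
  qed
  have eq: "(deriv ^^ n) G 0 = complex_of_real (hermite_poly n x)" for n
  proof (induction n rule: less_induct)
    case (less n)
    show ?case
    proof (cases n)
      case 0
      then show ?thesis by (simp add: G_def)
    next
      case (Suc m)
      then have "(deriv ^^ m) G 0 = hermite_poly m x" "m \<noteq> 0 \<Longrightarrow> (deriv ^^ (m - 1)) G 0 = hermite_poly (m - 1) x"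
        using less[of m] less[of "m - 1"] by auto
      then show ?thesis
        unfolding Suc rec hermite_poly_Suc by (cases "m = 0") (simp_all del: funpow.simps)
    qed
  qed
  have "(\<lambda>n. (deriv ^^ n) G 0 / fact n * (z - 0) ^ n) sums G z"
    by (rule holomorphic_power_series[where r="norm z + 1"]) (auto intro: hol)
  then show ?thesis unfolding eq by (simp add: G_def mult.commute)
qed

section \<open>Hermite series\<close>

text \<open>A variant of \<open>L2\<close> over an arbitrary measure. It is used over
  \<open>lborel\<close> and its products, where Fubini's theorem applies; \<open>borel_rep\<close>
  later links it to \<open>L2\<close>.\<close>

definition square_integrable :: "'a measure \<Rightarrow> ('a \<Rightarrow> complex) \<Rightarrow> bool" where
  "square_integrable M f \<longleftrightarrow> f \<in> borel_measurable M \<and> integrable M (\<lambda>x. (norm (f x))\<^sup>2)"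

lemma square_integrableD [dest]:
  "square_integrable M f \<Longrightarrow> f \<in> borel_measurable M"
  "square_integrable M f \<Longrightarrow> integrable M (\<lambda>x. (norm (f x))\<^sup>2)"
  by (auto simp: square_integrable_def)

lemma square_integrable_bound:
  assumes "integrable M g" "f \<in> borel_measurable M" "\<And>x. (norm (f x))\<^sup>2 \<le> g x"
  shows "square_integrable M f"
  unfolding square_integrable_def
  using assms by (auto intro!: Bochner_Integration.integrable_bound[OF assms(1)] order.trans[OF assms(3) abs_ge_self])

lemma norm_add_square_le: "(norm (a + b))\<^sup>2 \<le> 2 * (norm a)\<^sup>2 + 2 * (norm (b :: 'a :: real_normed_vector))\<^sup>2"
proof -
  have "(norm (a + b))\<^sup>2 \<le> (norm a + norm b)\<^sup>2"
    by (intro power_mono norm_triangle_ineq norm_ge_zero)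
  also have "\<dots> \<le> 2 * (norm a)\<^sup>2 + 2 * (norm b)\<^sup>2"
    using sum_squares_bound[of "norm a" "norm b"] by (simp add: power2_sum)
  finally show ?thesis .
qed

lemma square_integrable_add:
  assumes "square_integrable M f" "square_integrable M g"
  shows "square_integrable M (\<lambda>x. f x + g x)"
proof (rule square_integrable_bound)
  show "integrable M (\<lambda>x. 2 * (norm (f x))\<^sup>2 + 2 * (norm (g x))\<^sup>2)"
    using assms by (auto simp: square_integrable_def)
  show "(\<lambda>x. f x + g x) \<in> borel_measurable M"
    using assms by (auto simp: square_integrable_def)
qed (rule norm_add_square_le)

lemma square_integrable_mult:
  "square_integrable M f \<Longrightarrow> square_integrable M (\<lambda>x. a * f x)"
  by (auto simp: square_integrable_def norm_mult power_mult_distrib)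

lemma borel_measurable_cnj [measurable]: "cnj \<in> borel_measurable borel"
  by (intro borel_measurable_continuous_onI continuous_intros)

lemma square_integrable_cnj:
  "square_integrable M f \<Longrightarrow> square_integrable M (\<lambda>x. cnj (f x))"
  unfolding square_integrable_def complex_mod_cnj by (auto intro: measurable_compose[OF _ borel_measurable_cnj])

lemma square_integrable_diff:
  assumes "square_integrable M f" "square_integrable M g"
  shows "square_integrable M (\<lambda>x. f x - g x)"
  using square_integrable_add[OF assms(1) square_integrable_mult[OF assms(2), of "-1"]] by simp

lemma square_integrable_zero [simp]: "square_integrable M (\<lambda>x. 0)"
  by (simp add: square_integrable_def)

lemma square_integrable_sum:
  "(\<And>n. n \<in> A \<Longrightarrow> square_integrable M (f n)) \<Longrightarrow> square_integrable M (\<lambda>x. \<Sum>n\<in>A. f n x)"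
  by (induction A rule: infinite_finite_induct) (auto intro: square_integrable_add)

lemma square_integrable_nn:
  assumes "f \<in> borel_measurable M" "(\<integral>\<^sup>+x. ennreal ((norm (f x))\<^sup>2) \<partial>M) < \<infinity>"
  shows "square_integrable M f"
  unfolding square_integrable_def using assms by (auto intro!: integrableI_bounded)

lemma nn_integral_square:
  assumes "square_integrable M f"
  shows "(\<integral>\<^sup>+x. ennreal ((norm (f x))\<^sup>2) \<partial>M) = ennreal (\<integral>x. (norm (f x))\<^sup>2 \<partial>M)"
  using assms by (intro nn_integral_eq_integral) (auto simp: square_integrable_def)

lemma square_integrable_product:
  assumes "square_integrable M f" "square_integrable M g"
  shows "integrable M (\<lambda>x. f x * g x)"
proof (rule Bochner_Integration.integrable_bound)
  show "integrable M (\<lambda>x. (norm (f x))\<^sup>2 + (norm (g x))\<^sup>2)"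
    using assms by (auto simp: square_integrable_def)
  show "(\<lambda>x. f x * g x) \<in> borel_measurable M"
    using assms by (auto simp: square_integrable_def)
  have "norm (f x * g x) \<le> norm ((norm (f x))\<^sup>2 + (norm (g x))\<^sup>2)" for x
  proof -
    have "2 * norm (f x) * norm (g x) \<le> (norm (f x))\<^sup>2 + (norm (g x))\<^sup>2"
      by (rule sum_squares_bound)
    moreover have "0 \<le> norm (f x) * norm (g x)" by simp
    ultimately have "norm (f x * g x) \<le> (norm (f x))\<^sup>2 + (norm (g x))\<^sup>2"
      unfolding norm_mult by linarith
    then show ?thesis by simp
  qed
  then show "AE x in M. norm (f x * g x) \<le> norm ((norm (f x))\<^sup>2 + (norm (g x))\<^sup>2)" by simp
qed

lemma Cauchy_Schwarz_integral:
  assumes f: "square_integrable M f" and g: "square_integrable M g"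
  shows "(norm (\<integral>x. f x * g x \<partial>M))\<^sup>2 \<le> (\<integral>x. (norm (f x))\<^sup>2 \<partial>M) * (\<integral>x. (norm (g x))\<^sup>2 \<partial>M)"
proof -
  have [measurable]: "f \<in> borel_measurable M" "g \<in> borel_measurable M"
    using assms by auto
  have "ennreal (norm (\<integral>x. f x * g x \<partial>M)) \<le> (\<integral>\<^sup>+x. ennreal (norm (f x)) * ennreal (norm (g x)) \<partial>M)"
    using integral_norm_bound_ennreal[OF square_integrable_product[OF assms]]
    by (simp add: norm_mult ennreal_mult)
  then have "(ennreal (norm (\<integral>x. f x * g x \<partial>M)))\<^sup>2 \<le> (\<integral>\<^sup>+x. ennreal (norm (f x)) * ennreal (norm (g x)) \<partial>M)\<^sup>2"
    by (rule power_mono) simp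
  also have "\<dots> \<le> (\<integral>\<^sup>+x. (ennreal (norm (f x)))\<^sup>2 \<partial>M) * (\<integral>\<^sup>+x. (ennreal (norm (g x)))\<^sup>2 \<partial>M)"
    by (rule Cauchy_Schwarz_nn_integral) measurable
  also have "\<dots> = ennreal ((\<integral>x. (norm (f x))\<^sup>2 \<partial>M) * (\<integral>x. (norm (g x))\<^sup>2 \<partial>M))"
    by (simp add: ennreal_power nn_integral_square[OF f] nn_integral_square[OF g] ennreal_mult)
  finally show ?thesis
    by (simp add: ennreal_power)
qed

lemma square_integral_cnj:
  "complex_of_real (\<integral>x. (norm (f x))\<^sup>2 \<partial>M) = (\<integral>x. f x * cnj (f x) \<partial>M)"
  by (simp add: complex_norm_square[symmetric] flip: of_real_power)

section \<open>Finite Hermite sums, coefficients and Bessel's identity\<close>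

definition hermite_sum :: "(nat \<Rightarrow> complex) \<Rightarrow> nat set \<Rightarrow> real \<Rightarrow> real \<Rightarrow> complex" where
  "hermite_sum c A t x = (\<Sum>n\<in>A. cis (t * (2 * real n + 1)) * c n * complex_of_real (hermite_fun n x))"

text \<open>The integrand has no conjugate because Hermite functions are real;
  \<open>L2_inner_hermite\<close> identifies this with the coefficient used by
  \<open>propagator\<close>.\<close>

definition coef :: "(real \<Rightarrow> complex) \<Rightarrow> nat \<Rightarrow> complex" where
  "coef f n = (\<integral>x. f x * complex_of_real (hermite_fun n x) \<partial>lborel)"

lemma measurable_hermite_sum [measurable]:
  "(\<lambda>(t, x). hermite_sum c A t x) \<in> borel_measurable (borel \<Otimes>\<^sub>M borel)"
  "hermite_sum c A t \<in> borel_measurable borel"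
  unfolding hermite_sum_def[abs_def] cis_conv_exp by measurable

lemma square_integrable_hermite: "square_integrable lborel (\<lambda>x. complex_of_real (hermite_fun n x))"
  using integrable_hermite_fun_mult[of n n] by (auto simp: square_integrable_def power2_eq_square)

lemma square_integrable_hermite_sum: "square_integrable lborel (hermite_sum c A t)"
  unfolding hermite_sum_def[abs_def]
  by (intro square_integrable_sum square_integrable_mult square_integrable_hermite)

lemma coef_hermite: "coef (\<lambda>x. complex_of_real (hermite_fun n x)) m = (if n = m then 1 else 0)"
  using hermite_fun_orthonormal[of n m] unfolding coef_def
  by (simp flip: of_real_mult) 

lemma coef_add:
  assumes "square_integrable lborel f" "square_integrable lborel g"
  shows "coef (\<lambda>x. f x + g x) n = coef f n + coef g n"
  using assms[THEN square_integrable_product, OF square_integrable_hermite[of n]]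
  by (simp add: coef_def distrib_right)

lemma coef_mult: "coef (\<lambda>x. a * f x) n = a * coef f n"
  by (simp add: coef_def mult.assoc)

lemma coef_diff:
  assumes "square_integrable lborel f" "square_integrable lborel g"
  shows "coef (\<lambda>x. f x - g x) n = coef f n - coef g n"
  using assms[THEN square_integrable_product, OF square_integrable_hermite[of n]]
  by (simp add: coef_def left_diff_distrib)

lemma coef_hermite_sum:
  assumes "finite A"
  shows "coef (hermite_sum c A t) m = (if m \<in> A then cis (t * (2 * real m + 1)) * c m else 0)"
proof -
  have "coef (hermite_sum c A t) m =
    (\<Sum>n\<in>A. coef (\<lambda>x. cis (t * (2 * real n + 1)) * c n * complex_of_real (hermite_fun n x)) m)"
    unfolding coef_def hermite_sum_def sum_distrib_right
    by (intro Bochner_Integration.integral_sum square_integrable_product square_integrable_mult square_integrable_hermite)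
  also have "\<dots> = (\<Sum>n\<in>A. if n = m then cis (t * (2 * real n + 1)) * c n else 0)"
    unfolding coef_mult coef_hermite by (intro sum.cong) auto
  finally show ?thesis using assms by simp
qed

lemma coef_bound:
  assumes "square_integrable lborel f"
  shows "(norm (coef f n))\<^sup>2 \<le> (\<integral>x. (norm (f x))\<^sup>2 \<partial>lborel)"
proof -
  have "(\<integral>x. (norm (complex_of_real (hermite_fun n x)))\<^sup>2 \<partial>lborel) = 1"
    using hermite_fun_orthonormal[of n n] by (simp add: power2_eq_square)
  then show ?thesis
    using Cauchy_Schwarz_integral[OF assms square_integrable_hermite[of n]] by (simp add: coef_def)
qed

lemma integral_mult_hermite_sum:
  assumes "square_integrable lborel f"
  shows "(\<integral>x. f x * hermite_sum c A t x \<partial>lborel) = (\<Sum>n\<in>A. cis (t * (2 * real n + 1)) * c n * coef f n)"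
proof -
  have "(\<integral>x. f x * hermite_sum c A t x \<partial>lborel) =
     (\<integral>x. (\<Sum>n\<in>A. cis (t * (2 * real n + 1)) * c n * (f x * complex_of_real (hermite_fun n x))) \<partial>lborel)"
    unfolding hermite_sum_def sum_distrib_left by (simp add: algebra_simps)
  also have "\<dots> = (\<Sum>n\<in>A. (\<integral>x. cis (t * (2 * real n + 1)) * c n * (f x * complex_of_real (hermite_fun n x)) \<partial>lborel))"
    by (intro Bochner_Integration.integral_sum integrable_mult_right square_integrable_product square_integrable_hermite assms)
  finally show ?thesis by (simp add: coef_def)
qed

lemma cnj_hermite_sum: "cnj (hermite_sum c A t x) = hermite_sum (\<lambda>n. cnj (c n)) A (- t) x"
  by (simp add: hermite_sum_def cis_cnj)

lemma norm_hermite_sum: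
  assumes "finite A"
  shows "(\<integral>x. (norm (hermite_sum c A t x))\<^sup>2 \<partial>lborel) = (\<Sum>n\<in>A. (norm (c n))\<^sup>2)"
proof -
  have "complex_of_real (\<integral>x. (norm (hermite_sum c A t x))\<^sup>2 \<partial>lborel) =
     (\<Sum>n\<in>A. cis (- t * (2 * real n + 1)) * cnj (c n) * (cis (t * (2 * real n + 1)) * c n))"
    unfolding square_integral_cnj cnj_hermite_sum
      integral_mult_hermite_sum[OF square_integrable_hermite_sum] coef_hermite_sum[OF assms]
    by (intro sum.cong) auto
  also have "\<dots> = (\<Sum>n\<in>A. complex_of_real ((norm (c n))\<^sup>2))"
  proof (intro sum.cong refl)
    fix n
    have "cis (- t * (2 * real n + 1)) * cis (t * (2 * real n + 1)) = 1"
      by (simp add: cis_mult)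
    then have "cis (- t * (2 * real n + 1)) * cnj (c n) * (cis (t * (2 * real n + 1)) * c n) = c n * cnj (c n)"
      using mult.assoc[of "cis (- t * (2 * real n + 1)) * cis (t * (2 * real n + 1))" "c n" "cnj (c n)"]
      by (simp add: mult_ac)
    then show "cis (- t * (2 * real n + 1)) * cnj (c n) * (cis (t * (2 * real n + 1)) * c n) = complex_of_real ((norm (c n))\<^sup>2)"
      by (simp only: complex_norm_square)
  qed
  finally show ?thesis unfolding of_real_sum[symmetric] of_real_eq_iff .
qed

text \<open>When the square is expanded, both cross terms and the norm of the partial sum equal the
  sum of the squared moduli of the coefficients.\<close>

lemma Bessel:
  assumes f: "square_integrable lborel f"
  shows "(\<integral>x. (norm (f x - hermite_sum (coef f) {..<N} 0 x))\<^sup>2 \<partial>lborel) =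
     (\<integral>x. (norm (f x))\<^sup>2 \<partial>lborel) - (\<Sum>n<N. (norm (coef f n))\<^sup>2)"
proof -
  let ?S = "hermite_sum (coef f) {..<N} 0"
  note S = square_integrable_hermite_sum[of "coef f" "{..<N}" 0]
  note ints = square_integrable_product[OF f square_integrable_cnj[OF f]] square_integrable_product[OF f square_integrable_cnj[OF S]]
    square_integrable_product[OF S square_integrable_cnj[OF f]] square_integrable_product[OF S square_integrable_cnj[OF S]]
  have fS: "(\<integral>x. f x * cnj (?S x) \<partial>lborel) = complex_of_real (\<Sum>n<N. (norm (coef f n))\<^sup>2)"
    unfolding cnj_hermite_sum integral_mult_hermite_sum[OF f]
    unfolding of_real_sum
    by (intro sum.cong refl) (simp add: complex_norm_square[symmetric] mult.commute)
  have "(\<integral>x. ?S x * cnj (f x) \<partial>lborel) = (\<integral>x. cnj (f x * cnj (?S x)) \<partial>lborel)"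
    by (simp only: complex_cnj_mult complex_cnj_cnj mult.commute)
  also have "\<dots> = cnj (\<integral>x. f x * cnj (?S x) \<partial>lborel)"
    by (rule Bochner_Integration.integral_cnj)
  finally have "(\<integral>x. ?S x * cnj (f x) \<partial>lborel) = cnj (\<integral>x. f x * cnj (?S x) \<partial>lborel)" .
  then have Sf: "(\<integral>x. ?S x * cnj (f x) \<partial>lborel) = complex_of_real (\<Sum>n<N. (norm (coef f n))\<^sup>2)"
    unfolding fS by simp
  have SS: "(\<integral>x. ?S x * cnj (?S x) \<partial>lborel) = complex_of_real (\<Sum>n<N. (norm (coef f n))\<^sup>2)"
    unfolding square_integral_cnj[symmetric] norm_hermite_sum[OF finite_lessThan] ..
  have "complex_of_real (\<integral>x. (norm (f x - ?S x))\<^sup>2 \<partial>lborel) =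
    (\<integral>x. f x * cnj (f x) - f x * cnj (?S x) - (?S x * cnj (f x) - ?S x * cnj (?S x)) \<partial>lborel)"
    unfolding square_integral_cnj by (simp add: algebra_simps)
  also have "\<dots> = complex_of_real (\<integral>x. (norm (f x))\<^sup>2 \<partial>lborel) - complex_of_real (\<Sum>n<N. (norm (coef f n))\<^sup>2)"
    using ints by (simp add: fS Sf SS square_integral_cnj)
  finally show ?thesis unfolding of_real_diff[symmetric] of_real_eq_iff .
qed

lemma summable_coef:
  assumes f: "square_integrable lborel f"
  shows "summable (\<lambda>n. (norm (coef f n))\<^sup>2)"
    and "(\<Sum>n. (norm (coef f n))\<^sup>2) \<le> (\<integral>x. (norm (f x))\<^sup>2 \<partial>lborel)"
proof -
  have le: "(\<Sum>n<N. (norm (coef f n))\<^sup>2) \<le> (\<integral>x. (norm (f x))\<^sup>2 \<partial>lborel)" for N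
    using Bessel[OF f, of N] Bochner_Integration.integral_nonneg[of lborel "\<lambda>x. (norm (f x - hermite_sum (coef f) {..<N} 0 x))\<^sup>2"]
    by simp
  show s: "summable (\<lambda>n. (norm (coef f n))\<^sup>2)"
    by (rule summableI_nonneg_bounded[OF _ le]) simp
  show "(\<Sum>n. (norm (coef f n))\<^sup>2) \<le> (\<integral>x. (norm (f x))\<^sup>2 \<partial>lborel)"
    by (rule suminf_le_const[OF s le])
qed

definition tail :: "(nat \<Rightarrow> complex) \<Rightarrow> nat \<Rightarrow> real" where
  "tail c N = (\<Sum>n. (norm (c (n + N)))\<^sup>2)"

lemma tail_tendsto_0:
  assumes "summable (\<lambda>n. (norm (c n))\<^sup>2)"
  shows "tail c \<longlonglongrightarrow> 0"
  unfolding tail_def[abs_def] using suminf_exist_split2[OF assms] by simp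

lemma summable_shift: "summable f \<Longrightarrow> summable (\<lambda>n. f (n + N :: nat) :: real)"
  by (rule summable_ignore_initial_segment)

lemma tail_nonneg: "summable (\<lambda>n. (norm (c n))\<^sup>2) \<Longrightarrow> 0 \<le> tail c N"
  unfolding tail_def by (intro suminf_nonneg summable_shift[of "\<lambda>n. (norm (c n))\<^sup>2"]) auto

lemma norm_hermite_sum_diff_le:
  assumes s: "summable (\<lambda>n. (norm (c n))\<^sup>2)" and "N \<le> K"
  shows "(\<integral>x. (norm (hermite_sum c {..<K} t x - hermite_sum c {..<N} t x))\<^sup>2 \<partial>lborel) \<le> tail c N"
proof -
  have "hermite_sum c {..<K} t x - hermite_sum c {..<N} t x = hermite_sum c {N..<K} t x" for x
    unfolding hermite_sum_def using \<open>N \<le> K\<close>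
    by (subst sum_diff[symmetric]) (auto intro!: sum.cong)
  then have "(\<integral>x. (norm (hermite_sum c {..<K} t x - hermite_sum c {..<N} t x))\<^sup>2 \<partial>lborel) =
      (\<Sum>n\<in>{N..<K}. (norm (c n))\<^sup>2)"
    by (simp add: norm_hermite_sum)
  also have "\<dots> = (\<Sum>n<K - N. (norm (c (n + N)))\<^sup>2)"
    using sum.shift_bounds_nat_ivl[of "\<lambda>n. (norm (c n))\<^sup>2" 0 N "K - N"] \<open>N \<le> K\<close>
    by (simp add: lessThan_atLeast0)
  also have "\<dots> \<le> tail c N"
    unfolding tail_def by (intro sum_le_suminf summable_shift[of "\<lambda>n. (norm (c n))\<^sup>2"] s) auto
  finally show ?thesis .
qed

text \<open>The bound on \<open>tail\<close> does not involve the time, so one subsequence converges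
  fast enough at all times at once. This uniformity lets the pointwise limit be jointly
  measurable.\<close>

definition subseq_of :: "(nat \<Rightarrow> complex) \<Rightarrow> nat \<Rightarrow> nat" where
  "subseq_of c = (SOME r. strict_mono r \<and> (\<forall>k. tail c (r k) \<le> (1/4) ^ k))"

lemma subseq_of:
  assumes "summable (\<lambda>n. (norm (c n))\<^sup>2)"
  shows "strict_mono (subseq_of c)" "tail c (subseq_of c k) \<le> (1/4) ^ k"
proof -
  have ev: "eventually (\<lambda>N. tail c N \<le> (1/4) ^ k) sequentially" for k
    using order_tendstoD(2)[OF tail_tendsto_0[OF assms], of "(1/4)^k"] by (auto elim: eventually_mono)
  have "\<exists>N>m. tail c N \<le> (1/4) ^ k" for m k
    using eventually_happens[OF eventually_conj[OF ev[of k] eventually_gt_at_top[of m]]] by auto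
  then have "\<exists>r. strict_mono r \<and> (\<forall>k. tail c (r k) \<le> (1/4) ^ k)"
    using dependent_nat_choice[of "\<lambda>k N. tail c N \<le> (1/4) ^ k" "\<lambda>k N M. N < M"]
    unfolding strict_mono_Suc_iff by blast
  from someI_ex[OF this] show "strict_mono (subseq_of c)" "tail c (subseq_of c k) \<le> (1/4) ^ k"
    unfolding subseq_of_def by auto
qed

text \<open>
  A representative of the \<open>L\<^sup>2\<close>-limit of the Hermite series which is jointly measurable in
  time and space: along \<open>subseq_of\<close> the partial sums converge almost everywhere for each time.
\<close>

definition flowc :: "(nat \<Rightarrow> complex) \<Rightarrow> real \<Rightarrow> real \<Rightarrow> complex" where
  "flowc c t x = lim (\<lambda>k. hermite_sum c {..<subseq_of c k} t x)"

lemma measurable_flowc [measurable]: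
  "(\<lambda>(t, x). flowc c t x) \<in> borel_measurable (borel \<Otimes>\<^sub>M borel)"
  "flowc c t \<in> borel_measurable borel"
proof -
  have "(\<lambda>p. lim (\<lambda>k. (case p of (t, x) \<Rightarrow> hermite_sum c {..<subseq_of c k} t x))) \<in> borel_measurable (borel \<Otimes>\<^sub>M borel)"
    by (intro borel_measurable_lim_metric measurable_hermite_sum)
  then show "(\<lambda>(t, x). flowc c t x) \<in> borel_measurable (borel \<Otimes>\<^sub>M borel)"
    by (simp add: flowc_def split_beta')
  show "flowc c t \<in> borel_measurable borel"
    unfolding flowc_def[abs_def] by (intro borel_measurable_lim_metric measurable_hermite_sum)
qed

text \<open>The Riesz-Fischer argument. Consecutive sums along the subsequence differ by at most
  4^(-k) in squared norm, so the series of squared increments weighted by 2^k is still integrable;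
  where it is finite, the increments are dominated by a geometric sequence of ratio 1 / sqrt
  2.\<close>

lemma hermite_sum_convergent_AE:
  assumes s: "summable (\<lambda>n. (norm (c n))\<^sup>2)"
  shows "AE x in lborel. (\<lambda>k. hermite_sum c {..<subseq_of c k} t x) \<longlonglongrightarrow> flowc c t x"
proof -
  define r where "r = subseq_of c"
  define d where "d k x = hermite_sum c {..<r (Suc k)} t x - hermite_sum c {..<r k} t x" for k x
  have [measurable]: "d k \<in> borel_measurable borel" for k
    unfolding d_def[abs_def] by measurable
  have mono: "r k \<le> r (Suc k)" for k
    using subseq_of(1)[OF s] by (simp add: r_def strict_mono_less_eq)
  have sqd: "square_integrable lborel (d k)" for k
    unfolding d_def[abs_def] by (intro square_integrable_diff square_integrable_hermite_sum)
  have d: "(\<integral>\<^sup>+x. ennreal ((norm (d k x))\<^sup>2) \<partial>lborel) \<le> ennreal ((1/4) ^ k)" for k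
    unfolding nn_integral_square[OF sqd]
    using norm_hermite_sum_diff_le[OF s mono[of k], of t] subseq_of(2)[OF s, of k]
    by (intro ennreal_leI) (simp add: d_def r_def)
  have "(\<integral>\<^sup>+x. (\<Sum>k. ennreal (2 ^ k) * ennreal ((norm (d k x))\<^sup>2)) \<partial>lborel) =
      (\<Sum>k. ennreal (2 ^ k) * (\<integral>\<^sup>+x. ennreal ((norm (d k x))\<^sup>2) \<partial>lborel))"
    by (subst nn_integral_suminf) (auto simp: nn_integral_cmult)
  also have "\<dots> \<le> (\<Sum>k. ennreal ((1/2) ^ k))"
  proof (intro suminf_le allI)
    fix k
    have "ennreal (2 ^ k) * (\<integral>\<^sup>+x. ennreal ((norm (d k x))\<^sup>2) \<partial>lborel) \<le> ennreal (2 ^ k) * ennreal ((1/4) ^ k)"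
      by (intro mult_left_mono d) auto
    also have "\<dots> = ennreal ((1/2) ^ k)"
      by (simp add: ennreal_mult[symmetric] power_mult_distrib[symmetric])
    finally show "ennreal (2 ^ k) * (\<integral>\<^sup>+x. ennreal ((norm (d k x))\<^sup>2) \<partial>lborel) \<le> ennreal ((1/2) ^ k)" .
  qed auto
  also have "\<dots> = ennreal (\<Sum>k. (1/2) ^ k)"
    by (intro suminf_ennreal2) auto
  also have "\<dots> < \<infinity>" by simp
  finally have fin: "AE x in lborel. (\<Sum>k. ennreal (2 ^ k) * ennreal ((norm (d k x))\<^sup>2)) \<noteq> \<infinity>"
    by (intro nn_integral_noteq_infinite) (auto simp: top.not_eq_extremum)
  show ?thesis
    using fin
  proof eventually_elim
    fix x assume x: "(\<Sum>k. ennreal (2 ^ k) * ennreal ((norm (d k x))\<^sup>2)) \<noteq> \<infinity>"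
    define B where "B = enn2real (\<Sum>k. ennreal (2 ^ k) * ennreal ((norm (d k x))\<^sup>2))"
    have B: "ennreal B = (\<Sum>k. ennreal (2 ^ k) * ennreal ((norm (d k x))\<^sup>2))" "B \<ge> 0"
      using x by (simp_all add: B_def less_top)
    have dB: "norm (d k x) \<le> sqrt B * (1 / sqrt 2) ^ k" for k
    proof -
      have "ennreal (2 ^ k) * ennreal ((norm (d k x))\<^sup>2) \<le> ennreal B"
        unfolding B(1) using sum_le_suminf[of "\<lambda>k. ennreal (2 ^ k) * ennreal ((norm (d k x))\<^sup>2)" "{k}"] by auto
      then have "2 ^ k * (norm (d k x))\<^sup>2 \<le> B"
        using B(2) by (simp add: ennreal_mult[symmetric])
      then have "(sqrt 2 ^ k * norm (d k x))\<^sup>2 \<le> B"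
        by (simp add: power_mult_distrib power_commutes flip: power_mult) (simp add: power_mult mult.commute[of k])
      then have "sqrt 2 ^ k * norm (d k x) \<le> sqrt B"
        by (rule real_le_rsqrt)
      then show ?thesis by (simp add: power_divide field_simps)
    qed
    have "summable (\<lambda>k. sqrt B * (1 / sqrt 2) ^ k)"
      by (intro summable_mult summable_geometric) auto
    then have "summable (\<lambda>k. d k x)"
      by (rule summable_comparison_test'[of _ 0]) (use dB in auto)
    then have "convergent (\<lambda>K. \<Sum>k<K. d k x)"
      by (simp add: summable_iff_convergent)
    then have "convergent (\<lambda>K. (\<Sum>k<K. d k x) + hermite_sum c {..<r 0} t x)"
      by (intro convergent_add convergent_const)
    also have "(\<lambda>K. (\<Sum>k<K. d k x) + hermite_sum c {..<r 0} t x) = (\<lambda>k. hermite_sum c {..<r k} t x)"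
      unfolding d_def by (subst sum_lessThan_telescope) simp
    finally show "(\<lambda>k. hermite_sum c {..<subseq_of c k} t x) \<longlonglongrightarrow> flowc c t x"
      unfolding flowc_def r_def by (simp add: convergent_LIMSEQ_iff)
  qed
qed

lemma flowc_eqI:
  assumes s: "summable (\<lambda>n. (norm (c n))\<^sup>2)" and lim: "(\<lambda>N. hermite_sum c {..<N} t x) \<longlonglongrightarrow> u"
  shows "flowc c t x = u"
  unfolding flowc_def
  using LIMSEQ_subseq_LIMSEQ[OF lim subseq_of(1)[OF s]] by (auto simp: o_def intro: limI)

text \<open>Fatou's lemma along the subsequence: for indices beyond N the difference of the two
  partial sums is controlled by \<open>tail c N\<close>, whether or not N belongs to the
  subsequence.\<close>

lemma flowc_error:
  assumes s: "summable (\<lambda>n. (norm (c n))\<^sup>2)"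
  shows "(\<integral>\<^sup>+x. ennreal ((norm (flowc c t x - hermite_sum c {..<N} t x))\<^sup>2) \<partial>lborel) \<le> ennreal (tail c N)"
proof -
  define r where "r = subseq_of c"
  let ?g = "\<lambda>k x. ennreal ((norm (hermite_sum c {..<r k} t x - hermite_sum c {..<N} t x))\<^sup>2)"
  have "(\<integral>\<^sup>+x. ennreal ((norm (flowc c t x - hermite_sum c {..<N} t x))\<^sup>2) \<partial>lborel) \<le> (\<integral>\<^sup>+x. liminf (\<lambda>k. ?g k x) \<partial>lborel)"
  proof (rule nn_integral_mono_AE)
    show "AE x in lborel. ennreal ((norm (flowc c t x - hermite_sum c {..<N} t x))\<^sup>2) \<le> liminf (\<lambda>k. ?g k x)"
      using hermite_sum_convergent_AE[OF s, of t]
    proof eventually_elim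
      fix x assume "(\<lambda>k. hermite_sum c {..<subseq_of c k} t x) \<longlonglongrightarrow> flowc c t x"
      then have "(\<lambda>k. ?g k x) \<longlonglongrightarrow> ennreal ((norm (flowc c t x - hermite_sum c {..<N} t x))\<^sup>2)"
        unfolding r_def by (intro tendsto_intros tendsto_ennrealI)
      then have "liminf (\<lambda>k. ?g k x) = ennreal ((norm (flowc c t x - hermite_sum c {..<N} t x))\<^sup>2)"
        by (intro lim_imp_Liminf) auto
      then show "ennreal ((norm (flowc c t x - hermite_sum c {..<N} t x))\<^sup>2) \<le> liminf (\<lambda>k. ?g k x)" by simp
    qed
  qed
  also have "\<dots> \<le> liminf (\<lambda>k. \<integral>\<^sup>+x. ?g k x \<partial>lborel)"
    by (rule nn_integral_liminf) measurable
  also have "\<dots> \<le> ennreal (tail c N)"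
  proof (rule Liminf_le)
    have "r k \<ge> N \<Longrightarrow> (\<integral>\<^sup>+x. ?g k x \<partial>lborel) \<le> ennreal (tail c N)" for k
      by (subst nn_integral_square[OF square_integrable_diff[OF square_integrable_hermite_sum square_integrable_hermite_sum]])
        (intro ennreal_leI norm_hermite_sum_diff_le s)
    moreover have "r k \<ge> k" for k
      unfolding r_def by (rule seq_suble[OF subseq_of(1)[OF s]])
    ultimately show "\<forall>\<^sub>F k in sequentially. (\<integral>\<^sup>+x. ?g k x \<partial>lborel) \<le> ennreal (tail c N)"
      by (intro eventually_sequentiallyI[of N]) (meson order.trans)
  qed simp
  finally show ?thesis .
qed

lemma square_integrable_flowc:
  assumes s: "summable (\<lambda>n. (norm (c n))\<^sup>2)"
  shows "square_integrable lborel (flowc c t)"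
    and "(\<integral>x. (norm (flowc c t x))\<^sup>2 \<partial>lborel) \<le> (\<Sum>n. (norm (c n))\<^sup>2)"
proof -
  have le: "(\<integral>\<^sup>+x. ennreal ((norm (flowc c t x))\<^sup>2) \<partial>lborel) \<le> ennreal (\<Sum>n. (norm (c n))\<^sup>2)"
    using flowc_error[OF s, of t 0] by (simp add: hermite_sum_def tail_def)
  show *: "square_integrable lborel (flowc c t)"
    by (rule square_integrable_nn) (use le in \<open>auto simp: order_le_less_trans\<close>)
  show "(\<integral>x. (norm (flowc c t x))\<^sup>2 \<partial>lborel) \<le> (\<Sum>n. (norm (c n))\<^sup>2)"
    using le s unfolding nn_integral_square[OF *] by (simp add: suminf_nonneg)
qed

lemma flowc_error':
  assumes s: "summable (\<lambda>n. (norm (c n))\<^sup>2)"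
  shows "(\<integral>x. (norm (flowc c t x - hermite_sum c {..<N} t x))\<^sup>2 \<partial>lborel) \<le> tail c N"
  using flowc_error[OF s, of t N] tail_nonneg[OF s]
  unfolding nn_integral_square[OF square_integrable_diff[OF square_integrable_flowc(1)[OF s] square_integrable_hermite_sum]]
  by simp

lemma square_integral_eq_0:
  assumes "square_integrable M f" "(\<integral>x. (norm (f x))\<^sup>2 \<partial>M) \<le> 0"
  shows "AE x in M. f x = 0"
proof -
  have "(\<integral>x. (norm (f x))\<^sup>2 \<partial>M) = 0"
    using assms(2) by (intro antisym) auto
  then show ?thesis
    using integral_nonneg_eq_0_iff_AE[of M "\<lambda>x. (norm (f x))\<^sup>2"] assms(1) by auto
qed

text \<open>Uniqueness of L^2-limits. It identifies the function chosen in \<open>propagator\<close>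
  and, in \<open>flow_linear\<close>, a combination of limits taken along different
  subsequences.\<close>

lemma flowc_unique:
  assumes s: "summable (\<lambda>n. (norm (c n))\<^sup>2)" and u: "square_integrable lborel u"
    and lim: "(\<lambda>N. \<integral>x. (norm (u x - hermite_sum c {..<N} t x))\<^sup>2 \<partial>lborel) \<longlonglongrightarrow> 0"
  shows "AE x in lborel. u x = flowc c t x"
proof -
  let ?I = "\<integral>x. (norm (u x - flowc c t x))\<^sup>2 \<partial>lborel"
  have "?I \<le> 2 * (\<integral>x. (norm (u x - hermite_sum c {..<N} t x))\<^sup>2 \<partial>lborel) + 2 * tail c N" for N
  proof -
    let ?a = "\<lambda>x. u x - hermite_sum c {..<N} t x" and ?b = "\<lambda>x. flowc c t x - hermite_sum c {..<N} t x"
    have a: "square_integrable lborel ?a" and b: "square_integrable lborel ?b"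
      using u s by (auto intro!: square_integrable_diff square_integrable_hermite_sum square_integrable_flowc)
    have "?I \<le> (\<integral>x. 2 * (norm (?a x))\<^sup>2 + 2 * (norm (?b x))\<^sup>2 \<partial>lborel)"
    proof (rule integral_mono)
      show "integrable lborel (\<lambda>x. (norm (u x - flowc c t x))\<^sup>2)"
        using square_integrable_diff[OF u square_integrable_flowc(1)[OF s]] by auto
      show "(norm (u x - flowc c t x))\<^sup>2 \<le> 2 * (norm (?a x))\<^sup>2 + 2 * (norm (?b x))\<^sup>2" for x
        using norm_add_square_le[of "?a x" "- ?b x"] by (simp add: norm_minus_commute)
    qed (use a b in \<open>auto simp: square_integrable_def\<close>)
    also have "\<dots> = 2 * (\<integral>x. (norm (?a x))\<^sup>2 \<partial>lborel) + 2 * (\<integral>x. (norm (?b x))\<^sup>2 \<partial>lborel)"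
      using a b by (simp add: square_integrable_def)
    finally show ?thesis using flowc_error'[OF s, of t N] by simp
  qed
  moreover have "(\<lambda>N. 2 * (\<integral>x. (norm (u x - hermite_sum c {..<N} t x))\<^sup>2 \<partial>lborel) + 2 * tail c N) \<longlonglongrightarrow> 2 * 0 + 2 * 0"
    by (intro tendsto_intros lim tail_tendsto_0[OF s])
  ultimately have "?I \<le> 0"
    by (intro LIMSEQ_le_const) auto
  then show ?thesis
    using square_integral_eq_0[OF square_integrable_diff[OF u square_integrable_flowc(1)[OF s]]] by simp
qed

text \<open>The n-th coefficient is continuous in L^2, and all partial sums beyond n already have
  the right one.\<close>

lemma coef_flowc:
  assumes s: "summable (\<lambda>n. (norm (c n))\<^sup>2)"
  shows "coef (flowc c t) n = cis (t * (2 * real n + 1)) * c n"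
proof -
  have "(norm (coef (flowc c t) n - cis (t * (2 * real n + 1)) * c n))\<^sup>2 \<le> tail c N" if "N > n" for N
    using coef_bound[OF square_integrable_diff[OF square_integrable_flowc(1)[OF s] square_integrable_hermite_sum], of t c "{..<N}" t n]
      flowc_error'[OF s, of t N] that
    by (simp add: coef_diff[OF square_integrable_flowc(1)[OF s] square_integrable_hermite_sum] coef_hermite_sum)
  then have "(norm (coef (flowc c t) n - cis (t * (2 * real n + 1)) * c n))\<^sup>2 \<le> 0"
    by (intro LIMSEQ_le_const[OF tail_tendsto_0[OF s]]) (auto intro: exI[of _ "Suc n"])
  then show ?thesis by simp
qed

section \<open>Coherent states and completeness\<close>

lemma hermite_norm_nonzero [simp]: "hermite_norm n \<noteq> 0"
  by (simp add: hermite_norm_def)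

definition coherent_coef :: "complex \<Rightarrow> nat \<Rightarrow> complex" where
  "coherent_coef w n = w ^ n / fact n * complex_of_real (hermite_norm n)"

lemma summable_coherent_coef: "summable (\<lambda>n. (norm (coherent_coef w n))\<^sup>2)"
proof -
  have "(norm (coherent_coef w n))\<^sup>2 = sqrt pi * ((2 * (norm w)\<^sup>2) ^ n / fact n)" for n
  proof -
    have "(norm (coherent_coef w n))\<^sup>2 = ((norm w)\<^sup>2) ^ n / (fact n * fact n) * (hermite_norm n * hermite_norm n)"
      by (simp add: coherent_coef_def norm_mult norm_divide norm_power power_mult_distrib power_divide
          power2_eq_square[of "hermite_norm n"] power2_eq_square[of "fact n"] power_mult[symmetric] mult.commute[of n]
          abs_of_pos)
    also have "\<dots> = sqrt pi * ((2 * (norm w)\<^sup>2) ^ n / fact n)"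
      by (simp add: hermite_norm_square power_mult_distrib)
    finally show ?thesis .
  qed
  then have eq: "(\<lambda>n. (norm (coherent_coef w n))\<^sup>2) = (\<lambda>n. sqrt pi * (inverse (fact n) * (2 * (norm w)\<^sup>2) ^ n))"
    by (auto simp: divide_inverse mult.commute)
  show ?thesis
    unfolding eq by (intro summable_mult summable_exp)
qed

lemma coherent_eq: "coherent w x = complex_of_real (exp (- x\<^sup>2 / 2)) * exp (2 * w * of_real x - w\<^sup>2)"
  by (simp add: coherent_def exp_of_real[symmetric] algebra_simps flip: exp_add)

text \<open>The phase of index n is \<open>cis t\<close> times the n-th power of
  \<open>cis (2 * t)\<close>, which the n-th power of the parameter absorbs. The generating function
  converges at every x, so the equality holds at every point.\<close>

lemma flowc_coherent: "flowc (coherent_coef w) t x = cis t * coherent (w * cis (2 * t)) x"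
proof (rule flowc_eqI[OF summable_coherent_coef])
  let ?z = "w * cis (2 * t)"
  have "(\<lambda>n. cis t * complex_of_real (exp (- x\<^sup>2 / 2)) * (?z ^ n / fact n * complex_of_real (hermite_poly n x))) sums
     (cis t * complex_of_real (exp (- x\<^sup>2 / 2)) * exp (2 * ?z * of_real x - ?z\<^sup>2))"
    by (intro sums_mult hermite_generating_function)
  also have "(\<lambda>n. cis t * complex_of_real (exp (- x\<^sup>2 / 2)) * (?z ^ n / fact n * complex_of_real (hermite_poly n x))) =
     (\<lambda>n. cis (t * (2 * real n + 1)) * coherent_coef w n * complex_of_real (hermite_fun n x))"
  proof
    fix n
    have "cis (t * (2 * real n + 1)) = cis t * cis (2 * t) ^ n"
    proof -
      have "cis t * cis (2 * t) ^ n = cis (t + real n * (2 * t))"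
        by (simp only: Complex.DeMoivre cis_mult)
      also have "t + real n * (2 * t) = t * (2 * real n + 1)"
        by (simp add: algebra_simps)
      finally show ?thesis ..
    qed
    then show "cis t * complex_of_real (exp (- x\<^sup>2 / 2)) * (?z ^ n / fact n * complex_of_real (hermite_poly n x)) =
       cis (t * (2 * real n + 1)) * coherent_coef w n * complex_of_real (hermite_fun n x)"
      by (simp add: coherent_coef_def hermite_fun_eq power_mult_distrib)
  qed
  finally show "(\<lambda>N. hermite_sum (coherent_coef w) {..<N} t x) \<longlonglongrightarrow> cis t * coherent ?z x"
    by (simp add: sums_def hermite_sum_def coherent_eq mult.assoc)
qed

lemma coherent_flowc: "coherent w = flowc (coherent_coef w) 0"
  by (auto simp: flowc_coherent)

lemma square_integrable_coherent: "square_integrable lborel (coherent w)"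
  unfolding coherent_flowc by (rule square_integrable_flowc[OF summable_coherent_coef])

lemma coef_coherent: "coef (coherent w) = coherent_coef w"
  by (auto simp: coherent_flowc coef_flowc[OF summable_coherent_coef])

text \<open>The partial Hermite sums of a coherent state pair to zero with \<open>f\<close>, and the
  remainder is small in L^2.\<close>

lemma integral_coherent_eq_0:
  assumes f: "square_integrable lborel f" and c: "\<And>n. coef f n = 0"
  shows "(\<integral>x. f x * coherent w x \<partial>lborel) = 0"
proof -
  let ?I = "\<integral>x. (norm (f x))\<^sup>2 \<partial>lborel" and ?c = "coherent_coef w"
  note s = summable_coherent_coef[of w]
  have "(norm (\<integral>x. f x * coherent w x \<partial>lborel))\<^sup>2 \<le> ?I * tail ?c N" for N
  proof -
    let ?S = "hermite_sum ?c {..<N} 0"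
    note S = square_integrable_hermite_sum[of ?c "{..<N}" 0]
    have "(\<integral>x. f x * ?S x \<partial>lborel) = 0"
      by (simp add: integral_mult_hermite_sum[OF f] c)
    then have "(\<integral>x. f x * coherent w x \<partial>lborel) = (\<integral>x. f x * (coherent w x - ?S x) \<partial>lborel)"
      using square_integrable_product[OF f square_integrable_coherent] square_integrable_product[OF f S]
      by (simp add: right_diff_distrib)
    also have "(norm \<dots>)\<^sup>2 \<le> ?I * (\<integral>x. (norm (coherent w x - ?S x))\<^sup>2 \<partial>lborel)"
      by (intro Cauchy_Schwarz_integral f square_integrable_diff square_integrable_coherent S)
    also have "\<dots> \<le> ?I * tail ?c N"
      unfolding coherent_flowc by (intro mult_left_mono flowc_error' s) simp
    finally show ?thesis .
  qed
  moreover have "(\<lambda>N. ?I * tail ?c N) \<longlonglongrightarrow> ?I * 0"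
    by (intro tendsto_intros tail_tendsto_0 s)
  ultimately have "(norm (\<integral>x. f x * coherent w x \<partial>lborel))\<^sup>2 \<le> ?I * 0"
    by (intro LIMSEQ_le_const) auto
  then show ?thesis by simp
qed

text \<open>By uniqueness of characteristic functions, applied to the normalised positive and negative parts.\<close>

lemma fourier_zero_real:
  fixes g :: "real \<Rightarrow> real"
  assumes g: "integrable lborel g" and z: "\<And>\<xi>. (\<integral>x. g x *\<^sub>R iexp (\<xi> * x) \<partial>lborel) = 0"
  shows "AE x in lborel. g x = 0"
proof -
  have [measurable]: "g \<in> borel_measurable borel" using g by auto
  define p where "p x = max 0 (g x)" for x
  define q where "q x = max 0 (- g x)" for x
  have [measurable]: "p \<in> borel_measurable borel" "q \<in> borel_measurable borel"
    by (auto simp: p_def[abs_def] q_def[abs_def])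
  have p: "integrable lborel p" and q: "integrable lborel q"
    using g by (auto simp: p_def[abs_def] q_def[abs_def])
  have nn: "p x \<ge> 0" "q x \<ge> 0" for x by (auto simp: p_def q_def)
  have gpq: "g x = p x - q x" for x by (auto simp: p_def q_def)
  have int: "integrable lborel (\<lambda>x. r x *\<^sub>R iexp (\<xi> * x))" if "integrable lborel r" for r :: "real \<Rightarrow> real" and \<xi>
    by (rule Bochner_Integration.integrable_bound[OF that]) (use that in auto)
  have eq: "(\<integral>x. p x *\<^sub>R iexp (\<xi> * x) \<partial>lborel) = (\<integral>x. q x *\<^sub>R iexp (\<xi> * x) \<partial>lborel)" for \<xi>
    using z[of \<xi>] int[OF p, of \<xi>] int[OF q, of \<xi>] unfolding gpq by (simp add: scaleR_diff_left)
  define m where "m = (\<integral>x. p x \<partial>lborel)"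
  have mq: "m = (\<integral>x. q x \<partial>lborel)"
    using eq[of 0] by (simp add: m_def scaleR_conv_of_real)
  have "m \<ge> 0" unfolding m_def by (intro integral_nonneg_AE) (auto simp: nn)
  show ?thesis
  proof (cases "m = 0")
    case True
    then have "AE x in lborel. p x = 0" "AE x in lborel. q x = 0"
      using integral_nonneg_eq_0_iff_AE[OF p] integral_nonneg_eq_0_iff_AE[OF q] nn mq by (auto simp: m_def)
    then show ?thesis by eventually_elim (simp add: gpq)
  next
    case False
    with \<open>m \<ge> 0\<close> have m: "m > 0" by simp
    have dist: "real_distribution (density lborel (\<lambda>x. ennreal (r x / m)))"
      if r: "integrable lborel r" "\<And>x. r x \<ge> 0" "(\<integral>x. r x \<partial>lborel) = m" for r
    proof -
      have [measurable]: "r \<in> borel_measurable borel" using r by auto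
      have "(\<integral>\<^sup>+x. ennreal (r x / m) \<partial>lborel) = ennreal (\<integral>x. r x / m \<partial>lborel)"
        using r m by (intro nn_integral_eq_integral) auto
      also have "\<dots> = 1" using r m by simp
      finally have "emeasure (density lborel (\<lambda>x. ennreal (r x / m))) UNIV = 1"
        by (simp add: emeasure_density)
      then have "prob_space (density lborel (\<lambda>x. ennreal (r x / m)))"
        by (intro prob_spaceI) simp
      then show ?thesis
        by (simp add: real_distribution_def real_distribution_axioms_def)
    qed
    have char: "char (density lborel (\<lambda>x. ennreal (r x / m))) \<xi> = (\<integral>x. r x *\<^sub>R iexp (\<xi> * x) \<partial>lborel) / m"
      if [measurable]: "r \<in> borel_measurable borel" and "\<And>x. r x \<ge> 0" for r \<xi>
    proof -
      have "char (density lborel (\<lambda>x. ennreal (r x / m))) \<xi> = (\<integral>x. (r x / m) *\<^sub>R iexp (\<xi> * x) \<partial>lborel)"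
        unfolding char_def using that m by (subst integral_density) auto
      also have "\<dots> = (\<integral>x. (1 / m) *\<^sub>R (r x *\<^sub>R iexp (\<xi> * x)) \<partial>lborel)"
        by (simp add: divide_inverse mult.commute)
      also have "\<dots> = (1 / m) *\<^sub>R (\<integral>x. r x *\<^sub>R iexp (\<xi> * x) \<partial>lborel)"
        by (rule integral_scaleR_right)
      finally show ?thesis by (simp add: scaleR_conv_of_real field_simps)
    qed
    have "density lborel (\<lambda>x. ennreal (p x / m)) = density lborel (\<lambda>x. ennreal (q x / m))"
    proof (rule Levy_uniqueness)
      show "char (density lborel (\<lambda>x. ennreal (p x / m))) = char (density lborel (\<lambda>x. ennreal (q x / m)))"
      proof
        fix \<xi>
        show "char (density lborel (\<lambda>x. ennreal (p x / m))) \<xi> = char (density lborel (\<lambda>x. ennreal (q x / m))) \<xi>"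
          using char[of p \<xi>] char[of q \<xi>] eq[of \<xi>] nn by simp
      qed
    qed (rule dist; use p q nn m_def mq in simp)+
    then have "AE x in lborel. ennreal (p x / m) = ennreal (q x / m)"
      by (intro sigma_finite_measure.density_unique[OF sigma_finite_lborel]) auto
    then show ?thesis
    proof eventually_elim
      fix x assume "ennreal (p x / m) = ennreal (q x / m)"
      then have "p x = q x" using nn m by (simp add: ennreal_inj)
      then show "g x = 0" by (simp add: gpq)
    qed
  qed
qed

text \<open>For w = i \<xi> / 2 the coherent state is, up to a constant, the Gaussian times exp(i
  \<xi> x), so f exp(-x^2/2) has vanishing Fourier transform. As \<open>fourier_zero_real\<close>
  concerns real functions, real and imaginary parts are separated by means of the transform of the
  conjugate.\<close>

lemma hermite_complete:
  assumes f: "square_integrable lborel f" and c: "\<And>n. coef f n = 0"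
  shows "AE x in lborel. f x = 0"
proof -
  define G where "G x = f x * complex_of_real (exp (- x\<^sup>2 / 2))" for x
  have "(\<lambda>x. complex_of_real (exp (- x\<^sup>2 / 2))) = coherent 0"
    by (auto simp: coherent_eq)
  then have G: "integrable lborel G"
    unfolding G_def[abs_def] using square_integrable_product[OF f square_integrable_coherent[of 0]] by metis
  then have [measurable]: "G \<in> borel_measurable borel" by auto
  have intE: "integrable lborel (\<lambda>x. H x * iexp (\<xi> * x))" if "integrable lborel H" for H :: "real \<Rightarrow> complex" and \<xi>
    by (rule Bochner_Integration.integrable_bound[OF that]) (use that in \<open>auto simp: norm_mult\<close>)
  have zero: "(\<integral>x. G x * iexp (\<xi> * x) \<partial>lborel) = 0" for \<xi>
  proof -
    have "coherent (\<i> * of_real \<xi> / 2) x = exp (of_real (\<xi>\<^sup>2 / 4)) * (complex_of_real (exp (- x\<^sup>2 / 2)) * iexp (\<xi> * x))" for x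
      by (simp add: coherent_eq power_mult_distrib power_divide mult.assoc flip: exp_add)
        (simp add: algebra_simps exp_add)
    then have "(\<integral>x. exp (of_real (\<xi>\<^sup>2 / 4)) * (G x * iexp (\<xi> * x)) \<partial>lborel) = 0"
      using integral_coherent_eq_0[OF f c, of "\<i> * of_real \<xi> / 2"] by (simp add: G_def mult_ac)
    then show ?thesis by simp
  qed
  have zero': "(\<integral>x. cnj (G x) * iexp (\<xi> * x) \<partial>lborel) = 0" for \<xi>
  proof -
    have "cnj (G x) * iexp (\<xi> * x) = cnj (G x * iexp (- \<xi> * x))" for x
      unfolding complex_cnj_mult exp_cnj by simp
    then have "(\<integral>x. cnj (G x) * iexp (\<xi> * x) \<partial>lborel) = cnj (\<integral>x. G x * iexp (- \<xi> * x) \<partial>lborel)"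
      using Bochner_Integration.integral_cnj[of lborel "\<lambda>x. G x * iexp (- \<xi> * x)"] by presburger
    then show ?thesis using zero[of "- \<xi>"] by simp
  qed
  have cG: "integrable lborel (\<lambda>x. cnj (G x))" using G by simp
  have "AE x in lborel. Re (G x) = 0"
  proof (rule fourier_zero_real)
    fix \<xi>
    have "Re (G x) *\<^sub>R iexp (\<xi> * x) = (1/2) * (G x * iexp (\<xi> * x) + cnj (G x) * iexp (\<xi> * x))" for x
      by (simp add: complex_add_cnj scaleR_conv_of_real flip: distrib_right)
    then show "(\<integral>x. Re (G x) *\<^sub>R iexp (\<xi> * x) \<partial>lborel) = 0"
      using intE[OF G, of \<xi>] intE[OF cG, of \<xi>] zero[of \<xi>] zero'[of \<xi>] by (simp only: integral_mult_right_zero Bochner_Integration.integral_add) simp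
  qed (use G in simp)
  moreover have "AE x in lborel. Im (G x) = 0"
  proof (rule fourier_zero_real)
    fix \<xi>
    have "complex_of_real (Im (G x)) = (- \<i> / 2) * (G x - cnj (G x))" for x
      by (simp add: complex_eq_iff)
    then have "Im (G x) *\<^sub>R iexp (\<xi> * x) = (- \<i> / 2) * (G x * iexp (\<xi> * x) - cnj (G x) * iexp (\<xi> * x))" for x
      by (simp only: scaleR_conv_of_real left_diff_distrib mult.assoc)
    then show "(\<integral>x. Im (G x) *\<^sub>R iexp (\<xi> * x) \<partial>lborel) = 0"
      using intE[OF G, of \<xi>] intE[OF cG, of \<xi>] zero[of \<xi>] zero'[of \<xi>] by (simp only: integral_mult_right_zero Bochner_Integration.integral_diff) simp
  qed (use G in simp)
  ultimately show ?thesis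
    by eventually_elim (auto simp: G_def complex_eq_iff)
qed

section \<open>The flow of a square-integrable function\<close>

definition flow :: "(real \<Rightarrow> complex) \<Rightarrow> real \<Rightarrow> real \<Rightarrow> complex" where
  "flow f = flowc (coef f)"

lemma measurable_flow [measurable]:
  "(\<lambda>(t, x). flow f t x) \<in> borel_measurable (borel \<Otimes>\<^sub>M borel)" "flow f t \<in> borel_measurable borel"
  by (simp_all add: flow_def)

lemma square_integrable_flow:
  assumes "square_integrable lborel f"
  shows "square_integrable lborel (flow f t)"
    and "(\<integral>x. (norm (flow f t x))\<^sup>2 \<partial>lborel) \<le> (\<integral>x. (norm (f x))\<^sup>2 \<partial>lborel)"
  using square_integrable_flowc[OF summable_coef(1)[OF assms], of t] summable_coef(2)[OF assms]
  by (auto simp: flow_def)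

lemma flow_coherent: "flow (coherent w) t x = cis t * coherent (w * cis (2 * t)) x"
  by (simp add: flow_def coef_coherent flowc_coherent)

lemma flow_0:
  assumes f: "square_integrable lborel f"
  shows "AE x in lborel. f x = flow f 0 x"
proof -
  note s = square_integrable_flow(1)[OF f, of 0]
  have "coef (\<lambda>x. f x - flow f 0 x) n = 0" for n
    by (simp add: coef_diff[OF f s]) (simp add: flow_def coef_flowc[OF summable_coef(1)[OF f]])
  from hermite_complete[OF square_integrable_diff[OF f s] this] show ?thesis by simp
qed

lemma hermite_expansion:
  assumes f: "square_integrable lborel f"
  shows "(\<integral>x. (norm (f x - hermite_sum (coef f) {..<N} 0 x))\<^sup>2 \<partial>lborel) \<le> tail (coef f) N"
proof -
  have [measurable]: "f \<in> borel_measurable borel" using f by auto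
  have "(\<integral>x. (norm (f x - hermite_sum (coef f) {..<N} 0 x))\<^sup>2 \<partial>lborel) =
    (\<integral>x. (norm (flow f 0 x - hermite_sum (coef f) {..<N} 0 x))\<^sup>2 \<partial>lborel)"
    using flow_0[OF f] by (intro integral_cong_AE) (measurable, auto)
  then show ?thesis
    using flowc_error'[OF summable_coef(1)[OF f], of 0 N] by (simp add: flow_def)
qed

text \<open>The combination of the flows is an L^2-limit of the partial sums of the combination, so
  uniqueness applies. The equality is only almost everywhere, since the three flows are limits along
  possibly different subsequences.\<close>

lemma flow_linear:
  assumes f: "square_integrable lborel f" and g: "square_integrable lborel g"
  shows "AE x in lborel. flow (\<lambda>x. a * f x + b * g x) t x = a * flow f t x + b * flow g t x"
proof -
  let ?h = "\<lambda>x. a * f x + b * g x"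
  note cf = summable_coef(1)[OF f] and cg = summable_coef(1)[OF g]
  have h: "square_integrable lborel ?h"
    by (intro square_integrable_add square_integrable_mult f g)
  have coef: "coef ?h n = a * coef f n + b * coef g n" for n
    by (simp add: coef_add square_integrable_mult f g coef_mult)
  have "AE x in lborel. a * flow f t x + b * flow g t x = flowc (coef ?h) t x"
  proof (rule flowc_unique[OF summable_coef(1)[OF h]])
    show "square_integrable lborel (\<lambda>x. a * flow f t x + b * flow g t x)"
      by (intro square_integrable_add square_integrable_mult square_integrable_flow f g)
    show "(\<lambda>N. \<integral>x. (norm (a * flow f t x + b * flow g t x - hermite_sum (coef ?h) {..<N} t x))\<^sup>2 \<partial>lborel) \<longlonglongrightarrow> 0"
    proof (rule tendsto_sandwich[OF _ _ tendsto_const])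
      show "\<forall>\<^sub>F N in sequentially. (\<integral>x. (norm (a * flow f t x + b * flow g t x - hermite_sum (coef ?h) {..<N} t x))\<^sup>2 \<partial>lborel)
         \<le> 2 * (norm a)\<^sup>2 * tail (coef f) N + 2 * (norm b)\<^sup>2 * tail (coef g) N"
      proof (intro always_eventually allI)
        fix N
        let ?d = "\<lambda>f x. flow f t x - hermite_sum (coef f) {..<N} t x"
        have sf: "square_integrable lborel (?d f)" and sg: "square_integrable lborel (?d g)"
          by (intro square_integrable_diff square_integrable_flow square_integrable_hermite_sum f g)+
        have eq: "a * flow f t x + b * flow g t x - hermite_sum (coef ?h) {..<N} t x = a * ?d f x + b * ?d g x" for x
          by (simp add: hermite_sum_def coef distrib_left distrib_right sum.distrib right_diff_distrib sum_distrib_left)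
            (simp add: algebra_simps)
        have "(\<integral>x. (norm (a * flow f t x + b * flow g t x - hermite_sum (coef ?h) {..<N} t x))\<^sup>2 \<partial>lborel)
           \<le> (\<integral>x. 2 * (norm a)\<^sup>2 * (norm (?d f x))\<^sup>2 + 2 * (norm b)\<^sup>2 * (norm (?d g x))\<^sup>2 \<partial>lborel)"
          unfolding eq
        proof (rule integral_mono)
          show "integrable lborel (\<lambda>x. (norm (a * ?d f x + b * ?d g x))\<^sup>2)"
            using square_integrable_add[OF square_integrable_mult[OF sf, of a] square_integrable_mult[OF sg, of b]] by auto
          show "integrable lborel (\<lambda>x. 2 * (norm a)\<^sup>2 * (norm (?d f x))\<^sup>2 + 2 * (norm b)\<^sup>2 * (norm (?d g x))\<^sup>2)"
            using sf sg by (auto simp: square_integrable_def)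
          show "(norm (a * ?d f x + b * ?d g x))\<^sup>2 \<le> 2 * (norm a)\<^sup>2 * (norm (?d f x))\<^sup>2 + 2 * (norm b)\<^sup>2 * (norm (?d g x))\<^sup>2" for x
            using norm_add_square_le[of "a * ?d f x" "b * ?d g x"] by (simp add: norm_mult power_mult_distrib)
        qed
        also have "\<dots> = 2 * (norm a)\<^sup>2 * (\<integral>x. (norm (?d f x))\<^sup>2 \<partial>lborel) + 2 * (norm b)\<^sup>2 * (\<integral>x. (norm (?d g x))\<^sup>2 \<partial>lborel)"
          using sf sg by (simp add: square_integrable_def)
        also have "\<dots> \<le> 2 * (norm a)\<^sup>2 * tail (coef f) N + 2 * (norm b)\<^sup>2 * tail (coef g) N"
          unfolding flow_def by (intro add_mono mult_left_mono flowc_error' cf cg) auto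
        finally show "(\<integral>x. (norm (a * flow f t x + b * flow g t x - hermite_sum (coef ?h) {..<N} t x))\<^sup>2 \<partial>lborel)
           \<le> 2 * (norm a)\<^sup>2 * tail (coef f) N + 2 * (norm b)\<^sup>2 * tail (coef g) N" .
      qed
      show "(\<lambda>N. 2 * (norm a)\<^sup>2 * tail (coef f) N + 2 * (norm b)\<^sup>2 * tail (coef g) N) \<longlonglongrightarrow> 0"
        using tendsto_add[OF tendsto_mult_right_zero[OF tail_tendsto_0[OF cf], of "2 * (norm a)\<^sup>2"]
            tendsto_mult_right_zero[OF tail_tendsto_0[OF cg], of "2 * (norm b)\<^sup>2"]] by simp
    qed (auto intro!: always_eventually)
  qed
  then show ?thesis by (auto simp: flow_def)
qed

text \<open>The real and imaginary parts are real power series that vanish on the line, and a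
  nonzero coefficient would force a punctured neighbourhood of 0 without zeros.\<close>

lemma powser_eq_0:
  fixes a :: "nat \<Rightarrow> complex"
  assumes "\<And>s::real. (\<lambda>n. a n * of_real s ^ n) sums 0"
  shows "a n = 0"
proof -
  have real: "b n = 0" if b: "\<And>s. (\<lambda>n. b n * s ^ n) sums 0" for b :: "nat \<Rightarrow> real"
  proof (rule ccontr)
    assume n: "b n \<noteq> 0"
    have "(\<lambda>n. b n * 0 ^ n) sums b 0" by (rule powser_sums_zero)
    then have "b 0 = 0" using b[of 0] sums_unique2 by blast
    then have "n > 0" using n by (cases n) auto
    show False
    proof (rule powser_0_nonzero[where r=1 and \<xi>="0::real" and a=b and f="\<lambda>_. 0" and m=n])
      fix r :: real assume "0 < r" "\<And>z::real. z \<in> cball 0 r - {0} \<Longrightarrow> (0::real) \<noteq> 0"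
      from this(2)[of r] this(1) show False by simp
    qed (use b n \<open>n > 0\<close> in auto)
  qed
  have "(\<lambda>n. Re (a n) * s ^ n) sums 0" "(\<lambda>n. Im (a n) * s ^ n) sums 0" for s
    using sums_Re[OF assms[of s]] sums_Im[OF assms[of s]] by (simp_all flip: of_real_power)
  then show ?thesis by (auto simp: complex_eq_iff intro: real)
qed

text \<open>By continuity \<Lambda> is determined by its values on the Hermite functions, and
  \<Lambda> of the coherent state with parameter s is a power series in s whose coefficients are
  these values times nonzero constants. The bound is asked on the unit ball only, because the bounds
  available for the two forms are not homogeneous.\<close>

lemma functional_zero:
  fixes \<Lambda> :: "(real \<Rightarrow> complex) \<Rightarrow> complex"
  assumes add: "\<And>f g. square_integrable lborel f \<Longrightarrow> square_integrable lborel g \<Longrightarrow> \<Lambda> (\<lambda>x. f x + g x) = \<Lambda> f + \<Lambda> g"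
    and mult: "\<And>a f. square_integrable lborel f \<Longrightarrow> \<Lambda> (\<lambda>x. a * f x) = a * \<Lambda> f"
    and bound: "\<And>f. square_integrable lborel f \<Longrightarrow> (\<integral>x. (norm (f x))\<^sup>2 \<partial>lborel) \<le> 1 \<Longrightarrow> norm (\<Lambda> f) \<le> C"
    and coherent: "\<And>s::real. \<Lambda> (coherent (of_real s)) = 0"
    and f: "square_integrable lborel f"
  shows "\<Lambda> f = 0"
proof -
  define \<phi> where "\<phi> n = (\<lambda>x. complex_of_real (hermite_fun n x))" for n
  have \<phi>: "square_integrable lborel (\<phi> n)" for n
    unfolding \<phi>_def by (rule square_integrable_hermite)
  have "C \<ge> 0" using bound[of "\<lambda>x. 0"] norm_ge_zero[of "\<Lambda> (\<lambda>x. 0)"] by (simp add: order.trans[OF norm_ge_zero])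
  have scaled: "norm (\<Lambda> f) \<le> e * C"
    if f: "square_integrable lborel f" "(\<integral>x. (norm (f x))\<^sup>2 \<partial>lborel) \<le> e\<^sup>2" and "e > 0" for f e
  proof -
    have "(\<integral>x. (norm (complex_of_real (1 / e) * f x))\<^sup>2 \<partial>lborel) = (1 / e)\<^sup>2 * (\<integral>x. (norm (f x))\<^sup>2 \<partial>lborel)"
      by (simp add: norm_mult power_mult_distrib norm_divide power_divide)
    also have "\<dots> \<le> 1" using f(2) \<open>e > 0\<close> by (simp add: field_simps)
    finally have "norm (\<Lambda> (\<lambda>x. complex_of_real (1 / e) * f x)) \<le> C"
      by (intro bound square_integrable_mult f)
    then have "norm (complex_of_real (1 / e) * \<Lambda> f) \<le> C"
      by (simp only: mult[OF f(1)])
    then show ?thesis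
      using \<open>e > 0\<close> by (simp add: norm_mult norm_divide field_simps)
  qed
  have sum: "\<Lambda> (hermite_sum c {..<N} 0) = (\<Sum>n<N. c n * \<Lambda> (\<phi> n))" for c N
  proof (induction N)
    case 0
    have "hermite_sum c {..<0} 0 = (\<lambda>x. 0 * \<phi> 0 x)" by (auto simp: hermite_sum_def)
    then show ?case using mult[OF \<phi>[of 0], of 0] by simp
  next
    case (Suc N)
    have "hermite_sum c {..<Suc N} 0 = (\<lambda>x. hermite_sum c {..<N} 0 x + c N * \<phi> N x)"
      by (auto simp: hermite_sum_def \<phi>_def)
    then show ?case
      by (simp add: add square_integrable_hermite_sum square_integrable_mult \<phi> mult Suc)
  qed
  have expand: "(\<lambda>n. coef f n * \<Lambda> (\<phi> n)) sums \<Lambda> f" if f: "square_integrable lborel f" for f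
    unfolding sums_def
  proof (rule LIMSEQ_I)
    fix r :: real assume "r > 0"
    \<comment> \<open>\<open>C + 1\<close> keeps the quotient meaningful for C = 0 and makes
      \<open>e * C < r\<close>.\<close>
    define e where "e = r / (2 * (C + 1))"
    have e: "e > 0" "e * C < r"
      using \<open>r > 0\<close> \<open>C \<ge> 0\<close> by (auto simp: e_def field_simps intro: add_nonneg_pos)
    have "\<forall>\<^sub>F N in sequentially. tail (coef f) N < e\<^sup>2"
      using order_tendstoD(2)[OF tail_tendsto_0[OF summable_coef(1)[OF f]]] e by auto
    then obtain N0 where N0: "\<And>N. N \<ge> N0 \<Longrightarrow> tail (coef f) N < e\<^sup>2"
      by (auto simp: eventually_sequentially)
    have "norm ((\<Sum>n<N. coef f n * \<Lambda> (\<phi> n)) - \<Lambda> f) < r" if "N \<ge> N0" for N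
    proof -
      let ?S = "hermite_sum (coef f) {..<N} 0"
      note S = square_integrable_hermite_sum[of "coef f" "{..<N}" 0]
      have "\<Lambda> f = \<Lambda> (\<lambda>x. (f x - ?S x) + ?S x)" by simp
      also have "\<dots> = \<Lambda> (\<lambda>x. f x - ?S x) + \<Lambda> ?S"
        by (intro add square_integrable_diff f S)
      finally have eq: "\<Lambda> f - \<Lambda> ?S = \<Lambda> (\<lambda>x. f x - ?S x)" by simp
      have "norm (\<Lambda> (\<lambda>x. f x - ?S x)) \<le> e * C"
        using hermite_expansion[OF f, of N] N0[OF that] e(1)
        by (intro scaled square_integrable_diff f S) auto
      then show ?thesis
        using e(2) by (simp add: norm_minus_commute sum[symmetric] eq)
    qed
    then show "\<exists>N0. \<forall>N\<ge>N0. norm ((\<Sum>n<N. coef f n * \<Lambda> (\<phi> n)) - \<Lambda> f) < r" by blast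
  qed
  have "\<Lambda> (\<phi> n) = 0" for n
  proof -
    have "(\<lambda>n. (hermite_norm n / fact n * \<Lambda> (\<phi> n)) * of_real s ^ n) sums 0" for s :: real
      using expand[OF square_integrable_coherent[of "of_real s"]]
      by (simp add: coherent coef_coherent coherent_coef_def field_simps)
    from powser_eq_0[OF this, of n] show ?thesis
      by simp
  qed
  then show ?thesis using expand[OF f] by (simp add: sums_iff)
qed

section \<open>Integrals over the circle and Gaussian integrals\<close>

text \<open>A density on the whole line instead of a restricted space, so that measurability stays
  plain Borel measurability in all product spaces.\<close>

definition lborel_on :: "real \<Rightarrow> real \<Rightarrow> real measure" where
  "lborel_on a b = density lborel (indicator {a..b})"

lemma sets_lborel_on [simp, measurable_cong]: "sets (lborel_on a b) = sets borel"
  and space_lborel_on [simp]: "space (lborel_on a b) = UNIV"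
  by (simp_all add: lborel_on_def)

lemma emeasure_lborel_on: "a \<le> b \<Longrightarrow> emeasure (lborel_on a b) UNIV = ennreal (b - a)"
  by (simp add: lborel_on_def emeasure_density)

lemma finite_measure_lborel_on: "finite_measure (lborel_on a b)"
proof (rule finite_measureI)
  show "emeasure (lborel_on a b) (space (lborel_on a b)) \<noteq> \<infinity>"
    using emeasure_lborel_on[of a b] by (cases "a \<le> b") (auto simp: lborel_on_def emeasure_density)
qed

lemma sigma_finite_lborel_on: "sigma_finite_measure (lborel_on a b)"
  using finite_measure_lborel_on by (rule finite_measure.sigma_finite_measure)

lemma integral_lborel_on:
  fixes f :: "real \<Rightarrow> 'a::{banach, second_countable_topology}"
  assumes "f \<in> borel_measurable borel"
  shows "integral\<^sup>L (lborel_on a b) f = (\<integral>x. indicator {a..b} x *\<^sub>R f x \<partial>lborel)"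
proof -
  have "lborel_on a b = density lborel (\<lambda>x. ennreal (indicator {a..b} x))"
    by (simp add: lborel_on_def ennreal_indicator)
  then show ?thesis
    using assms by (simp add: integral_density)
qed

lemma has_integral_lborel_on_FTC:
  fixes f F :: "real \<Rightarrow> complex"
  assumes "a \<le> b" "\<And>x. (F has_vector_derivative f x) (at x)" "continuous_on UNIV f"
  shows "integral\<^sup>L (lborel_on a b) f = F b - F a"
proof -
  have [measurable]: "f \<in> borel_measurable borel"
    using assms(3) by (rule borel_measurable_continuous_onI)
  have "has_bochner_integral lborel (\<lambda>x. indicator {a..b} x *\<^sub>R f x) (F b - F a)"
    using assms by (intro has_bochner_integral_FTC_Icc)
      (auto intro: has_vector_derivative_at_within continuous_on_subset)
  then show ?thesis by (simp add: integral_lborel_on has_bochner_integral_iff)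
qed

lemma continuous_on_cis' [continuous_intros]: "continuous_on A f \<Longrightarrow> continuous_on A (\<lambda>x. cis (f x))"
  unfolding cis_conv_exp by (intro continuous_intros)

lemma borel_measurable_cis [measurable]: "cis \<in> borel_measurable borel"
  by (intro borel_measurable_continuous_onI continuous_intros)

lemma integral_cis:
  fixes m :: int
  shows "(\<integral>\<theta>. cis (of_int m * \<theta>) \<partial>lborel_on (-pi) pi) = (if m = 0 then 2 * pi else 0)"
proof (cases "m = 0")
  case True
  have "(\<integral>\<theta>. cis (of_int m * \<theta>) \<partial>lborel_on (-pi) pi) = of_real pi - of_real (- pi)"
    using True by (intro has_integral_lborel_on_FTC) (auto intro!: derivative_eq_intros continuous_intros simp: cis_zero)
  then show ?thesis using True by simp
next
  case False
  have "(\<integral>\<theta>. cis (of_int m * \<theta>) \<partial>lborel_on (-pi) pi)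
      = cis (of_int m * pi) / (\<i> * of_int m) - cis (of_int m * (- pi)) / (\<i> * of_int m)"
  proof (intro has_integral_lborel_on_FTC)
    show "((\<lambda>\<theta>. cis (of_int m * \<theta>) / (\<i> * of_int m)) has_vector_derivative cis (of_int m * x)) (at x)" for x
    proof -
      have "((\<lambda>z. exp (\<i> * of_int m * z) / (\<i> * of_int m)) has_field_derivative exp (\<i> * of_int m * of_real x)) (at (of_real x))"
        using False by (auto intro!: derivative_eq_intros)
      from has_vector_derivative_real_field[OF this] show ?thesis
        by (simp add: cis_conv_exp mult.assoc)
    qed
  qed (auto intro!: continuous_intros)
  also have "\<dots> = 0"
    using sin_zero_iff_int2[of "of_int m * pi"] by (auto simp: cis.ctr complex_eq_iff Re_divide Im_divide)
  finally show ?thesis using False by simp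
qed

text \<open>In the binomial expansion the j-th term has frequency 2 j - k, so only the middle term
  of an even power survives, and it involves \<open>p\<close> and \<open>q\<close> through their
  product.\<close>

lemma integral_circle_power:
  fixes p q :: complex
  shows "(\<integral>\<theta>. (p * cis \<theta> + q * cis (- \<theta>)) ^ k \<partial>lborel_on (-pi) pi) =
     (if even k then 2 * pi * of_nat (k choose (k div 2)) * (p * q) ^ (k div 2) else 0)"
proof -
  interpret finite_measure "lborel_on (-pi) pi" by (rule finite_measure_lborel_on)
  have int: "integrable (lborel_on (-pi) pi) (\<lambda>\<theta>. cis (c * \<theta>))" for c
    by (rule integrable_const_bound[of _ 1]) auto
  have "(p * cis \<theta> + q * cis (- \<theta>)) ^ k =
     (\<Sum>j\<le>k. (of_nat (k choose j) * p ^ j * q ^ (k - j)) * cis (of_int (2 * int j - int k) * \<theta>))" for \<theta>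
    unfolding binomial_ring
  proof (intro sum.cong refl)
    fix j assume "j \<in> {..k}"
    then have "cis \<theta> ^ j * cis (- \<theta>) ^ (k - j) = cis (of_int (2 * int j - int k) * \<theta>)"
      by (simp add: Complex.DeMoivre cis_mult of_nat_diff algebra_simps)
    moreover have "of_nat (k choose j) * (p * cis \<theta>) ^ j * (q * cis (- \<theta>)) ^ (k - j) =
       (of_nat (k choose j) * p ^ j * q ^ (k - j)) * (cis \<theta> ^ j * cis (- \<theta>) ^ (k - j))"
      by (simp add: power_mult_distrib mult_ac)
    ultimately show "of_nat (k choose j) * (p * cis \<theta>) ^ j * (q * cis (- \<theta>)) ^ (k - j) =
       (of_nat (k choose j) * p ^ j * q ^ (k - j)) * cis (of_int (2 * int j - int k) * \<theta>)" by simp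
  qed
  then have "(\<integral>\<theta>. (p * cis \<theta> + q * cis (- \<theta>)) ^ k \<partial>lborel_on (-pi) pi) =
    (\<Sum>j\<le>k. (of_nat (k choose j) * p ^ j * q ^ (k - j)) * (\<integral>\<theta>. cis (of_int (2 * int j - int k) * \<theta>) \<partial>lborel_on (-pi) pi))"
    using int by (simp only: Bochner_Integration.integral_sum integrable_mult_right integral_mult_right_zero)
  also have "\<dots> = (\<Sum>j\<le>k. if 2 * j = k then 2 * pi * of_nat (k choose (k div 2)) * (p * q) ^ (k div 2) else 0)"
  proof (intro sum.cong refl)
    fix j assume "j \<in> {..k}"
    show "of_nat (k choose j) * p ^ j * q ^ (k - j) * (\<integral>\<theta>. cis (of_int (2 * int j - int k) * \<theta>) \<partial>lborel_on (-pi) pi) =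
       (if 2 * j = k then 2 * pi * of_nat (k choose (k div 2)) * (p * q) ^ (k div 2) else 0)"
    proof (cases "2 * j = k")
      case True
      then show ?thesis unfolding integral_cis by (auto simp: power_mult_distrib)
    next
      case False
      then have "2 * int j - int k \<noteq> 0" by presburger
      then show ?thesis unfolding integral_cis using False by simp
    qed
  qed
  also have "\<dots> = (if even k then 2 * pi * of_nat (k choose (k div 2)) * (p * q) ^ (k div 2) else 0)"
  proof (cases "even k")
    case True
    then have "(2 * j = k) = (j = k div 2)" for j by auto
    then show ?thesis using True by simp
  next
    case False
    then have "2 * j \<noteq> k" for j by auto
    then show ?thesis using False by simp
  qed
  finally show ?thesis .
qed

text \<open>By \<open>integral_circle_power\<close> the integral is the power series \<open>2\<pi> \<Sum>k. (p q)\<^sup>k / k!\<^sup>2\<close>.\<close>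

lemma integral_circle_exp_cong:
  assumes "p * q = p' * q'"
  shows "(\<integral>\<theta>. exp (p * cis \<theta> + q * cis (- \<theta>)) \<partial>lborel_on (-pi) pi) =
     (\<integral>\<theta>. exp (p' * cis \<theta> + q' * cis (- \<theta>)) \<partial>lborel_on (-pi) pi)"
proof -
  interpret finite_measure "lborel_on (-pi) pi" by (rule finite_measure_lborel_on)
  have sums: "(\<lambda>k. (\<integral>\<theta>. (p * cis \<theta> + q * cis (- \<theta>)) ^ k \<partial>lborel_on (-pi) pi) / fact k) sums
     (\<integral>\<theta>. exp (p * cis \<theta> + q * cis (- \<theta>)) \<partial>lborel_on (-pi) pi)" for p q
  proof -
    let ?z = "\<lambda>\<theta>. p * cis \<theta> + q * cis (- \<theta>)" and ?B = "norm p + norm q"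
    have B: "norm (?z \<theta> ^ k / fact k) \<le> ?B ^ k / fact k" for k \<theta>
    proof -
      have "norm (?z \<theta>) \<le> ?B"
        by (rule order.trans[OF norm_triangle_ineq]) (simp add: norm_mult)
      then show ?thesis
        by (simp add: norm_divide norm_power divide_right_mono power_mono)
    qed
    have int: "integrable (lborel_on (-pi) pi) (\<lambda>\<theta>. ?z \<theta> ^ k / fact k)" for k
      by (rule integrable_const_bound[of _ "?B ^ k / fact k"]) (use B in auto)
    have sB: "summable (\<lambda>k. ?B ^ k / fact k)"
      using summable_exp[of ?B] by (simp add: divide_inverse mult.commute)
    have "(\<lambda>k. (\<integral>\<theta>. ?z \<theta> ^ k / fact k \<partial>lborel_on (-pi) pi)) sums (\<integral>\<theta>. (\<Sum>k. ?z \<theta> ^ k / fact k) \<partial>lborel_on (-pi) pi)"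
    proof (rule sums_integral[OF int])
      show "AE \<theta> in lborel_on (-pi) pi. summable (\<lambda>k. norm (?z \<theta> ^ k / fact k))"
        using B by (intro AE_I2 summable_comparison_test'[OF sB, of 0]) simp
      show "summable (\<lambda>k. \<integral>\<theta>. norm (?z \<theta> ^ k / fact k) \<partial>lborel_on (-pi) pi)"
      proof (rule summable_comparison_test'[of _ 0])
        show "summable (\<lambda>k. measure (lborel_on (-pi) pi) UNIV * (?B ^ k / fact k))"
          by (intro summable_mult sB)
        fix k
        have "(\<integral>\<theta>. norm (?z \<theta> ^ k / fact k) \<partial>lborel_on (-pi) pi) \<le> (\<integral>\<theta>. ?B ^ k / fact k \<partial>lborel_on (-pi) pi)"
          by (intro integral_mono integrable_norm int B) simp
        then show "norm (\<integral>\<theta>. norm (?z \<theta> ^ k / fact k) \<partial>lborel_on (-pi) pi) \<le> measure (lborel_on (-pi) pi) UNIV * (?B ^ k / fact k)"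
          by (simp only: lebesgue_integral_const space_lborel_on real_scaleR_def real_norm_def
              abs_of_nonneg Bochner_Integration.integral_nonneg norm_ge_zero)
      qed
    qed
    moreover have "exp (?z \<theta>) = (\<Sum>k. ?z \<theta> ^ k / fact k)" for \<theta>
      by (simp add: exp_def scaleR_conv_of_real divide_inverse mult.commute)
    ultimately show ?thesis by simp
  qed
  show ?thesis
    using sums[of p q] sums[of p' q'] unfolding integral_circle_power assms by (rule sums_unique2)
qed

text \<open>The time window is one full period of \<open>cis (4 * t)\<close>, the frequency left in
  the space-time form of coherent states after integration over x.\<close>

lemma integral_circle_rescale:
  "(\<integral>t. exp (p * cis (4 * t) + q * cis (- (4 * t))) \<partial>lborel_on (-pi/4) (pi/4)) =
   (\<integral>\<theta>. exp (p * cis \<theta> + q * cis (- \<theta>)) \<partial>lborel_on (-pi) pi) / 4"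
proof -
  have "(\<integral>\<theta>. indicator {-pi..pi} \<theta> *\<^sub>R exp (p * cis \<theta> + q * cis (- \<theta>)) \<partial>lborel) =
     4 *\<^sub>R (\<integral>t. indicator {-pi..pi} (4 * t) *\<^sub>R exp (p * cis (4 * t) + q * cis (- (4 * t))) \<partial>lborel)"
    using lborel_integral_real_affine[of 4 "\<lambda>\<theta>. indicator {-pi..pi} \<theta> *\<^sub>R exp (p * cis \<theta> + q * cis (- \<theta>))" 0] by simp
  also have "(\<lambda>t. indicator {-pi..pi} (4 * t) *\<^sub>R exp (p * cis (4 * t) + q * cis (- (4 * t)))) =
    (\<lambda>t. indicator {-pi/4..pi/4} t *\<^sub>R exp (p * cis (4 * t) + q * cis (- (4 * t))))"
  proof
    fix t
    have "indicator {-pi..pi} (4 * t) = (indicator {-pi/4..pi/4} t :: real)"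
      by (auto simp: indicator_def)
    then show "indicator {-pi..pi} (4 * t) *\<^sub>R exp (p * cis (4 * t) + q * cis (- (4 * t))) =
      indicator {-pi/4..pi/4} t *\<^sub>R exp (p * cis (4 * t) + q * cis (- (4 * t)))" by simp
  qed
  finally show ?thesis
    by (simp add: integral_lborel_on scaleR_conv_of_real)
qed

text \<open>Only the real part of \<open>b\<close> is removed by a shift, which stays on the real
  line; the imaginary part then appears in the characteristic function of the standard normal
  distribution, so no contour is moved.\<close>

lemma gauss_integral_complex:
  fixes a :: real and b :: complex
  assumes "a > 0"
  shows "(\<integral>x. exp (- of_real a * (of_real x)\<^sup>2 + 2 * b * of_real x) \<partial>lborel) = of_real (sqrt (pi / a)) * exp (b\<^sup>2 / of_real a)"
proof -
  \<comment> \<open>The scale with a c^2 = 1/2, which turns the quadratic term into that of the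
    standard normal density.\<close>
  define c where "c = 1 / sqrt (2 * a)"
  define \<beta> where "\<beta> = Re b"
  define \<gamma> where "\<gamma> = Im b"
  have b: "b = of_real \<beta> + \<i> * of_real \<gamma>" by (simp add: \<beta>_def \<gamma>_def complex_eq_iff)
  have c: "c > 0" "c\<^sup>2 = 1 / (2 * a)" using assms by (auto simp: c_def power_divide)
  have ac: "complex_of_real a * (of_real c)\<^sup>2 = 1 / 2"
    using assms c(2) by (simp flip: of_real_power)
  define E where "E = exp (of_real (\<beta>\<^sup>2 / a) + 2 * \<i> * of_real (\<gamma> * \<beta> / a))"
  have std: "(\<integral>y. complex_of_real (exp (- y\<^sup>2 / 2)) * iexp (2 * \<gamma> * c * y) \<partial>lborel) = of_real (sqrt (2 * pi) * exp (- (2 * \<gamma> * c)\<^sup>2 / 2))"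
  proof -
    have "char std_normal_distribution (2 * \<gamma> * c) = (\<integral>y. std_normal_density y *\<^sub>R iexp (2 * \<gamma> * c * y) \<partial>lborel)"
      unfolding char_def by (subst integral_density) auto
    also have "\<dots> = (\<integral>y. (1 / sqrt (2 * pi)) * (complex_of_real (exp (- y\<^sup>2 / 2)) * iexp (2 * \<gamma> * c * y)) \<partial>lborel)"
      by (simp add: std_normal_density_def scaleR_conv_of_real)
    finally show ?thesis
      unfolding char_std_normal_distribution integral_mult_right_zero by (simp add: field_simps)
  qed
  have arg: "- of_real a * (of_real (\<beta> / a + c * y))\<^sup>2 + 2 * b * of_real (\<beta> / a + c * y) =
     (of_real (\<beta>\<^sup>2 / a) + 2 * \<i> * of_real (\<gamma> * \<beta> / a)) + (of_real (- y\<^sup>2 / 2) + \<i> * of_real (2 * \<gamma> * c * y))" for y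
  proof -
    have r: "- a * (\<beta> / a + c * y)\<^sup>2 + 2 * \<beta> * (\<beta> / a + c * y) = \<beta>\<^sup>2 / a - y\<^sup>2 / 2"
    proof -
      have "- a * (\<beta> / a + c * y)\<^sup>2 + 2 * \<beta> * (\<beta> / a + c * y) = \<beta>\<^sup>2 / a - a * c\<^sup>2 * y\<^sup>2"
        using assms by (simp add: power2_eq_square field_simps)
      then show ?thesis using assms by (simp add: c(2))
    qed
    have i: "2 * \<gamma> * (\<beta> / a + c * y) = 2 * (\<gamma> * \<beta> / a) + 2 * \<gamma> * c * y"
      by (simp add: algebra_simps)
    have "- of_real a * (of_real (\<beta> / a + c * y))\<^sup>2 + 2 * b * of_real (\<beta> / a + c * y) =
      complex_of_real (- a * (\<beta> / a + c * y)\<^sup>2 + 2 * \<beta> * (\<beta> / a + c * y)) + \<i> * complex_of_real (2 * \<gamma> * (\<beta> / a + c * y))"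
      unfolding b by (simp add: algebra_simps)
    then show ?thesis unfolding r i by (simp add: algebra_simps)
  qed
  have "(\<integral>x. exp (- of_real a * (of_real x)\<^sup>2 + 2 * b * of_real x) \<partial>lborel) =
     c *\<^sub>R (\<integral>y. exp (- of_real a * (of_real (\<beta> / a + c * y))\<^sup>2 + 2 * b * of_real (\<beta> / a + c * y)) \<partial>lborel)"
    using c(1) by (subst lborel_integral_real_affine[of c _ "\<beta> / a"]) auto
  also have "\<dots> = c *\<^sub>R (E * of_real (sqrt (2 * pi) * exp (- (2 * \<gamma> * c)\<^sup>2 / 2)))"
  proof -
    have "exp (- of_real a * (of_real (\<beta> / a + c * y))\<^sup>2 + 2 * b * of_real (\<beta> / a + c * y)) =
       E * (complex_of_real (exp (- y\<^sup>2 / 2)) * iexp (2 * \<gamma> * c * y))" for y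
      by (simp only: arg exp_add exp_of_real[symmetric] E_def)
    then show ?thesis by (simp only: integral_mult_right_zero std)
  qed
  also have "\<dots> = of_real (c * sqrt (2 * pi)) * (E * exp (of_real (- (2 * \<gamma> * c)\<^sup>2 / 2)))"
    by (simp only: scaleR_conv_of_real of_real_mult exp_of_real mult_ac)
  also have "c * sqrt (2 * pi) = sqrt (pi / a)"
    unfolding c_def using assms by (simp add: real_sqrt_divide real_sqrt_mult)
  also have "E * exp (of_real (- (2 * \<gamma> * c)\<^sup>2 / 2)) = exp (b\<^sup>2 / of_real a)"
  proof -
    have "- (2 * \<gamma> * c)\<^sup>2 / 2 = - \<gamma>\<^sup>2 / a"
      using c(2) assms by (simp add: power_mult_distrib)
    moreover have "of_real (\<beta>\<^sup>2 / a) + 2 * \<i> * of_real (\<gamma> * \<beta> / a) + complex_of_real (- \<gamma>\<^sup>2 / a) = b\<^sup>2 / of_real a"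
      unfolding b using assms by (simp add: power2_eq_square field_simps)
    ultimately show ?thesis unfolding E_def exp_add[symmetric] by simp
  qed
  finally show ?thesis .
qed

section \<open>Rotations about the diagonal\<close>

text \<open>By Rodrigues' formula the matrix of a rotation about (1, 1, 1) is circulant. These are
  its three entries, with rows (a, b, c), (c, a, b), (b, c, a).\<close>

definition rot_a :: "real \<Rightarrow> real" where "rot_a \<theta> = (1 + 2 * cos \<theta>) / 3"
definition rot_b :: "real \<Rightarrow> real" where "rot_b \<theta> = (1 - cos \<theta> + sqrt 3 * sin \<theta>) / 3"
definition rot_c :: "real \<Rightarrow> real" where "rot_c \<theta> = (1 - cos \<theta> - sqrt 3 * sin \<theta>) / 3"

text \<open>Unit length of the rows, and orthogonality of distinct rows, which for a circulant
  matrix is a single equation. Together they express that the matrix is orthogonal.\<close>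

lemma rot_square_sum: "rot_a \<theta> * rot_a \<theta> + rot_b \<theta> * rot_b \<theta> + rot_c \<theta> * rot_c \<theta> = 1"
  and rot_product_sum: "rot_a \<theta> * rot_b \<theta> + rot_b \<theta> * rot_c \<theta> + rot_c \<theta> * rot_a \<theta> = 0"
proof -
  have s: "sin \<theta> * sin \<theta> = 1 - cos \<theta> * cos \<theta>"
    using sin_squared_eq[of \<theta>] by (simp add: power2_eq_square)
  have q: "sqrt 3 * sin \<theta> * (sqrt 3 * sin \<theta>) = 3 * (1 - cos \<theta> * cos \<theta>)"
  proof -
    have "sqrt 3 * sin \<theta> * (sqrt 3 * sin \<theta>) = (sqrt 3 * sqrt 3) * (sin \<theta> * sin \<theta>)"
      by (simp only: mult_ac)
    then show ?thesis unfolding s by simp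
  qed
  have "(1 + 2 * C) / 3 * ((1 + 2 * C) / 3) + (1 - C + w) / 3 * ((1 - C + w) / 3) + (1 - C - w) / 3 * ((1 - C - w) / 3)
      = (3 + 6 * (C * C) + 2 * (w * w)) / 9" for C w :: real
    by (simp add: field_simps)
  from this[of "cos \<theta>" "sqrt 3 * sin \<theta>"]
  show "rot_a \<theta> * rot_a \<theta> + rot_b \<theta> * rot_b \<theta> + rot_c \<theta> * rot_c \<theta> = 1"
    unfolding rot_a_def rot_b_def rot_c_def q by simp
  have "(1 + 2 * C) / 3 * ((1 - C + w) / 3) + (1 - C + w) / 3 * ((1 - C - w) / 3) + (1 - C - w) / 3 * ((1 + 2 * C) / 3)
      = (3 - 3 * (C * C) - w * w) / 9" for C w :: real
    by (simp add: field_simps)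
  from this[of "cos \<theta>" "sqrt 3 * sin \<theta>"]
  show "rot_a \<theta> * rot_b \<theta> + rot_b \<theta> * rot_c \<theta> + rot_c \<theta> * rot_a \<theta> = 0"
    unfolding rot_a_def rot_b_def rot_c_def q by simp
qed

lemma rot_bound: "\<bar>rot_a \<theta>\<bar> \<le> 1" "\<bar>rot_b \<theta>\<bar> \<le> 1" "\<bar>rot_c \<theta>\<bar> \<le> 1"
proof -
  have "x * x \<le> 1 \<Longrightarrow> \<bar>x\<bar> \<le> 1" for x :: real
    by (metis abs_square_le_1 power2_eq_square)
  moreover have "rot_a \<theta> * rot_a \<theta> \<le> 1" "rot_b \<theta> * rot_b \<theta> \<le> 1" "rot_c \<theta> * rot_c \<theta> \<le> 1"
    using rot_square_sum[of \<theta>] zero_le_square[of "rot_a \<theta>"] zero_le_square[of "rot_b \<theta>"] zero_le_square[of "rot_c \<theta>"]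
    by linarith+
  ultimately show "\<bar>rot_a \<theta>\<bar> \<le> 1" "\<bar>rot_b \<theta>\<bar> \<le> 1" "\<bar>rot_c \<theta>\<bar> \<le> 1"
    by blast+
qed

lemma measurable_rot [measurable]:
  "rot_a \<in> borel_measurable borel" "rot_b \<in> borel_measurable borel" "rot_c \<in> borel_measurable borel"
  unfolding rot_a_def[abs_def] rot_b_def[abs_def] rot_c_def[abs_def] by measurable

text \<open>The rotation by \<open>\<theta>\<close> about the axis \<open>(1, 1, 1)\<close>.\<close>

definition rot :: "real \<Rightarrow> real \<times> real \<times> real \<Rightarrow> real \<times> real \<times> real" where
  "rot \<theta> = (\<lambda>(x, y, z). (rot_a \<theta> * x + rot_b \<theta> * y + rot_c \<theta> * z,
     rot_c \<theta> * x + rot_a \<theta> * y + rot_b \<theta> * z, rot_b \<theta> * x + rot_c \<theta> * y + rot_a \<theta> * z))"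

text \<open>The preimage of a box is its image under the inverse, again an orthogonal map and hence
  measure preserving; boxes determine Lebesgue measure.\<close>

lemma distr_lborel_orthogonal:
  fixes f :: "real^'n::{finite,wellorder} \<Rightarrow> real^'n::_"
  assumes f: "orthogonal_transformation f"
  shows "distr lborel borel f = lborel"
proof (rule lborel_eqI[symmetric])
  have "continuous_on UNIV f"
    by (rule linear_continuous_on[OF linear_conv_bounded_linear[THEN iffD1, OF orthogonal_transformation_linear[OF f]]])
  then have [measurable]: "f \<in> borel_measurable borel" by (rule borel_measurable_continuous_onI)
  fix l u :: "real^'n::_" assume lu: "\<And>b. b \<in> Basis \<Longrightarrow> l \<bullet> b \<le> u \<bullet> b"
  have vi: "f -` box l u = inv f ` box l u"
    using orthogonal_transformation_bij[OF f] by (simp add: bij_vimage_eq_inv_image)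
  have box: "box l u \<in> lmeasurable" by simp
  note g = orthogonal_transformation_inv[OF f]
  have lm: "f -` box l u \<in> lmeasurable" "measure lebesgue (f -` box l u) = measure lebesgue (box l u)"
    unfolding vi using measurable_orthogonal_image[OF g box] measure_orthogonal_image[OF g box] by auto
  have sb: "f -` box l u \<in> sets borel"
    using measurable_sets[of f borel borel "box l u"] by simp
  have "emeasure lborel (f -` box l u) = emeasure lebesgue (f -` box l u)"
    using sb by (simp add: emeasure_completion)
  also have "\<dots> = ennreal (measure lebesgue (box l u))"
    using lm(1) by (simp add: emeasure_eq_measure2 lm(2)[symmetric])
  also have "\<dots> = emeasure lborel (box l u)"
    using emeasure_eq_measure2[OF box] by simp
  finally show "emeasure (distr lborel borel f) (box l u) = ennreal (\<Prod>b\<in>Basis. (u - l) \<bullet> b)"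
    using lu by (simp add: emeasure_distr emeasure_lborel_box)
qed simp

lemma emeasure_lborel_Times:
  fixes A :: "'a::euclidean_space set" and B :: "'b::euclidean_space set"
  assumes "A \<in> sets borel" "B \<in> sets borel"
  shows "emeasure lborel (A \<times> B) = emeasure lborel A * emeasure lborel B"
  unfolding lborel_prod[symmetric] using assms by (intro lborel.emeasure_pair_measure_Times) auto

lemma measurable_vec3 [measurable]:
  "(\<lambda>(x, y, z). vector [x, y, z] :: real^3) \<in> borel_measurable borel" (is "?V \<in> _")
proof -
  have V: "?V p = (fst p) *\<^sub>R axis 1 1 + fst (snd p) *\<^sub>R axis 2 1 + snd (snd p) *\<^sub>R axis 3 1" for p
    by (auto simp: vec_eq_iff forall_3 axis_def split: prod.split)
  have "continuous_on UNIV ?V"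
    unfolding V by (intro continuous_intros)
  then show ?thesis by (rule borel_measurable_continuous_onI)
qed

text \<open>Carries Lebesgue measure from nested pairs to \<open>real^3\<close>, the setting of
  \<open>distr_lborel_orthogonal\<close>.\<close>

lemma distr_lborel_vec3:
  "distr lborel borel (\<lambda>(x, y, z). vector [x, y, z] :: real^3) = lborel"
proof (rule lborel_eqI[symmetric])
  let ?V = "\<lambda>(x, y, z). vector [x, y, z] :: real^3"
  fix l u :: "real^3" assume lu: "\<And>b. b \<in> Basis \<Longrightarrow> l \<bullet> b \<le> u \<bullet> b"
  have lu': "vec_nth l i \<le> vec_nth u i" for i
    using lu[of "axis i 1"] by (auto simp: inner_axis Basis_vec_def)
  have "?V -` box l u = {vec_nth l 1<..<vec_nth u 1} \<times> {vec_nth l 2<..<vec_nth u 2} \<times> {vec_nth l 3<..<vec_nth u 3}"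
    by (auto simp: mem_box_cart forall_3)
  then have "emeasure (distr lborel borel ?V) (box l u) = emeasure lborel ({vec_nth l 1<..<vec_nth u 1} \<times> {vec_nth l 2<..<vec_nth u 2} \<times> {vec_nth l 3<..<vec_nth u 3})"
    by (simp add: emeasure_distr)
  also have "\<dots> = ennreal (vec_nth u 1 - vec_nth l 1) * (ennreal (vec_nth u 2 - vec_nth l 2) * ennreal (vec_nth u 3 - vec_nth l 3))"
  proof -
    have B: "{vec_nth l 2<..<vec_nth u 2} \<times> {vec_nth l 3<..<vec_nth u 3} \<in> sets borel"
      by (intro borel_open open_Times) auto
    have "emeasure lborel ({vec_nth l 1<..<vec_nth u 1} \<times> {vec_nth l 2<..<vec_nth u 2} \<times> {vec_nth l 3<..<vec_nth u 3}) =
      emeasure lborel {vec_nth l 1<..<vec_nth u 1} * emeasure lborel ({vec_nth l 2<..<vec_nth u 2} \<times> {vec_nth l 3<..<vec_nth u 3})"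
      by (rule emeasure_lborel_Times[OF _ B]) simp
    also have "emeasure lborel ({vec_nth l 2<..<vec_nth u 2} \<times> {vec_nth l 3<..<vec_nth u 3}) =
      emeasure lborel {vec_nth l 2<..<vec_nth u 2} * emeasure lborel {vec_nth l 3<..<vec_nth u 3}"
      by (rule emeasure_lborel_Times) simp_all
    finally show ?thesis
      by (simp only: emeasure_lborel_Ioo lu')
  qed
  also have "\<dots> = ennreal (\<Prod>i\<in>UNIV. vec_nth (u - l) i)"
  proof -
    have "(\<Prod>i\<in>UNIV. vec_nth (u - l) i) = (vec_nth u 1 - vec_nth l 1) * ((vec_nth u 2 - vec_nth l 2) * (vec_nth u 3 - vec_nth l 3))"
      unfolding UNIV_3 by simp
    then show ?thesis using lu' by (simp only: ennreal_mult mult_nonneg_nonneg diff_ge_0_iff_ge)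
  qed
  also have "(\<Prod>i\<in>UNIV. vec_nth (u - l) i) = (\<Prod>b\<in>Basis. (u - l) \<bullet> b)"
  proof -
    have B: "(Basis :: (real^3) set) = range (\<lambda>i. axis i 1)"
      by (auto simp: Basis_vec_def)
    have inj: "inj (\<lambda>i. axis i (1::real) :: real^3)"
      by (auto simp: inj_on_def axis_eq_axis)
    have "(\<Prod>b\<in>Basis. (u - l) \<bullet> b) = (\<Prod>i\<in>UNIV. (u - l) \<bullet> axis i 1)"
      unfolding B using prod.reindex[OF inj, of "\<lambda>b. (u - l) \<bullet> b"] by (simp only: o_def)
    then show ?thesis by (simp add: inner_axis)
  qed
  finally show "emeasure (distr lborel borel ?V) (box l u) = ennreal (\<Prod>b\<in>Basis. (u - l) \<bullet> b)" .
qed simp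

lemma measurable_rot_map [measurable]: "rot \<theta> \<in> borel_measurable borel"
proof -
  have "continuous_on UNIV (rot \<theta>)"
    unfolding rot_def split_beta' by (intro continuous_intros)
  then show ?thesis by (rule borel_measurable_continuous_onI)
qed

text \<open>\<open>rot\<close> is an orthogonal map of \<open>real^3\<close> conjugated by the
  passage between triples and vectors, and each of the three factors preserves Lebesgue
  measure.\<close>

lemma distr_lborel_rot: "distr lborel borel (rot \<theta>) = lborel"
proof -
  let ?V = "\<lambda>(x, y, z). vector [x, y, z] :: real^3"
  let ?W = "\<lambda>v :: real^3. (vec_nth v 1, vec_nth v 2, vec_nth v 3)"
  let ?a = "rot_a \<theta>" and ?b = "rot_b \<theta>" and ?c = "rot_c \<theta>"
  define f :: "real^3 \<Rightarrow> real^3" where "f v = vector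
    [?a * vec_nth v 1 + ?b * vec_nth v 2 + ?c * vec_nth v 3, ?c * vec_nth v 1 + ?a * vec_nth v 2 + ?b * vec_nth v 3, ?b * vec_nth v 1 + ?c * vec_nth v 2 + ?a * vec_nth v 3]" for v
  have "linear f"
    by (rule linearI) (simp_all add: f_def vec_eq_iff forall_3 distrib_left mult.left_commute)
  moreover have "f v \<bullet> f w = v \<bullet> w" for v w
  proof -
    have ident: "(a * x + b * y + c * z) * (a * x' + b * y' + c * z') + (c * x + a * y + b * z) * (c * x' + a * y' + b * z')
        + (b * x + c * y + a * z) * (b * x' + c * y' + a * z') =
      (a * a + b * b + c * c) * (x * x' + y * y' + z * z')
      + (a * b + b * c + c * a) * (x * y' + y * x' + x * z' + z * x' + y * z' + z * y')"
      for a b c x y z x' y' z' :: real by (simp add: algebra_simps)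
    have "f v \<bullet> f w = (?a * ?a + ?b * ?b + ?c * ?c) * (vec_nth v 1 * vec_nth w 1 + vec_nth v 2 * vec_nth w 2 + vec_nth v 3 * vec_nth w 3)
      + (?a * ?b + ?b * ?c + ?c * ?a) * (vec_nth v 1 * vec_nth w 2 + vec_nth v 2 * vec_nth w 1 + vec_nth v 1 * vec_nth w 3 + vec_nth v 3 * vec_nth w 1 + vec_nth v 2 * vec_nth w 3 + vec_nth v 3 * vec_nth w 2)"
      unfolding ident[symmetric] by (simp add: f_def inner_vec_def sum_3)
    then show ?thesis
      by (simp add: rot_square_sum rot_product_sum inner_vec_def sum_3)
  qed
  ultimately have f: "orthogonal_transformation f"
    by (simp add: orthogonal_transformation_def)
  have cont: "continuous_on UNIV f"
    by (rule linear_continuous_on[OF linear_conv_bounded_linear[THEN iffD1, OF orthogonal_transformation_linear[OF f]]])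
  have [measurable]: "f \<in> borel_measurable borel"
    using cont by (rule borel_measurable_continuous_onI)
  have mW [measurable]: "?W \<in> borel_measurable borel"
    by (intro borel_measurable_continuous_onI continuous_intros)
  have WV: "distr (lborel :: (real^3) measure) borel ?W = lborel"
  proof -
    have "distr (distr lborel borel ?V) borel ?W = distr lborel borel (?W \<circ> ?V)"
      by (intro distr_distr) measurable
    also have "?W \<circ> ?V = (\<lambda>x. x)" by auto
    finally show ?thesis unfolding distr_lborel_vec3 by (simp add: distr_id2)
  qed
  have "rot \<theta> = ?W \<circ> (f \<circ> ?V)"
    by (auto simp: rot_def f_def)
  then have "distr lborel borel (rot \<theta>) = distr (distr (distr lborel borel ?V) borel f) borel ?W"
    by (simp add: distr_distr comp_assoc)
  also have "\<dots> = lborel"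
    unfolding distr_lborel_vec3 distr_lborel_orthogonal[OF f] by (rule WV)
  finally show ?thesis .
qed

lemma nn_integral_rot:
  assumes [measurable]: "f \<in> borel_measurable borel"
  shows "(\<integral>\<^sup>+p. f (rot \<theta> p) \<partial>lborel) = (\<integral>\<^sup>+p. f p \<partial>lborel)"
proof -
  have "(\<integral>\<^sup>+p. f p \<partial>lborel) = (\<integral>\<^sup>+p. f p \<partial>distr lborel borel (rot \<theta>))"
    by (simp add: distr_lborel_rot)
  also have "\<dots> = (\<integral>\<^sup>+p. f (rot \<theta> p) \<partial>lborel)"
    by (subst nn_integral_distr) auto
  finally show ?thesis ..
qed

section \<open>The space-time form and the rotation form\<close>

lemma prod_lessThan_6: "(\<Prod>i<6. f i) = f 0 * f 1 * f 2 * f 3 * f 4 * (f (5::nat) :: 'a :: comm_monoid_mult)"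
  by (simp add: eval_nat_numeral mult.assoc)

text \<open>The last three of six slots are conjugated. Families indexed by the slot allow one slot
  to be replaced by function update, the form in which multilinearity is used.\<close>

definition cnj_slot :: "nat \<Rightarrow> complex \<Rightarrow> complex" where
  "cnj_slot i z = (if i < 3 then z else cnj z)"

lemma measurable_cnj_slot [measurable]: "cnj_slot i \<in> borel_measurable borel"
  unfolding cnj_slot_def[abs_def] by (cases "i < 3") auto

lemma norm_cnj_slot [simp]: "norm (cnj_slot i z) = norm z"
  by (simp add: cnj_slot_def)

lemma cnj_slot_add: "cnj_slot i (z + w) = cnj_slot i z + cnj_slot i w"
  by (simp add: cnj_slot_def)

lemma cnj_slot_mult: "cnj_slot i (z * w) = cnj_slot i z * cnj_slot i w"
  by (simp add: cnj_slot_def)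

definition time_space :: "(real \<times> real) measure" where
  "time_space = lborel_on (-pi/4) (pi/4) \<Otimes>\<^sub>M lborel"

lemma sets_time_space [simp, measurable_cong]: "sets time_space = sets (borel \<Otimes>\<^sub>M borel)"
  unfolding time_space_def by (rule sets_pair_measure_cong) auto

definition time_density :: "(nat \<Rightarrow> real \<Rightarrow> complex) \<Rightarrow> real \<times> real \<Rightarrow> complex" where
  "time_density F p = (\<Prod>i<6. cnj_slot i (flow (F i) (fst p) (snd p)))"

definition time_form :: "(nat \<Rightarrow> real \<Rightarrow> complex) \<Rightarrow> complex" where
  "time_form F = integral\<^sup>L time_space (time_density F)"

lemma measurable_flow' [measurable]: "(\<lambda>p. flow f (fst p) (snd p)) \<in> borel_measurable (borel \<Otimes>\<^sub>M borel)"
  using measurable_flow(1)[of f] by (simp add: split_beta')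

lemma measurable_time_density [measurable]: "time_density F \<in> borel_measurable (borel \<Otimes>\<^sub>M borel)"
  unfolding time_density_def[abs_def] by measurable

definition rot_space :: "(real \<times> real \<times> real \<times> real) measure" where
  "rot_space = lborel \<Otimes>\<^sub>M (lborel_on (-pi) pi \<Otimes>\<^sub>M (lborel \<Otimes>\<^sub>M lborel))"

lemma sets_rot_space [simp, measurable_cong]:
  "sets rot_space = sets (borel \<Otimes>\<^sub>M (borel \<Otimes>\<^sub>M (borel \<Otimes>\<^sub>M borel)))"
  unfolding rot_space_def by (intro sets_pair_measure_cong) auto

text \<open>
  The last slot \<open>z\<close> is the outermost component, so that the dual variable can be split off by
  Fubini's theorem.
\<close>

definition coord :: "nat \<Rightarrow> real \<times> real \<times> real \<times> real \<Rightarrow> real" where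
  "coord i = (\<lambda>(z, \<theta>, y1, y2).
     if i = 0 then fst (rot \<theta> (z, y1, y2)) else if i = 1 then fst (snd (rot \<theta> (z, y1, y2)))
     else if i = 2 then snd (snd (rot \<theta> (z, y1, y2))) else if i = 3 then y1 else if i = 4 then y2 else z)"

lemma coord_simps:
  "coord 0 (z, \<theta>, y1, y2) = rot_a \<theta> * z + rot_b \<theta> * y1 + rot_c \<theta> * y2"
  "coord (Suc 0) (z, \<theta>, y1, y2) = rot_c \<theta> * z + rot_a \<theta> * y1 + rot_b \<theta> * y2"
  "coord 1 (z, \<theta>, y1, y2) = rot_c \<theta> * z + rot_a \<theta> * y1 + rot_b \<theta> * y2"
  "coord 2 (z, \<theta>, y1, y2) = rot_b \<theta> * z + rot_c \<theta> * y1 + rot_a \<theta> * y2"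
  "coord 3 (z, \<theta>, y1, y2) = y1" "coord 4 (z, \<theta>, y1, y2) = y2" "coord 5 (z, \<theta>, y1, y2) = z"
  by (simp_all add: coord_def rot_def)

lemma measurable_coord [measurable]:
  "coord i \<in> borel_measurable (borel \<Otimes>\<^sub>M (borel \<Otimes>\<^sub>M (borel \<Otimes>\<^sub>M borel)))"
  unfolding coord_def rot_def split_beta' by simp measurable

definition rot_density :: "(nat \<Rightarrow> real \<Rightarrow> complex) \<Rightarrow> real \<times> real \<times> real \<times> real \<Rightarrow> complex" where
  "rot_density F p = (\<Prod>i<6. cnj_slot i (F i (coord i p)))"

definition rot_form :: "(nat \<Rightarrow> real \<Rightarrow> complex) \<Rightarrow> complex" where
  "rot_form F = integral\<^sup>L rot_space (rot_density F)"

lemma measurable_rot_density: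
  assumes "\<And>i. i < 6 \<Longrightarrow> F i \<in> borel_measurable borel"
  shows "rot_density F \<in> borel_measurable (borel \<Otimes>\<^sub>M (borel \<Otimes>\<^sub>M (borel \<Otimes>\<^sub>M borel)))"
  unfolding rot_density_def[abs_def]
proof (rule borel_measurable_prod)
  fix i :: nat assume "i \<in> {..<6}"
  then have [measurable]: "F i \<in> borel_measurable borel" using assms by simp
  show "(\<lambda>p. cnj_slot i (F i (coord i p))) \<in> borel_measurable (borel \<Otimes>\<^sub>M (borel \<Otimes>\<^sub>M (borel \<Otimes>\<^sub>M borel)))"
    by measurable
qed

lemma nn_integral_time_space:
  assumes [measurable]: "f \<in> borel_measurable (borel \<Otimes>\<^sub>M borel)"
  shows "(\<integral>\<^sup>+p. f p \<partial>time_space) = (\<integral>\<^sup>+t. (\<integral>\<^sup>+x. f (t, x) \<partial>lborel) \<partial>lborel_on (-pi/4) (pi/4))"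
  unfolding time_space_def by (intro lborel.nn_integral_fst[symmetric]) measurable

lemma lborel3: "lborel \<Otimes>\<^sub>M (lborel \<Otimes>\<^sub>M lborel) = (lborel :: (real \<times> real \<times> real) measure)"
  by (simp add: lborel_prod)

lemma sigma_finite_lborel2: "sigma_finite_measure (lborel \<Otimes>\<^sub>M lborel :: (real \<times> real) measure)"
  unfolding lborel_prod by (rule sigma_finite_lborel)

text \<open>The angle is moved to the outside, so that at a fixed angle the rotation invariance of
  the three-dimensional integral can be used.\<close>

lemma nn_integral_rot_space:
  assumes [measurable]: "f \<in> borel_measurable (borel \<Otimes>\<^sub>M (borel \<Otimes>\<^sub>M (borel \<Otimes>\<^sub>M borel)))"
  shows "(\<integral>\<^sup>+p. f p \<partial>rot_space) =
    (\<integral>\<^sup>+\<theta>. (\<integral>\<^sup>+b. f (fst b, \<theta>, snd b) \<partial>lborel) \<partial>lborel_on (-pi) pi)"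
proof -
  interpret L2: sigma_finite_measure "lborel \<Otimes>\<^sub>M lborel :: (real \<times> real) measure"
    by (rule sigma_finite_lborel2)
  interpret C: sigma_finite_measure "lborel_on (-pi) pi"
    by (rule sigma_finite_lborel_on)
  interpret P: pair_sigma_finite "lborel_on (-pi) pi" "lborel \<Otimes>\<^sub>M lborel :: (real \<times> real) measure" ..
  interpret Q: pair_sigma_finite "lborel_on (-pi) pi" "lborel :: real measure" ..
  have "(\<integral>\<^sup>+p. f p \<partial>rot_space) =
      (\<integral>\<^sup>+z. (\<integral>\<^sup>+q. f (z, q) \<partial>(lborel_on (-pi) pi \<Otimes>\<^sub>M (lborel \<Otimes>\<^sub>M lborel))) \<partial>lborel)"
    unfolding rot_space_def by (intro P.nn_integral_fst[symmetric]) measurable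
  also have "\<dots> = (\<integral>\<^sup>+z. (\<integral>\<^sup>+\<theta>. (\<integral>\<^sup>+w. f (z, \<theta>, w) \<partial>(lborel \<Otimes>\<^sub>M lborel)) \<partial>lborel_on (-pi) pi) \<partial>lborel)"
    by (intro nn_integral_cong sigma_finite_measure.nn_integral_fst[OF sigma_finite_lborel2, symmetric]) measurable
  also have "\<dots> = (\<integral>\<^sup>+\<theta>. (\<integral>\<^sup>+z. (\<integral>\<^sup>+w. f (z, \<theta>, w) \<partial>(lborel \<Otimes>\<^sub>M lborel)) \<partial>lborel) \<partial>lborel_on (-pi) pi)"
    by (intro Q.Fubini') measurable
  also have "\<dots> = (\<integral>\<^sup>+\<theta>. (\<integral>\<^sup>+b. f (fst b, \<theta>, snd b) \<partial>(lborel \<Otimes>\<^sub>M (lborel \<Otimes>\<^sub>M lborel))) \<partial>lborel_on (-pi) pi)"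
  proof (intro nn_integral_cong)
    fix \<theta>
    have "(\<lambda>b. f (fst b, \<theta>, snd b)) \<in> borel_measurable (lborel \<Otimes>\<^sub>M (lborel \<Otimes>\<^sub>M lborel))"
      by measurable
    from sigma_finite_measure.nn_integral_fst[OF sigma_finite_lborel2 this]
    show "(\<integral>\<^sup>+z. (\<integral>\<^sup>+w. f (z, \<theta>, w) \<partial>(lborel \<Otimes>\<^sub>M lborel)) \<partial>lborel) =
      (\<integral>\<^sup>+b. f (fst b, \<theta>, snd b) \<partial>(lborel \<Otimes>\<^sub>M (lborel \<Otimes>\<^sub>M lborel)))" by simp
  qed
  finally show ?thesis by (simp only: lborel3)
qed

lemma nn_integral_lborel3:
  fixes f g h :: "real \<Rightarrow> ennreal"
  assumes [measurable]: "f \<in> borel_measurable borel" "g \<in> borel_measurable borel" "h \<in> borel_measurable borel"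
  shows "(\<integral>\<^sup>+b. f (fst b) * (g (fst (snd b)) * h (snd (snd b))) \<partial>lborel) =
    (\<integral>\<^sup>+x. f x \<partial>lborel) * ((\<integral>\<^sup>+x. g x \<partial>lborel) * (\<integral>\<^sup>+x. h x \<partial>lborel))"
proof -
  have "(\<integral>\<^sup>+b. f (fst b) * (g (fst (snd b)) * h (snd (snd b))) \<partial>lborel) =
     (\<integral>\<^sup>+x. (\<integral>\<^sup>+w. f x * (g (fst w) * h (snd w)) \<partial>(lborel \<Otimes>\<^sub>M lborel)) \<partial>lborel)"
    unfolding lborel3[symmetric]
    using sigma_finite_measure.nn_integral_fst[OF sigma_finite_lborel2,
        of "\<lambda>b. f (fst b) * (g (fst (snd b)) * h (snd (snd b)))" lborel] by simp
  also have "\<dots> = (\<integral>\<^sup>+x. f x * (\<integral>\<^sup>+w. g (fst w) * h (snd w) \<partial>(lborel \<Otimes>\<^sub>M lborel)) \<partial>lborel)"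
    by (intro nn_integral_cong nn_integral_cmult) measurable
  also have "\<dots> = (\<integral>\<^sup>+x. f x \<partial>lborel) * (\<integral>\<^sup>+w. g (fst w) * h (snd w) \<partial>(lborel \<Otimes>\<^sub>M lborel))"
    by (intro nn_integral_multc) measurable
  also have "(\<integral>\<^sup>+w. g (fst w) * h (snd w) \<partial>(lborel \<Otimes>\<^sub>M lborel)) = (\<integral>\<^sup>+y. (\<integral>\<^sup>+z. g y * h z \<partial>lborel) \<partial>lborel)"
    using lborel.nn_integral_fst[of "\<lambda>w. g (fst w) * h (snd w)" lborel] by simp
  also have "\<dots> = (\<integral>\<^sup>+x. g x \<partial>lborel) * (\<integral>\<^sup>+x. h x \<partial>lborel)"
    by (simp add: nn_integral_cmult nn_integral_multc)
  finally show ?thesis .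
qed

text \<open>The angle is integrated first: \<open>k\<close> depends on it and on z alone, and its
  angular integral is bounded uniformly in z. The uses are k = 1 and the square of a kernel such as
  \<open>peak\<close>.\<close>

lemma nn_integral_base_slots:
  fixes f g h :: "real \<Rightarrow> ennreal"
  assumes [measurable]: "f \<in> borel_measurable borel" "g \<in> borel_measurable borel" "h \<in> borel_measurable borel"
    "k \<in> borel_measurable (borel \<Otimes>\<^sub>M borel)"
  assumes k: "\<And>x. (\<integral>\<^sup>+\<theta>. k (\<theta>, x) \<partial>lborel_on (-pi) pi) \<le> C"
  shows "(\<integral>\<^sup>+p. k (fst (snd p), coord 5 p) * (f (coord 5 p) * (g (coord 3 p) * h (coord 4 p))) \<partial>rot_space) \<le>
    C * ((\<integral>\<^sup>+x. f x \<partial>lborel) * ((\<integral>\<^sup>+x. g x \<partial>lborel) * (\<integral>\<^sup>+x. h x \<partial>lborel)))"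
proof -
  interpret C: sigma_finite_measure "lborel_on (-pi) pi"
    by (rule sigma_finite_lborel_on)
  interpret Q: pair_sigma_finite "lborel_on (-pi) pi" "lborel :: (real \<times> real \<times> real) measure" ..
  let ?p = "\<lambda>b :: real \<times> real \<times> real. f (fst b) * (g (fst (snd b)) * h (snd (snd b)))"
  have mp [measurable]: "?p \<in> borel_measurable borel"
    unfolding borel_prod[symmetric] by measurable
  have [measurable]: "fst \<in> borel_measurable (borel :: (real \<times> real \<times> real) measure)"
    unfolding borel_prod[symmetric] by measurable
  have "(\<integral>\<^sup>+p. k (fst (snd p), coord 5 p) * (f (coord 5 p) * (g (coord 3 p) * h (coord 4 p))) \<partial>rot_space) =
    (\<integral>\<^sup>+\<theta>. (\<integral>\<^sup>+b. k (\<theta>, fst b) * ?p b \<partial>lborel) \<partial>lborel_on (-pi) pi)"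
    by (subst nn_integral_rot_space) (measurable, auto intro!: nn_integral_cong simp: coord_simps split_beta')
  also have "\<dots> = (\<integral>\<^sup>+b. (\<integral>\<^sup>+\<theta>. k (\<theta>, fst b) * ?p b \<partial>lborel_on (-pi) pi) \<partial>lborel)"
    by (intro Q.Fubini'[symmetric]) measurable
  also have "\<dots> = (\<integral>\<^sup>+b. (\<integral>\<^sup>+\<theta>. k (\<theta>, fst b) \<partial>lborel_on (-pi) pi) * ?p b \<partial>lborel)"
    by (intro nn_integral_cong nn_integral_multc) measurable
  also have "\<dots> \<le> (\<integral>\<^sup>+b. C * ?p b \<partial>lborel)"
    by (intro nn_integral_mono mult_right_mono k) simp
  also have "\<dots> = C * (\<integral>\<^sup>+b. ?p b \<partial>lborel)"
    by (intro nn_integral_cmult) measurable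
  finally show ?thesis by (simp only: nn_integral_lborel3 assms)
qed

text \<open>At a fixed angle the rotation makes coordinates 0, 1, 2 the independent variables
  without changing the measure. Then \<open>k\<close> depends on the angle and one independent
  variable, and the argument for the base slots applies.\<close>

lemma nn_integral_rot_slots:
  fixes f g h :: "real \<Rightarrow> ennreal"
  assumes [measurable]: "f \<in> borel_measurable borel" "g \<in> borel_measurable borel" "h \<in> borel_measurable borel"
    "k \<in> borel_measurable (borel \<Otimes>\<^sub>M borel)"
  assumes k: "\<And>x. (\<integral>\<^sup>+\<theta>. k (\<theta>, x) \<partial>lborel_on (-pi) pi) \<le> C" and j: "j < 3"
  shows "(\<integral>\<^sup>+p. k (fst (snd p), coord j p) * (f (coord 0 p) * (g (coord 1 p) * h (coord 2 p))) \<partial>rot_space) \<le>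
    C * ((\<integral>\<^sup>+x. f x \<partial>lborel) * ((\<integral>\<^sup>+x. g x \<partial>lborel) * (\<integral>\<^sup>+x. h x \<partial>lborel)))"
proof -
  interpret C: sigma_finite_measure "lborel_on (-pi) pi"
    by (rule sigma_finite_lborel_on)
  interpret Q: pair_sigma_finite "lborel_on (-pi) pi" "lborel :: (real \<times> real \<times> real) measure" ..
  let ?p = "\<lambda>b :: real \<times> real \<times> real. f (fst b) * (g (fst (snd b)) * h (snd (snd b)))"
  define c where "c b = (if j = 0 then fst b else if j = 1 then fst (snd b) else snd (snd b))" for b :: "real \<times> real \<times> real"
  have mp [measurable]: "?p \<in> borel_measurable borel"
    unfolding borel_prod[symmetric] by measurable
  have mc [measurable]: "c \<in> borel_measurable borel"
    unfolding c_def[abs_def] borel_prod[symmetric] by measurable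
  have cj: "coord j (fst b, \<theta>, snd b) = c (rot \<theta> b)" for \<theta> b
    using j by (auto simp: c_def coord_def split_beta')
  have "(\<integral>\<^sup>+p. k (fst (snd p), coord j p) * (f (coord 0 p) * (g (coord 1 p) * h (coord 2 p))) \<partial>rot_space) =
    (\<integral>\<^sup>+\<theta>. (\<integral>\<^sup>+b. k (\<theta>, coord j (fst b, \<theta>, snd b)) * (f (coord 0 (fst b, \<theta>, snd b)) *
        (g (coord 1 (fst b, \<theta>, snd b)) * h (coord 2 (fst b, \<theta>, snd b)))) \<partial>lborel) \<partial>lborel_on (-pi) pi)"
    (is "nn_integral rot_space ?F = _")
  proof -
    have "?F \<in> borel_measurable (borel \<Otimes>\<^sub>M (borel \<Otimes>\<^sub>M (borel \<Otimes>\<^sub>M borel)))"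
      by measurable
    from nn_integral_rot_space[OF this] show ?thesis by simp
  qed
  also have "\<dots> = (\<integral>\<^sup>+\<theta>. (\<integral>\<^sup>+b. k (\<theta>, c (rot \<theta> b)) * ?p (rot \<theta> b) \<partial>lborel) \<partial>lborel_on (-pi) pi)"
    unfolding cj by (simp add: coord_def split_beta')
  also have "\<dots> = (\<integral>\<^sup>+\<theta>. (\<integral>\<^sup>+b. k (\<theta>, c b) * ?p b \<partial>lborel) \<partial>lborel_on (-pi) pi)"
    by (intro nn_integral_cong nn_integral_rot[of "\<lambda>b. k (_, c b) * ?p b"]) measurable
  also have "\<dots> = (\<integral>\<^sup>+b. (\<integral>\<^sup>+\<theta>. k (\<theta>, c b) * ?p b \<partial>lborel_on (-pi) pi) \<partial>lborel)"
    by (intro Q.Fubini'[symmetric]) measurable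
  also have "\<dots> = (\<integral>\<^sup>+b. (\<integral>\<^sup>+\<theta>. k (\<theta>, c b) \<partial>lborel_on (-pi) pi) * ?p b \<partial>lborel)"
    by (intro nn_integral_cong nn_integral_multc) measurable
  also have "\<dots> \<le> (\<integral>\<^sup>+b. C * ?p b \<partial>lborel)"
    by (intro nn_integral_mono mult_right_mono k) simp
  also have "\<dots> = C * (\<integral>\<^sup>+b. ?p b \<partial>lborel)"
    by (intro nn_integral_cmult) measurable
  finally show ?thesis by (simp only: nn_integral_lborel3 assms)
qed

abbreviation sqnorm :: "(real \<Rightarrow> complex) \<Rightarrow> real" where
  "sqnorm f \<equiv> (\<integral>x. (norm (f x))\<^sup>2 \<partial>lborel)"

lemma mult_le_sum_squares: "(a::real) * b \<le> a\<^sup>2 + b\<^sup>2"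
proof -
  have "0 \<le> (a - b)\<^sup>2 + a\<^sup>2 + b\<^sup>2" by simp
  then show ?thesis by (simp add: power2_diff)
qed

text \<open>By a b \<le> a^2 + b^2 the six factors split into the rotated and the base triple, each
  a product of functions of independent variables in its own frame. The bound is not homogeneous,
  but uniform on bounded sets, as \<open>functional_zero\<close> requires.\<close>

lemma rot_density_nn_bound:
  assumes F: "\<And>i. i < 6 \<Longrightarrow> square_integrable lborel (F i)"
  shows "(\<integral>\<^sup>+p. ennreal (norm (rot_density F p)) \<partial>rot_space) \<le>
     ennreal (2 * pi * (sqnorm (F 0) * (sqnorm (F 1) * sqnorm (F 2)) + sqnorm (F 5) * (sqnorm (F 3) * sqnorm (F 4))))"
proof -
  define G where "G i x = ennreal ((norm (F i x))\<^sup>2)" for i x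
  have [measurable]: "F 0 \<in> borel_measurable borel" "F 1 \<in> borel_measurable borel" "F (Suc 0) \<in> borel_measurable borel"
    "F 2 \<in> borel_measurable borel" "F 3 \<in> borel_measurable borel" "F 4 \<in> borel_measurable borel" "F 5 \<in> borel_measurable borel"
    using F by (simp_all add: square_integrable_def)
  have GF: "(\<integral>\<^sup>+x. G i x \<partial>lborel) = ennreal (sqnorm (F i))" if "i < 6" for i
    unfolding G_def by (rule nn_integral_square[OF F[OF that]])
  have [measurable]: "G 0 \<in> borel_measurable borel" "G 1 \<in> borel_measurable borel" "G (Suc 0) \<in> borel_measurable borel"
    "G 2 \<in> borel_measurable borel" "G 3 \<in> borel_measurable borel" "G 4 \<in> borel_measurable borel" "G 5 \<in> borel_measurable borel"
    unfolding G_def[abs_def] by measurable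
  have one: "(\<integral>\<^sup>+\<theta>. 1 \<partial>lborel_on (-pi) pi) \<le> ennreal (2 * pi)"
    by (simp add: emeasure_lborel_on)
  have "(\<integral>\<^sup>+p. ennreal (norm (rot_density F p)) \<partial>rot_space) \<le>
    (\<integral>\<^sup>+p. 1 * (G 0 (coord 0 p) * (G 1 (coord 1 p) * G 2 (coord 2 p))) + 1 * (G 5 (coord 5 p) * (G 3 (coord 3 p) * G 4 (coord 4 p))) \<partial>rot_space)"
  proof (rule nn_integral_mono)
    fix p
    let ?n = "\<lambda>i. norm (F i (coord i p))"
    have "norm (rot_density F p) = (?n 0 * ?n 1 * ?n 2) * (?n 3 * ?n 4 * ?n 5)"
      by (simp add: rot_density_def prod_lessThan_6 norm_mult)
    also have "\<dots> \<le> (?n 0 * ?n 1 * ?n 2)\<^sup>2 + (?n 3 * ?n 4 * ?n 5)\<^sup>2"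
      by (rule mult_le_sum_squares)
    finally have "norm (rot_density F p) \<le> (?n 0)\<^sup>2 * ((?n 1)\<^sup>2 * (?n 2)\<^sup>2) + (?n 5)\<^sup>2 * ((?n 3)\<^sup>2 * (?n 4)\<^sup>2)"
      by (simp add: power_mult_distrib mult_ac)
    then have "ennreal (norm (rot_density F p)) \<le> ennreal ((?n 0)\<^sup>2 * ((?n 1)\<^sup>2 * (?n 2)\<^sup>2) + (?n 5)\<^sup>2 * ((?n 3)\<^sup>2 * (?n 4)\<^sup>2))"
      by (rule ennreal_leI)
    then show "ennreal (norm (rot_density F p)) \<le>
        1 * (G 0 (coord 0 p) * (G 1 (coord 1 p) * G 2 (coord 2 p))) + 1 * (G 5 (coord 5 p) * (G 3 (coord 3 p) * G 4 (coord 4 p)))"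
      by (simp add: G_def ennreal_mult)
  qed
  also have "\<dots> = (\<integral>\<^sup>+p. 1 * (G 0 (coord 0 p) * (G 1 (coord 1 p) * G 2 (coord 2 p))) \<partial>rot_space)
     + (\<integral>\<^sup>+p. 1 * (G 5 (coord 5 p) * (G 3 (coord 3 p) * G 4 (coord 4 p))) \<partial>rot_space)"
    by (intro nn_integral_add) measurable
  also have "\<dots> \<le> ennreal (2 * pi) * (ennreal (sqnorm (F 0)) * (ennreal (sqnorm (F 1)) * ennreal (sqnorm (F 2))))
     + ennreal (2 * pi) * (ennreal (sqnorm (F 5)) * (ennreal (sqnorm (F 3)) * ennreal (sqnorm (F 4))))"
  proof (rule add_mono)
    show "(\<integral>\<^sup>+p. 1 * (G 0 (coord 0 p) * (G 1 (coord 1 p) * G 2 (coord 2 p))) \<partial>rot_space) \<le>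
       ennreal (2 * pi) * (ennreal (sqnorm (F 0)) * (ennreal (sqnorm (F 1)) * ennreal (sqnorm (F 2))))"
      using nn_integral_rot_slots[of "G 0" "G 1" "G 2" "\<lambda>_. 1" "ennreal (2 * pi)" 0] one by (simp add: GF)
    show "(\<integral>\<^sup>+p. 1 * (G 5 (coord 5 p) * (G 3 (coord 3 p) * G 4 (coord 4 p))) \<partial>rot_space) \<le>
       ennreal (2 * pi) * (ennreal (sqnorm (F 5)) * (ennreal (sqnorm (F 3)) * ennreal (sqnorm (F 4))))"
      using nn_integral_base_slots[of "G 5" "G 3" "G 4" "\<lambda>_. 1" "ennreal (2 * pi)"] one by (simp add: GF)
  qed
  also have "\<dots> = ennreal (2 * pi * (sqnorm (F 0) * (sqnorm (F 1) * sqnorm (F 2)) + sqnorm (F 5) * (sqnorm (F 3) * sqnorm (F 4))))"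
    by (simp add: ennreal_mult[symmetric] ennreal_plus[symmetric] distrib_left del: ennreal_plus)
  finally show ?thesis .
qed

lemma rot_form_bound:
  assumes F: "\<And>i. i < 6 \<Longrightarrow> square_integrable lborel (F i)"
  shows "integrable rot_space (rot_density F)"
    and "norm (rot_form F) \<le> 2 * pi * (sqnorm (F 0) * (sqnorm (F 1) * sqnorm (F 2)) + sqnorm (F 5) * (sqnorm (F 3) * sqnorm (F 4)))"
proof -
  have [measurable]: "rot_density F \<in> borel_measurable (borel \<Otimes>\<^sub>M (borel \<Otimes>\<^sub>M (borel \<Otimes>\<^sub>M borel)))"
    by (intro measurable_rot_density) (use F in \<open>simp add: square_integrable_def\<close>)
  show int: "integrable rot_space (rot_density F)"
    by (rule integrableI_bounded) (measurable, rule order_le_less_trans[OF rot_density_nn_bound[OF F]], auto)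
  have "ennreal (norm (rot_form F)) \<le> (\<integral>\<^sup>+p. ennreal (norm (rot_density F p)) \<partial>rot_space)"
    unfolding rot_form_def by (rule integral_norm_bound_ennreal[OF int])
  also have "\<dots> \<le> ennreal (2 * pi * (sqnorm (F 0) * (sqnorm (F 1) * sqnorm (F 2)) + sqnorm (F 5) * (sqnorm (F 3) * sqnorm (F 4))))"
    by (rule rot_density_nn_bound) (rule F)
  finally show "norm (rot_form F) \<le> 2 * pi * (sqnorm (F 0) * (sqnorm (F 1) * sqnorm (F 2)) + sqnorm (F 5) * (sqnorm (F 3) * sqnorm (F 4)))"
    by (subst (asm) ennreal_le_iff) (auto intro!: mult_nonneg_nonneg add_nonneg_nonneg)
qed

section \<open>Functions with bounded evolution\<close>

lemma cnj_coherent: "cnj (coherent w x) = coherent (cnj w) x"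
  by (simp add: coherent_def exp_cnj)

text \<open>From 2 |w| |x| \<le> x^2 / 2 + 2 |w|^2. The bound depends on |w| only, hence survives
  the rotation of the parameter under the flow.\<close>

lemma norm_coherent_le: "norm (coherent w x) \<le> exp (3 * (norm w)\<^sup>2)"
proof -
  have "Re (- (of_real x)\<^sup>2 / 2 + 2 * w * of_real x - w\<^sup>2) = - x\<^sup>2 / 2 + Re (2 * w * of_real x) - Re (w\<^sup>2)"
    by (simp flip: of_real_power)
  also have "\<dots> \<le> - x\<^sup>2 / 2 + 2 * norm w * \<bar>x\<bar> + (norm w)\<^sup>2"
  proof -
    have "Re (2 * w * of_real x) \<le> 2 * norm w * \<bar>x\<bar>"
      using complex_Re_le_cmod[of "2 * w * of_real x"] by (simp add: norm_mult)
    moreover have "- Re (w\<^sup>2) \<le> (norm w)\<^sup>2"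
      using complex_Re_le_cmod[of "- w\<^sup>2"] by (simp add: norm_power)
    ultimately show ?thesis by linarith
  qed
  also have "\<dots> \<le> 3 * (norm w)\<^sup>2"
    using zero_le_power2[of "\<bar>x\<bar> - 2 * norm w"] by (simp add: power2_diff power_mult_distrib mult_ac)
  finally show ?thesis by (simp add: coherent_def)
qed

text \<open>The class on which the space-time form converges by elementary means, even when one slot
  is replaced by an arbitrary square-integrable function. It contains the coherent states and the
  finite Hermite sums.\<close>

definition bounded_flow :: "(real \<Rightarrow> complex) \<Rightarrow> bool" where
  "bounded_flow f \<longleftrightarrow> square_integrable lborel f \<and> (\<exists>B. \<forall>t x. norm (flow f t x) \<le> B)"

lemma bounded_flow_coherent: "bounded_flow (coherent w)"
  unfolding bounded_flow_def
proof (intro conjI exI allI)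
  show "norm (flow (coherent w) t x) \<le> exp (3 * (norm w)\<^sup>2)" for t x
    using norm_coherent_le[of "w * cis (2 * t)" x] by (simp add: flow_coherent norm_mult)
qed (rule square_integrable_coherent)

text \<open>The coefficients vanish from N on, so the partial sums are eventually constant and the
  identity holds at every point.\<close>

lemma flow_hermite_sum: "flow (hermite_sum c {..<N} 0) t x = hermite_sum c {..<N} t x"
  unfolding flow_def
proof (rule flowc_eqI)
  let ?h = "hermite_sum c {..<N} 0"
  show "summable (\<lambda>n. (norm (coef ?h n))\<^sup>2)"
    by (rule summable_coef[OF square_integrable_hermite_sum])
  have "hermite_sum (coef ?h) {..<M} t x = hermite_sum c {..<N} t x" if "M \<ge> N" for M
  proof -
    have "hermite_sum (coef ?h) {..<M} t x =
      (\<Sum>n\<in>{..<M}. if n < N then cis (t * (2 * real n + 1)) * c n * complex_of_real (hermite_fun n x) else 0)"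
      unfolding hermite_sum_def[of "coef ?h"] coef_hermite_sum[OF finite_lessThan] by (intro sum.cong) auto
    also have "\<dots> = (\<Sum>n\<in>{..<M} \<inter> {n. n < N}. cis (t * (2 * real n + 1)) * c n * complex_of_real (hermite_fun n x))"
      by (simp add: sum.inter_restrict)
    also have "{..<M} \<inter> {n. n < N} = {..<N}" using that by auto
    finally show ?thesis by (simp only: hermite_sum_def[of c "{..<N}" t x])
  qed
  then show "(\<lambda>M. hermite_sum (coef ?h) {..<M} t x) \<longlonglongrightarrow> hermite_sum c {..<N} t x"
    by (intro tendsto_eventually eventually_sequentiallyI[of N]) auto
qed

lemma bounded_flow_hermite_sum: "bounded_flow (hermite_sum c {..<N} 0)"
proof -
  have "\<exists>B. \<forall>x. \<bar>hermite_fun n x\<bar> \<le> B" for n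
  proof -
    obtain C where C: "C \<ge> 0" "\<And>x. \<bar>hermite_fun n x\<bar> \<le> C * exp (- x\<^sup>2 / 4)"
      using hermite_fun_bound by blast
    have "C * exp (- x\<^sup>2 / 4) \<le> C" for x
      using C(1) by (simp add: mult_left_le)
    then show ?thesis using C(2) by (meson order.trans)
  qed
  then obtain B where B: "\<And>n x. \<bar>hermite_fun n x\<bar> \<le> B n" by metis
  have "norm (hermite_sum c {..<N} t x) \<le> (\<Sum>n<N. norm (c n) * B n)" for t x
    unfolding hermite_sum_def
    by (rule order.trans[OF norm_sum]) (auto intro!: sum_mono mult_left_mono B simp: norm_mult)
  then show ?thesis
    unfolding bounded_flow_def flow_hermite_sum using square_integrable_hermite_sum by blast
qed

section \<open>Multilinearity and extension of the identity slot by slot\<close>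

lemma time_density_split:
  assumes "k < 6"
  shows "time_density (F(k := f)) p =
    cnj_slot k (flow f (fst p) (snd p)) * (\<Prod>i\<in>{..<6} - {k}. cnj_slot i (flow (F i) (fst p) (snd p)))"
proof -
  have "time_density (F(k := f)) p = cnj_slot k (flow ((F(k := f)) k) (fst p) (snd p)) *
     (\<Prod>i\<in>{..<6} - {k}. cnj_slot i (flow ((F(k := f)) i) (fst p) (snd p)))"
    unfolding time_density_def using assms by (intro prod.remove) auto
  also have "(\<Prod>i\<in>{..<6} - {k}. cnj_slot i (flow ((F(k := f)) i) (fst p) (snd p))) =
     (\<Prod>i\<in>{..<6} - {k}. cnj_slot i (flow (F i) (fst p) (snd p)))"
    by (intro prod.cong) auto
  finally show ?thesis by (simp only: fun_upd_same)
qed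

lemma rot_density_split:
  assumes "k < 6"
  shows "rot_density (F(k := f)) p =
    cnj_slot k (f (coord k p)) * (\<Prod>i\<in>{..<6} - {k}. cnj_slot i (F i (coord i p)))"
proof -
  have "rot_density (F(k := f)) p = cnj_slot k ((F(k := f)) k (coord k p)) *
     (\<Prod>i\<in>{..<6} - {k}. cnj_slot i ((F(k := f)) i (coord i p)))"
    unfolding rot_density_def using assms by (intro prod.remove) auto
  also have "(\<Prod>i\<in>{..<6} - {k}. cnj_slot i ((F(k := f)) i (coord i p))) =
     (\<Prod>i\<in>{..<6} - {k}. cnj_slot i (F i (coord i p)))"
    by (intro prod.cong) auto
  finally show ?thesis by (simp only: fun_upd_same)
qed

lemma AE_time_space:
  assumes "Measurable.pred (borel \<Otimes>\<^sub>M borel) P" "\<And>t. AE x in lborel. P (t, x)"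
  shows "AE p in time_space. P p"
proof -
  interpret C: sigma_finite_measure "lborel_on (-pi/4) (pi/4)"
    by (rule sigma_finite_lborel_on)
  interpret P: pair_sigma_finite "lborel_on (-pi/4) (pi/4)" "lborel :: real measure" ..
  have "{p \<in> space (lborel_on (-pi/4) (pi/4) \<Otimes>\<^sub>M lborel). P p} \<in> sets (lborel_on (-pi/4) (pi/4) \<Otimes>\<^sub>M lborel)"
    using assms(1) by (simp add: pred_def space_pair_measure cong: sets_pair_measure_cong)
  then show ?thesis
    unfolding time_space_def
    by (rule P.AE_pair_measure) (rule AE_I2, rule assms(2))
qed

lemma time_form_linear:
  assumes k: "k < 6" and f: "square_integrable lborel f" and g: "square_integrable lborel g"
    and intf: "integrable time_space (time_density (F(k := f)))" and intg: "integrable time_space (time_density (F(k := g)))"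
  shows "time_form (F(k := (\<lambda>x. a * f x + b * g x))) = cnj_slot k a * time_form (F(k := f)) + cnj_slot k b * time_form (F(k := g))"
proof -
  have "AE p in time_space. flow (\<lambda>x. a * f x + b * g x) (fst p) (snd p) = a * flow f (fst p) (snd p) + b * flow g (fst p) (snd p)"
    using flow_linear[OF f g] by (intro AE_time_space) auto
  then have "AE p in time_space. time_density (F(k := (\<lambda>x. a * f x + b * g x))) p =
     cnj_slot k a * time_density (F(k := f)) p + cnj_slot k b * time_density (F(k := g)) p"
    by eventually_elim (simp only: time_density_split[OF k] cnj_slot_add cnj_slot_mult distrib_right mult.assoc)
  then have "time_form (F(k := (\<lambda>x. a * f x + b * g x))) =
     (\<integral>p. cnj_slot k a * time_density (F(k := f)) p + cnj_slot k b * time_density (F(k := g)) p \<partial>time_space)"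
    unfolding time_form_def by (intro integral_cong_AE) measurable
  then show ?thesis using intf intg by (simp add: time_form_def)
qed

lemma rot_form_linear:
  assumes k: "k < 6" and intf: "integrable rot_space (rot_density (F(k := f)))" and intg: "integrable rot_space (rot_density (F(k := g)))"
  shows "rot_form (F(k := (\<lambda>x. a * f x + b * g x))) = cnj_slot k a * rot_form (F(k := f)) + cnj_slot k b * rot_form (F(k := g))"
proof -
  have "rot_density (F(k := (\<lambda>x. a * f x + b * g x))) =
     (\<lambda>p. cnj_slot k a * rot_density (F(k := f)) p + cnj_slot k b * rot_density (F(k := g)) p)"
    by (auto simp only: rot_density_split[OF k] cnj_slot_add cnj_slot_mult distrib_right mult.assoc)
  then show ?thesis using intf intg by (simp add: rot_form_def)
qed

text \<open>The constant is the quotient of the prefactors \<open>sqrt (pi / 3) / 4\<close> and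
  \<open>pi * sqrt pi\<close> of the two forms on coherent states.\<close>

definition form_diff :: "(nat \<Rightarrow> real \<Rightarrow> complex) \<Rightarrow> complex" where
  "form_diff F = time_form F - of_real (1 / (4 * pi * sqrt 3)) * rot_form F"

lemma form_diff_cong: "(\<And>i. i < 6 \<Longrightarrow> F i = G i) \<Longrightarrow> form_diff F = form_diff G"
proof -
  assume *: "\<And>i. i < 6 \<Longrightarrow> F i = G i"
  have "time_density F = time_density G" "rot_density F = rot_density G"
    unfolding time_density_def[abs_def] rot_density_def[abs_def] using * by (auto intro!: prod.cong ext)
  then show ?thesis by (simp add: form_diff_def time_form_def rot_form_def)
qed

text \<open>Induction on the number of slots filled by members of \<open>N\<close>, the others being
  coherent states with real parameter. In slot k alone the difference is, up to conjugation, a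
  bounded linear functional on all of L^2 that vanishes on these coherent states. \<open>N\<close>
  is a parameter because the argument runs twice, with bounded evolutions and then with L^2
  itself.\<close>

lemma form_diff_extend:
  assumes sq: "\<And>f. f \<in> N \<Longrightarrow> square_integrable lborel f" and coh: "\<And>s::real. coherent (of_real s) \<in> N"
    and bound: "\<And>F k R. k < 6 \<Longrightarrow> (\<And>i. i < 6 \<Longrightarrow> F i \<in> N) \<Longrightarrow>
       \<exists>C\<ge>0. \<forall>f. square_integrable lborel f \<longrightarrow> sqnorm f \<le> R \<longrightarrow>
         (\<integral>\<^sup>+p. ennreal (norm (time_density (F(k := f)) p)) \<partial>time_space) \<le> ennreal C"
    and base: "\<And>s :: nat \<Rightarrow> real. form_diff (\<lambda>i. coherent (of_real (s i))) = 0"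
    and F: "\<And>i. i < 6 \<Longrightarrow> F i \<in> N"
  shows "form_diff F = 0"
proof -
  have "form_diff F = 0" if "k \<le> 6" "\<And>i. i < k \<Longrightarrow> F i \<in> N" "\<And>i. k \<le> i \<Longrightarrow> i < 6 \<Longrightarrow> \<exists>s::real. F i = coherent (of_real s)" for k F
    using that
  proof (induction k arbitrary: F)
    case 0
    then have "\<forall>i. \<exists>s::real. i < 6 \<longrightarrow> F i = coherent (of_real s)" by blast
    then obtain s :: "nat \<Rightarrow> real" where "\<And>i. i < 6 \<Longrightarrow> F i = coherent (of_real (s i))" by metis
    then show ?case using base[of s] form_diff_cong[of F "\<lambda>i. coherent (of_real (s i))"] by simp
  next
    case (Suc k)
    have k: "k < 6" using Suc.prems(1) by simp
    have FN: "F i \<in> N" if "i < 6" for i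
      using Suc.prems(2)[of i] Suc.prems(3)[of i] that coh by (cases "i < Suc k") (auto simp: not_less)
    have sqF: "square_integrable lborel ((F(k := f)) i)" if "i < 6" "square_integrable lborel f" for i f
      using that FN sq by auto
    have bd: "\<exists>C\<ge>0. \<forall>f. square_integrable lborel f \<longrightarrow> sqnorm f \<le> R \<longrightarrow>
         (\<integral>\<^sup>+p. ennreal (norm (time_density (F(k := f)) p)) \<partial>time_space) \<le> ennreal C" for R
      by (rule bound[OF k]) (rule FN)
    have int: "integrable time_space (time_density (F(k := f)))" if f: "square_integrable lborel f" for f
    proof -
      obtain C where "(\<integral>\<^sup>+p. ennreal (norm (time_density (F(k := f)) p)) \<partial>time_space) \<le> ennreal C"
        using bd[of "sqnorm f"] f by blast
      then show ?thesis
        by (intro integrableI_bounded) (auto intro: order_le_less_trans)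
    qed
    have intr: "integrable rot_space (rot_density (F(k := f)))" if "square_integrable lborel f" for f
      by (rule rot_form_bound(1)) (rule sqF[OF _ that])
    have lin: "form_diff (F(k := (\<lambda>x. a * f x + b * g x))) = cnj_slot k a * form_diff (F(k := f)) + cnj_slot k b * form_diff (F(k := g))"
      if "square_integrable lborel f" "square_integrable lborel g" for a b f g
      unfolding form_diff_def
      using time_form_linear[OF k that int[OF that(1)] int[OF that(2)], of a b] rot_form_linear[OF k intr[OF that(1)] intr[OF that(2)], of a b]
      by (simp add: algebra_simps)
    \<comment> \<open>In the last three slots the difference is antilinear; conjugation makes it
      linear.\<close>
    define \<Lambda> where "\<Lambda> f = (if k < 3 then form_diff (F(k := f)) else cnj (form_diff (F(k := f))))" for f
    have lin\<Lambda>: "\<Lambda> (\<lambda>x. a * f x + b * g x) = a * \<Lambda> f + b * \<Lambda> g"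
      if "square_integrable lborel f" "square_integrable lborel g" for a b f g
      unfolding \<Lambda>_def lin[OF that] by (simp add: cnj_slot_def)
    obtain C where C: "C \<ge> 0" "\<And>f. square_integrable lborel f \<Longrightarrow> sqnorm f \<le> 1 \<Longrightarrow>
         (\<integral>\<^sup>+p. ennreal (norm (time_density (F(k := f)) p)) \<partial>time_space) \<le> ennreal C"
      using bd[of 1] by blast
    \<comment> \<open>At least 1, so that \<open>m k\<close> also bounds the squared norm of the
      function from the unit ball placed in slot k.\<close>
    define m where "m i = max 1 (sqnorm (F i))" for i
    define C' where "C' = C + 1 / (4 * pi * sqrt 3) * (2 * pi * (m 0 * (m 1 * m 2) + m 5 * (m 3 * m 4)))"
    have "\<Lambda> (F k) = 0"
    proof (rule functional_zero[where C=C' and \<Lambda>=\<Lambda> and f="F k"])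
      fix f g :: "real \<Rightarrow> complex" assume "square_integrable lborel f" "square_integrable lborel g"
      then show "\<Lambda> (\<lambda>x. f x + g x) = \<Lambda> f + \<Lambda> g" using lin\<Lambda>[of f g 1 1] by simp
    next
      fix a and f :: "real \<Rightarrow> complex" assume "square_integrable lborel f"
      then show "\<Lambda> (\<lambda>x. a * f x) = a * \<Lambda> f" using lin\<Lambda>[of f f a 0] by simp
    next
      fix s :: real
      have "form_diff (F(k := coherent (of_real s))) = 0"
      proof (rule Suc.IH)
        show "(F(k := coherent (of_real s))) i \<in> N" if "i < k" for i
          using Suc.prems(2)[of i] that by simp
        show "\<exists>r::real. (F(k := coherent (of_real s))) i = coherent (of_real r)" if "k \<le> i" "i < 6" for i
          using Suc.prems(3)[of i] that by (cases "i = k") auto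
      qed (use k in simp)
      then show "\<Lambda> (coherent (of_real s)) = 0" by (simp add: \<Lambda>_def)
    next
      fix f :: "real \<Rightarrow> complex" assume f: "square_integrable lborel f" "sqnorm f \<le> 1"
      have "ennreal (norm (time_form (F(k := f)))) \<le> (\<integral>\<^sup>+p. ennreal (norm (time_density (F(k := f)) p)) \<partial>time_space)"
        unfolding time_form_def by (rule integral_norm_bound_ennreal[OF int[OF f(1)]])
      also have "\<dots> \<le> ennreal C" by (rule C(2)[OF f])
      finally have t: "norm (time_form (F(k := f))) \<le> C" using C(1) by simp
      have m: "0 \<le> sqnorm ((F(k := f)) i)" "sqnorm ((F(k := f)) i) \<le> m i" for i
        using f(2) by (auto simp: m_def)
      have m0: "0 \<le> m i" for i by (simp add: m_def)
      have "norm (rot_form (F(k := f))) \<le> 2 * pi * (sqnorm ((F(k := f)) 0) * (sqnorm ((F(k := f)) 1) * sqnorm ((F(k := f)) 2))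
          + sqnorm ((F(k := f)) 5) * (sqnorm ((F(k := f)) 3) * sqnorm ((F(k := f)) 4)))"
        by (rule rot_form_bound(2)) (rule sqF[OF _ f(1)])
      also have "\<dots> \<le> 2 * pi * (m 0 * (m 1 * m 2) + m 5 * (m 3 * m 4))"
        by (intro mult_left_mono add_mono mult_mono m m0 mult_nonneg_nonneg) auto
      finally have r: "norm (rot_form (F(k := f))) \<le> 2 * pi * (m 0 * (m 1 * m 2) + m 5 * (m 3 * m 4))" .
      have "norm (\<Lambda> f) = norm (form_diff (F(k := f)))" by (simp add: \<Lambda>_def)
      also have "\<dots> \<le> norm (time_form (F(k := f))) + norm (of_real (1 / (4 * pi * sqrt 3)) * rot_form (F(k := f)))"
        unfolding form_diff_def by (rule norm_triangle_ineq4)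
      also have "norm (of_real (1 / (4 * pi * sqrt 3)) * rot_form (F(k := f))) = 1 / (4 * pi * sqrt 3) * norm (rot_form (F(k := f)))"
        by (simp add: norm_mult norm_divide)
      also have "norm (time_form (F(k := f))) + 1 / (4 * pi * sqrt 3) * norm (rot_form (F(k := f))) \<le> C'"
        unfolding C'_def by (intro add_mono t mult_left_mono r) simp
      finally show "norm (\<Lambda> f) \<le> C'" .
    qed (rule sq[OF FN[OF k]])
    then show ?case by (simp add: \<Lambda>_def split: if_splits)
  qed
  from this[of 6 F] show ?thesis using F by simp
qed

lemma nn_time_square:
  assumes f: "square_integrable lborel f"
  shows "(\<integral>\<^sup>+p. ennreal ((norm (flow f (fst p) (snd p)))\<^sup>2) \<partial>time_space) \<le> ennreal (pi / 2 * sqnorm f)"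
proof -
  have "(\<integral>\<^sup>+p. ennreal ((norm (flow f (fst p) (snd p)))\<^sup>2) \<partial>time_space) =
     (\<integral>\<^sup>+t. (\<integral>\<^sup>+x. ennreal ((norm (flow f t x))\<^sup>2) \<partial>lborel) \<partial>lborel_on (-pi/4) (pi/4))"
    by (subst nn_integral_time_space) simp_all
  also have "\<dots> \<le> (\<integral>\<^sup>+t. ennreal (sqnorm f) \<partial>lborel_on (-pi/4) (pi/4))"
    unfolding nn_integral_square[OF square_integrable_flow(1)[OF f]]
    by (intro nn_integral_mono ennreal_leI square_integrable_flow(2) f)
  also have "\<dots> = ennreal (pi / 2 * sqnorm f)"
    by (simp add: emeasure_lborel_on ennreal_mult[symmetric] mult.commute)
  finally show ?thesis .
qed

text \<open>Four of the other five evolutions are estimated by their suprema; the remaining one,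
  \<open>j\<close>, is paired with the arbitrary \<open>f\<close> by the L^2 bound in
  space-time.\<close>

lemma bounded_flow_slot_bound:
  assumes k: "k < 6" and F: "\<And>i. i < 6 \<Longrightarrow> bounded_flow (F i)"
  shows "\<exists>C\<ge>0. \<forall>f. square_integrable lborel f \<longrightarrow> sqnorm f \<le> R \<longrightarrow>
         (\<integral>\<^sup>+p. ennreal (norm (time_density (F(k := f)) p)) \<partial>time_space) \<le> ennreal C"
proof -
  define j :: nat where "j = (if k = 0 then 1 else 0)"
  have j: "j \<in> {..<6} - {k}" using k by (auto simp: j_def)
  have "\<forall>i. \<exists>B. i < 6 \<longrightarrow> (\<forall>t x. norm (flow (F i) t x) \<le> B)"
    using F by (auto simp: bounded_flow_def)
  then obtain B where B: "\<And>i t x. i < 6 \<Longrightarrow> norm (flow (F i) t x) \<le> B i" by metis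
  have B0: "0 \<le> B i" if "i < 6" for i
    using B[OF that, of 0 0] norm_ge_zero order.trans by blast
  define K where "K = (\<Prod>i\<in>{..<6} - {k} - {j}. B i)"
  have K0: "K \<ge> 0" unfolding K_def by (intro prod_nonneg) (auto intro: B0)
  have Fj: "square_integrable lborel (F j)" using F[of j] j by (auto simp: bounded_flow_def)
  define R' where "R' = max 0 R"
  have "(\<integral>\<^sup>+p. ennreal (norm (time_density (F(k := f)) p)) \<partial>time_space) \<le> ennreal (K * (pi / 2 * R' + pi / 2 * sqnorm (F j)))"
    if f: "square_integrable lborel f" "sqnorm f \<le> R" for f
  proof -
    have pt: "norm (time_density (F(k := f)) p) \<le> K * ((norm (flow f (fst p) (snd p)))\<^sup>2 + (norm (flow (F j) (fst p) (snd p)))\<^sup>2)" for p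
    proof -
      have "norm (\<Prod>i\<in>{..<6} - {k}. cnj_slot i (flow (F i) (fst p) (snd p))) =
         norm (flow (F j) (fst p) (snd p)) * (\<Prod>i\<in>{..<6} - {k} - {j}. norm (flow (F i) (fst p) (snd p)))"
        using j by (simp add: prod_norm[symmetric] prod.remove[of _ j] norm_mult)
      also have "\<dots> \<le> norm (flow (F j) (fst p) (snd p)) * K"
        unfolding K_def by (intro mult_left_mono prod_mono) (auto intro: B)
      finally have "norm (time_density (F(k := f)) p) \<le> norm (flow f (fst p) (snd p)) * (norm (flow (F j) (fst p) (snd p)) * K)"
        unfolding time_density_split[OF k] norm_mult norm_cnj_slot by (intro mult_left_mono) auto
      also have "\<dots> = K * (norm (flow f (fst p) (snd p)) * norm (flow (F j) (fst p) (snd p)))"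
        by (simp only: mult_ac)
      also have "\<dots> \<le> K * ((norm (flow f (fst p) (snd p)))\<^sup>2 + (norm (flow (F j) (fst p) (snd p)))\<^sup>2)"
        by (intro mult_left_mono mult_le_sum_squares K0)
      finally show ?thesis .
    qed
    have "(\<integral>\<^sup>+p. ennreal (norm (time_density (F(k := f)) p)) \<partial>time_space) \<le>
       (\<integral>\<^sup>+p. ennreal K * (ennreal ((norm (flow f (fst p) (snd p)))\<^sup>2) + ennreal ((norm (flow (F j) (fst p) (snd p)))\<^sup>2)) \<partial>time_space)"
      using ennreal_leI[OF pt] K0 by (intro nn_integral_mono) (simp add: ennreal_mult)
    also have "\<dots> = ennreal K * ((\<integral>\<^sup>+p. ennreal ((norm (flow f (fst p) (snd p)))\<^sup>2) \<partial>time_space)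
        + (\<integral>\<^sup>+p. ennreal ((norm (flow (F j) (fst p) (snd p)))\<^sup>2) \<partial>time_space))"
      by (simp add: nn_integral_cmult nn_integral_add)
    also have "\<dots> \<le> ennreal K * (ennreal (pi / 2 * sqnorm f) + ennreal (pi / 2 * sqnorm (F j)))"
      by (intro mult_left_mono add_mono nn_time_square f Fj) simp
    also have "\<dots> = ennreal (K * (pi / 2 * sqnorm f + pi / 2 * sqnorm (F j)))"
      using K0 by (simp add: ennreal_mult ennreal_plus[symmetric] del: ennreal_plus)
    also have "\<dots> \<le> ennreal (K * (pi / 2 * R' + pi / 2 * sqnorm (F j)))"
      using f(2) K0 by (intro ennreal_leI mult_left_mono add_right_mono) (auto simp: R'_def)
    finally show ?thesis .
  qed
  moreover have "0 \<le> K * (pi / 2 * R' + pi / 2 * sqnorm (F j))"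
    using K0 by (auto simp: R'_def intro!: mult_nonneg_nonneg add_nonneg_nonneg)
  ultimately show ?thesis by blast
qed

text \<open>Conjugation reverses the rotation of the parameter, and the phases \<open>cis t\<close>
  and \<open>cis (-t)\<close> cancel in pairs. Six Gaussians of weight 1/2 add up to the coefficient
  3 of x^2.\<close>

lemma time_density_coherent:
  fixes s :: "nat \<Rightarrow> real"
  defines "a \<equiv> complex_of_real (s 0 + s 1 + s 2)" and "b \<equiv> complex_of_real (s 3 + s 4 + s 5)"
    and "A \<equiv> complex_of_real ((s 0)\<^sup>2 + (s 1)\<^sup>2 + (s 2)\<^sup>2)" and "B \<equiv> complex_of_real ((s 3)\<^sup>2 + (s 4)\<^sup>2 + (s 5)\<^sup>2)"
  shows "time_density (\<lambda>i. coherent (of_real (s i))) (t, x) =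
    exp (- (A * cis (4 * t) + B * cis (- (4 * t)))) *
    exp (- of_real 3 * (of_real x)\<^sup>2 + 2 * (a * cis (2 * t) + b * cis (- (2 * t))) * of_real x)"
proof -
  let ?w = "cis (2 * t)" and ?v = "cis (- (2 * t))"
  define E where "E w = - (complex_of_real x)\<^sup>2 / 2 + 2 * w * of_real x - w\<^sup>2" for w
  have coh: "coherent w x = exp (E w)" for w by (simp add: coherent_def E_def)
  have arr: "(c * e0) * (c * e1) * (c * e2) * (d * e3) * (d * e4) * (d * e5) = (c * d) * (c * d) * (c * d) * (e0 * e1 * e2 * e3 * e4 * e5)"
    for c d e0 e1 e2 e3 e4 e5 :: complex by (simp only: mult_ac)
  have "time_density (\<lambda>i. coherent (of_real (s i))) (t, x) =
    (cis t * exp (E (s 0 * ?w))) * (cis t * exp (E (s 1 * ?w))) * (cis t * exp (E (s 2 * ?w))) *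
    (cis (-t) * exp (E (s 3 * ?v))) * (cis (-t) * exp (E (s 4 * ?v))) * (cis (-t) * exp (E (s 5 * ?v)))"
    by (simp add: time_density_def prod_lessThan_6 cnj_slot_def flow_coherent cnj_coherent coh[symmetric] cis_cnj)
  also have "\<dots> = (cis t * cis (-t)) * (cis t * cis (-t)) * (cis t * cis (-t)) * (exp (E (s 0 * ?w)) * exp (E (s 1 * ?w)) *
     exp (E (s 2 * ?w)) * exp (E (s 3 * ?v)) * exp (E (s 4 * ?v)) * exp (E (s 5 * ?v)))"
    by (rule arr)
  also have "cis t * cis (-t) = 1" by (simp add: cis_mult)
  also have "1 * 1 * 1 * (exp (E (s 0 * ?w)) * exp (E (s 1 * ?w)) *
     exp (E (s 2 * ?w)) * exp (E (s 3 * ?v)) * exp (E (s 4 * ?v)) * exp (E (s 5 * ?v))) =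
     exp (E (s 0 * ?w) + E (s 1 * ?w) + E (s 2 * ?w) + E (s 3 * ?v) + E (s 4 * ?v) + E (s 5 * ?v))"
    by (simp only: exp_add mult_1)
  also have "E (s 0 * ?w) + E (s 1 * ?w) + E (s 2 * ?w) + E (s 3 * ?v) + E (s 4 * ?v) + E (s 5 * ?v) =
     - (A * ?w\<^sup>2 + B * ?v\<^sup>2) + (- of_real 3 * (of_real x)\<^sup>2 + 2 * (a * ?w + b * ?v) * of_real x)"
    unfolding E_def a_def b_def A_def B_def by (simp add: algebra_simps power_mult_distrib)
  also have "?w\<^sup>2 = cis (4 * t)" by (simp add: Complex.DeMoivre)
  also have "?v\<^sup>2 = cis (- (4 * t))" by (simp add: Complex.DeMoivre)
  finally show ?thesis by (simp only: exp_add)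
qed

lemma integrable_time_density:
  assumes F: "\<And>i. i < 6 \<Longrightarrow> bounded_flow (F i)"
  shows "integrable time_space (time_density F)"
proof -
  have "square_integrable lborel (F 0)" using F[of 0] by (simp add: bounded_flow_def)
  then obtain C where "(\<integral>\<^sup>+p. ennreal (norm (time_density (F(0 := F 0)) p)) \<partial>time_space) \<le> ennreal C"
    using bounded_flow_slot_bound[of 0 F "sqnorm (F 0)", OF _ F] by auto
  then show ?thesis by (intro integrableI_bounded) (auto intro: order_le_less_trans)
qed

text \<open>The square of a cis(2t) + b cis(-2t) has a constant cross term, which gives the factor
  exp(2ab/3), and terms of frequency 4 and -4, which one full period turns into the circle
  integral.\<close>

lemma time_form_coherent:
  fixes s :: "nat \<Rightarrow> real"
  defines "a \<equiv> s 0 + s 1 + s 2" and "b \<equiv> s 3 + s 4 + s 5"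
    and "A \<equiv> (s 0)\<^sup>2 + (s 1)\<^sup>2 + (s 2)\<^sup>2" and "B \<equiv> (s 3)\<^sup>2 + (s 4)\<^sup>2 + (s 5)\<^sup>2"
  shows "time_form (\<lambda>i. coherent (of_real (s i))) = of_real (sqrt (pi / 3) / 4 * exp (2 * a * b / 3)) *
    (\<integral>\<theta>. exp (complex_of_real (a\<^sup>2 / 3 - A) * cis \<theta> + complex_of_real (b\<^sup>2 / 3 - B) * cis (- \<theta>)) \<partial>lborel_on (-pi) pi)"
proof -
  let ?F = "\<lambda>i. coherent (of_real (s i))"
  interpret C: sigma_finite_measure "lborel_on (-pi/4) (pi/4)"
    by (rule sigma_finite_lborel_on)
  interpret P: pair_sigma_finite "lborel_on (-pi/4) (pi/4)" "lborel :: real measure" ..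
  have inner: "(\<integral>x. time_density ?F (t, x) \<partial>lborel) = of_real (sqrt (pi / 3) * exp (2 * a * b / 3)) *
      exp (complex_of_real (a\<^sup>2 / 3 - A) * cis (4 * t) + complex_of_real (b\<^sup>2 / 3 - B) * cis (- (4 * t)))" for t
  proof -
    let ?w = "cis (2 * t)" and ?v = "cis (- (2 * t))"
    let ?\<beta> = "complex_of_real a * ?w + complex_of_real b * ?v"
    let ?\<gamma> = "- (complex_of_real A * cis (4 * t) + complex_of_real B * cis (- (4 * t)))"
    have "(\<integral>x. time_density ?F (t, x) \<partial>lborel) = exp ?\<gamma> * (\<integral>x. exp (- of_real 3 * (of_real x)\<^sup>2 + 2 * ?\<beta> * of_real x) \<partial>lborel)"
      unfolding time_density_coherent a_def b_def A_def B_def by (rule integral_mult_right_zero)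
    also have "\<dots> = of_real (sqrt (pi / 3)) * exp (?\<gamma> + ?\<beta>\<^sup>2 / of_real 3)"
      by (subst gauss_integral_complex) (simp_all add: exp_add)
    also have "?\<gamma> + ?\<beta>\<^sup>2 / of_real 3 = of_real (2 * a * b / 3) +
        (complex_of_real (a\<^sup>2 / 3 - A) * cis (4 * t) + complex_of_real (b\<^sup>2 / 3 - B) * cis (- (4 * t)))"
    proof -
      have "?w * ?v = 1" by (simp add: cis_mult)
      moreover have "?w * ?w = cis (4 * t)" "?v * ?v = cis (- (4 * t))" by (simp_all add: cis_mult)
      moreover have "?\<beta>\<^sup>2 = of_real a * of_real a * (?w * ?w) + of_real b * of_real b * (?v * ?v) + 2 * of_real a * of_real b * (?w * ?v)"
        by (simp add: power2_eq_square algebra_simps)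
      ultimately have "?\<beta>\<^sup>2 = of_real a * of_real a * cis (4 * t) + of_real b * of_real b * cis (- (4 * t)) + 2 * of_real a * of_real b"
        by simp
      then show ?thesis by (simp add: power2_eq_square algebra_simps add_divide_distrib diff_divide_distrib)
    qed
    also have "exp \<dots> = of_real (exp (2 * a * b / 3)) *
        exp (complex_of_real (a\<^sup>2 / 3 - A) * cis (4 * t) + complex_of_real (b\<^sup>2 / 3 - B) * cis (- (4 * t)))"
      by (simp only: exp_add exp_of_real)
    finally show ?thesis by (simp only: of_real_mult mult.assoc)
  qed
  have int: "integrable time_space (time_density ?F)"
    by (rule integrable_time_density) (rule bounded_flow_coherent)
  have "time_form ?F = (\<integral>t. (\<integral>x. time_density ?F (t, x) \<partial>lborel) \<partial>lborel_on (-pi/4) (pi/4))"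
    using P.integral_fst'[of "time_density ?F"] int unfolding time_form_def time_space_def by simp
  also have "\<dots> = of_real (sqrt (pi / 3) * exp (2 * a * b / 3)) * ((\<integral>\<theta>. exp (complex_of_real (a\<^sup>2 / 3 - A) * cis \<theta> + complex_of_real (b\<^sup>2 / 3 - B) * cis (- \<theta>)) \<partial>lborel_on (-pi) pi) / 4)"
    unfolding inner integral_mult_right_zero integral_circle_rescale ..
  finally show ?thesis by simp
qed

text \<open>The entries are free variables, so that the transpose, with b and c exchanged, is
  covered as well as the rotation itself.\<close>

lemma rot_transpose:
  assumes "a * a + b * b + c * c = (1::real)" "a * b + b * c + c * a = 0"
  shows "(a * x + b * y + c * z)\<^sup>2 + (c * x + a * y + b * z)\<^sup>2 + (b * x + c * y + a * z)\<^sup>2 = x\<^sup>2 + y\<^sup>2 + z\<^sup>2"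
proof -
  have "(a * x + b * y + c * z)\<^sup>2 + (c * x + a * y + b * z)\<^sup>2 + (b * x + c * y + a * z)\<^sup>2 =
    (a * a + b * b + c * c) * (x\<^sup>2 + y\<^sup>2 + z\<^sup>2) + 2 * (a * b + b * c + c * a) * (x * y + y * z + z * x)"
    by (simp add: power2_eq_square algebra_simps)
  then show ?thesis by (simp add: assms)
qed

text \<open>The Gaussian is rotation invariant, so at a fixed angle the exponent is -|y|^2 + 2 v . y
  up to a constant, with v the sum of (s5, s3, s4) and the transposed rotation of (s0, s1, s2). The
  integral is a multiple of exp(W), where W is twice the inner product of (s0, s1, s2) with the
  rotated (s5, s3, s4). Here m0, m1, m2 are the coefficients of the three matrix entries in that
  inner product, and P, Q those of cosine and sine in W.\<close>

lemma rot_form_coherent: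
  fixes s :: "nat \<Rightarrow> real"
  defines "m0 \<equiv> s 0 * s 5 + s 1 * s 3 + s 2 * s 4" and "m1 \<equiv> s 0 * s 3 + s 1 * s 4 + s 2 * s 5"
    and "m2 \<equiv> s 0 * s 4 + s 1 * s 5 + s 2 * s 3"
  defines "P \<equiv> 2 / 3 * (2 * m0 - m1 - m2)" and "Q \<equiv> 2 / 3 * sqrt 3 * (m1 - m2)"
  shows "rot_form (\<lambda>i. coherent (of_real (s i))) =
    of_real (pi * sqrt pi * exp (2 * (s 0 + s 1 + s 2) * (s 3 + s 4 + s 5) / 3)) *
    (\<integral>\<theta>. exp (Complex (P / 2) (- Q / 2) * cis \<theta> + Complex (P / 2) (Q / 2) * cis (- \<theta>)) \<partial>lborel_on (-pi) pi)"
proof -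
  let ?F = "\<lambda>i. coherent (of_real (s i))"
  define g where "g i x = exp (- x\<^sup>2 / 2 + 2 * s i * x - (s i)\<^sup>2)" for i x
  define R where "R p = (\<Prod>i<6. g i (coord i p))" for p
  define S where "S = (s 0)\<^sup>2 + (s 1)\<^sup>2 + (s 2)\<^sup>2 + (s 3)\<^sup>2 + (s 4)\<^sup>2 + (s 5)\<^sup>2"
  define W where "W \<theta> = 2 * (rot_a \<theta> * m0 + rot_b \<theta> * m1 + rot_c \<theta> * m2)" for \<theta>
  have cg: "coherent (of_real (s i)) x = of_real (g i x)" for i x
    by (simp add: coherent_def g_def exp_of_real[symmetric])
  have R: "rot_density ?F p = of_real (R p)" for p
  proof -
    have "cnj_slot i (of_real r) = of_real r" for i r by (simp add: cnj_slot_def)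
    then show ?thesis by (simp add: rot_density_def R_def cg)
  qed
  have [measurable]: "g i \<in> borel_measurable borel" for i
    unfolding g_def[abs_def] by measurable
  have mR [measurable]: "R \<in> borel_measurable (borel \<Otimes>\<^sub>M (borel \<Otimes>\<^sub>M (borel \<Otimes>\<^sub>M borel)))"
    unfolding R_def[abs_def] by measurable
  have [measurable]: "W \<in> borel_measurable borel" unfolding W_def[abs_def] by measurable
  have g1: "(\<integral>\<^sup>+x. ennreal (exp (- x\<^sup>2 + 2 * v * x)) \<partial>lborel) = ennreal (sqrt pi * exp (v\<^sup>2))" for v :: real
    using gauss_integral_real[of 1 v] by (subst nn_integral_eq_integral) (auto simp: has_bochner_integral_iff)
  have inner: "(\<integral>\<^sup>+b. ennreal (R (fst b, \<theta>, snd b)) \<partial>lborel) = ennreal (pi * sqrt pi * exp (W \<theta>))" for \<theta>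
  proof -
    let ?a = "rot_a \<theta>" and ?b = "rot_b \<theta>" and ?c = "rot_c \<theta>"
    define v0 where "v0 = s 5 + (?a * s 0 + ?c * s 1 + ?b * s 2)"
    define v1 where "v1 = s 3 + (?b * s 0 + ?a * s 1 + ?c * s 2)"
    define v2 where "v2 = s 4 + (?c * s 0 + ?b * s 1 + ?a * s 2)"
    have sq: "?a * ?a + ?b * ?b + ?c * ?c = 1" "?a * ?b + ?b * ?c + ?c * ?a = 0"
      by (rule rot_square_sum rot_product_sum)+
    have Rb: "R (z, \<theta>, y1, y2) = exp (- S) * (exp (- z\<^sup>2 + 2 * v0 * z) * (exp (- y1\<^sup>2 + 2 * v1 * y1) * exp (- y2\<^sup>2 + 2 * v2 * y2)))" for z y1 y2
    proof -
      define x0 where "x0 = ?a * z + ?b * y1 + ?c * y2"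
      define x1 where "x1 = ?c * z + ?a * y1 + ?b * y2"
      define x2 where "x2 = ?b * z + ?c * y1 + ?a * y2"
      have n: "x0\<^sup>2 + x1\<^sup>2 + x2\<^sup>2 = z\<^sup>2 + y1\<^sup>2 + y2\<^sup>2"
        unfolding x0_def x1_def x2_def by (rule rot_transpose[OF sq])
      have l: "s 0 * x0 + s 1 * x1 + s 2 * x2 + s 3 * y1 + s 4 * y2 + s 5 * z = v0 * z + v1 * y1 + v2 * y2"
        unfolding x0_def x1_def x2_def v0_def v1_def v2_def by (simp add: algebra_simps)
      have "R (z, \<theta>, y1, y2) = exp ((- x0\<^sup>2 / 2 + 2 * s 0 * x0 - (s 0)\<^sup>2) + (- x1\<^sup>2 / 2 + 2 * s 1 * x1 - (s 1)\<^sup>2)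
         + (- x2\<^sup>2 / 2 + 2 * s 2 * x2 - (s 2)\<^sup>2) + (- y1\<^sup>2 / 2 + 2 * s 3 * y1 - (s 3)\<^sup>2)
         + (- y2\<^sup>2 / 2 + 2 * s 4 * y2 - (s 4)\<^sup>2) + (- z\<^sup>2 / 2 + 2 * s 5 * z - (s 5)\<^sup>2))"
        unfolding R_def prod_lessThan_6 coord_simps x0_def[symmetric] x1_def[symmetric] x2_def[symmetric] g_def exp_add ..
      also have "(- x0\<^sup>2 / 2 + 2 * s 0 * x0 - (s 0)\<^sup>2) + (- x1\<^sup>2 / 2 + 2 * s 1 * x1 - (s 1)\<^sup>2)
         + (- x2\<^sup>2 / 2 + 2 * s 2 * x2 - (s 2)\<^sup>2) + (- y1\<^sup>2 / 2 + 2 * s 3 * y1 - (s 3)\<^sup>2)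
         + (- y2\<^sup>2 / 2 + 2 * s 4 * y2 - (s 4)\<^sup>2) + (- z\<^sup>2 / 2 + 2 * s 5 * z - (s 5)\<^sup>2)
        = - (x0\<^sup>2 + x1\<^sup>2 + x2\<^sup>2) / 2 - (z\<^sup>2 + y1\<^sup>2 + y2\<^sup>2) / 2
          + 2 * (s 0 * x0 + s 1 * x1 + s 2 * x2 + s 3 * y1 + s 4 * y2 + s 5 * z) - S"
        unfolding S_def by (simp add: field_simps)
      also have "\<dots> = - S + ((- z\<^sup>2 + 2 * v0 * z) + ((- y1\<^sup>2 + 2 * v1 * y1) + (- y2\<^sup>2 + 2 * v2 * y2)))"
        unfolding n l by (simp add: field_simps)
      finally show ?thesis by (simp only: exp_add)
    qed
    have Rb': "ennreal (R (fst b, \<theta>, snd b)) = ennreal (exp (- S)) * (ennreal (exp (- (fst b)\<^sup>2 + 2 * v0 * fst b)) *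
       (ennreal (exp (- (fst (snd b))\<^sup>2 + 2 * v1 * fst (snd b))) * ennreal (exp (- (snd (snd b))\<^sup>2 + 2 * v2 * snd (snd b)))))" for b
      using Rb[of "fst b" "fst (snd b)" "snd (snd b)"] by (simp add: ennreal_mult)
    have "(\<integral>\<^sup>+b. ennreal (R (fst b, \<theta>, snd b)) \<partial>lborel) = ennreal (exp (- S)) * (ennreal (sqrt pi * exp (v0\<^sup>2)) * (ennreal (sqrt pi * exp (v1\<^sup>2)) * ennreal (sqrt pi * exp (v2\<^sup>2))))"
    proof -
      have "(\<lambda>b :: real \<times> real \<times> real. ennreal (exp (- (fst b)\<^sup>2 + 2 * v0 * fst b)) *
       (ennreal (exp (- (fst (snd b))\<^sup>2 + 2 * v1 * fst (snd b))) * ennreal (exp (- (snd (snd b))\<^sup>2 + 2 * v2 * snd (snd b)))))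
         \<in> borel_measurable lborel"
        unfolding lborel3[symmetric] by measurable
      from nn_integral_cmult[OF this, of "ennreal (exp (- S))"] show ?thesis
        unfolding Rb' by (subst (asm) nn_integral_lborel3) (measurable, simp only: g1)
    qed
    also have "\<dots> = ennreal (sqrt pi * (sqrt pi * sqrt pi) * exp (- S + (v0\<^sup>2 + v1\<^sup>2 + v2\<^sup>2)))"
    proof -
      have "ennreal d * (ennreal (r * a) * (ennreal (r * b) * ennreal (r * c))) = ennreal (r * (r * r) * (d * (a * b * c)))"
        if "0 \<le> a" "0 \<le> b" "0 \<le> c" "0 \<le> d" "0 \<le> r" for a b c d r
        using that by (simp add: ennreal_mult[symmetric] mult_ac)
      then show ?thesis by (simp only: exp_add exp_ge_zero real_sqrt_ge_zero pi_ge_zero)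
    qed
    \<comment> \<open>The squares of the parameters in S cancel against the diagonal part of |v|^2,
      as the rotation preserves length; only cross terms remain.\<close>
    also have "- S + (v0\<^sup>2 + v1\<^sup>2 + v2\<^sup>2) = W \<theta>"
    proof -
      have n: "(?a * s 0 + ?c * s 1 + ?b * s 2)\<^sup>2 + (?b * s 0 + ?a * s 1 + ?c * s 2)\<^sup>2 + (?c * s 0 + ?b * s 1 + ?a * s 2)\<^sup>2
        = (s 0)\<^sup>2 + (s 1)\<^sup>2 + (s 2)\<^sup>2"
        by (rule rot_transpose) (use sq in \<open>simp_all add: algebra_simps\<close>)
      have "v0\<^sup>2 + v1\<^sup>2 + v2\<^sup>2 = (s 3)\<^sup>2 + (s 4)\<^sup>2 + (s 5)\<^sup>2 + ((?a * s 0 + ?c * s 1 + ?b * s 2)\<^sup>2 + (?b * s 0 + ?a * s 1 + ?c * s 2)\<^sup>2 + (?c * s 0 + ?b * s 1 + ?a * s 2)\<^sup>2)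
         + W \<theta>"
        unfolding v0_def v1_def v2_def W_def m0_def m1_def m2_def power2_sum[of "s _"] by (simp add: algebra_simps)
      then show ?thesis unfolding n S_def by simp
    qed
    finally show ?thesis by (simp add: mult_ac)
  qed
  have "integral\<^sup>L rot_space R = enn2real (\<integral>\<^sup>+p. ennreal (R p) \<partial>rot_space)"
    by (intro integral_eq_nn_integral) (auto simp: R_def g_def intro!: prod_nonneg)
  also have "(\<integral>\<^sup>+p. ennreal (R p) \<partial>rot_space) = (\<integral>\<^sup>+\<theta>. ennreal (pi * sqrt pi * exp (W \<theta>)) \<partial>lborel_on (-pi) pi)"
    using nn_integral_rot_space[of "\<lambda>p. ennreal (R p)"] by (simp add: inner)
  also have "enn2real \<dots> = (\<integral>\<theta>. pi * sqrt pi * exp (W \<theta>) \<partial>lborel_on (-pi) pi)"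
    by (intro integral_eq_nn_integral[symmetric]) auto
  finally have real: "integral\<^sup>L rot_space R = (\<integral>\<theta>. pi * sqrt pi * exp (W \<theta>) \<partial>lborel_on (-pi) pi)" .
  have "rot_form ?F = of_real (integral\<^sup>L rot_space R)"
    unfolding rot_form_def R by simp
  also have "\<dots> = (\<integral>\<theta>. of_real (pi * sqrt pi * exp (W \<theta>)) \<partial>lborel_on (-pi) pi)"
    unfolding real by simp
  also have "\<dots> = (\<integral>\<theta>. of_real (pi * sqrt pi * exp (2 * (s 0 + s 1 + s 2) * (s 3 + s 4 + s 5) / 3)) *
     exp (Complex (P / 2) (- Q / 2) * cis \<theta> + Complex (P / 2) (Q / 2) * cis (- \<theta>)) \<partial>lborel_on (-pi) pi)"
  proof (intro Bochner_Integration.integral_cong refl)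
    fix \<theta>
    have M: "m0 + m1 + m2 = (s 0 + s 1 + s 2) * (s 3 + s 4 + s 5)"
      unfolding m0_def m1_def m2_def by (simp add: algebra_simps)
    have "W \<theta> = 2 / 3 * (m0 + m1 + m2) + (P * cos \<theta> + Q * sin \<theta>)"
      unfolding W_def P_def Q_def rot_a_def rot_b_def rot_c_def by (simp add: field_simps)
    then have W: "W \<theta> = 2 * (s 0 + s 1 + s 2) * (s 3 + s 4 + s 5) / 3 + (P * cos \<theta> + Q * sin \<theta>)"
      unfolding M by simp
    have C: "Complex (P / 2) (- Q / 2) * cis \<theta> + Complex (P / 2) (Q / 2) * cis (- \<theta>) = of_real (P * cos \<theta> + Q * sin \<theta>)"
      by (simp add: complex_eq_iff field_simps)
    show "complex_of_real (pi * sqrt pi * exp (W \<theta>)) = of_real (pi * sqrt pi * exp (2 * (s 0 + s 1 + s 2) * (s 3 + s 4 + s 5) / 3)) *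
       exp (Complex (P / 2) (- Q / 2) * cis \<theta> + Complex (P / 2) (Q / 2) * cis (- \<theta>))"
      unfolding W C exp_of_real exp_add by (simp only: of_real_mult mult.assoc)
  qed
  also have "\<dots> = of_real (pi * sqrt pi * exp (2 * (s 0 + s 1 + s 2) * (s 3 + s 4 + s 5) / 3)) *
    (\<integral>\<theta>. exp (Complex (P / 2) (- Q / 2) * cis \<theta> + Complex (P / 2) (Q / 2) * cis (- \<theta>)) \<partial>lborel_on (-pi) pi)"
    by (rule integral_mult_right_zero)
  finally show ?thesis .
qed

text \<open>Let p and q be the components of the two parameter triples orthogonal to (1, 1, 1). Then
  A - a^2/3 = |p|^2 and B - b^2/3 = |q|^2, while the rotating part of the exponent has amplitude 2
  |p| |q|, so P^2 + Q^2 = 4 |p|^2 |q|^2. Hence both circle integrals have the same product of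
  coefficients.\<close>

lemma form_diff_coherent:
  fixes s :: "nat \<Rightarrow> real"
  shows "form_diff (\<lambda>i. coherent (of_real (s i))) = 0"
proof -
  define m0 where "m0 = s 0 * s 5 + s 1 * s 3 + s 2 * s 4"
  define m1 where "m1 = s 0 * s 3 + s 1 * s 4 + s 2 * s 5"
  define m2 where "m2 = s 0 * s 4 + s 1 * s 5 + s 2 * s 3"
  define P where "P = 2 / 3 * (2 * m0 - m1 - m2)"
  define Q where "Q = 2 / 3 * sqrt 3 * (m1 - m2)"
  define a where "a = s 0 + s 1 + s 2"
  define b where "b = s 3 + s 4 + s 5"
  define A where "A = (s 0)\<^sup>2 + (s 1)\<^sup>2 + (s 2)\<^sup>2"
  define B where "B = (s 3)\<^sup>2 + (s 4)\<^sup>2 + (s 5)\<^sup>2"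
  have "Q\<^sup>2 = 4 / 3 * (m1 - m2)\<^sup>2" by (simp add: Q_def power_mult_distrib power_divide)
  moreover have "P\<^sup>2 = 4 / 9 * (2 * m0 - m1 - m2)\<^sup>2"
    unfolding P_def power_mult_distrib by (rule arg_cong2[where f="(*)"]) (simp_all add: power2_eq_square)
  moreover have "36 * ((4 / 9 * X + 4 / 3 * Y) / 4) = 4 * (X + 3 * Y)" for X Y :: real
    by (simp add: field_simps)
  ultimately have "36 * ((P\<^sup>2 + Q\<^sup>2) / 4) = 4 * ((2 * m0 - m1 - m2)\<^sup>2 + 3 * (m1 - m2)\<^sup>2)"
    by (simp only:)
  also have "(2 * m0 - m1 - m2)\<^sup>2 + 3 * (m1 - m2)\<^sup>2 = (a\<^sup>2 - 3 * A) * (b\<^sup>2 - 3 * B)"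
    unfolding m0_def m1_def m2_def a_def b_def A_def B_def by (simp add: power2_eq_square algebra_simps)
  finally have pq: "(a\<^sup>2 / 3 - A) * (b\<^sup>2 / 3 - B) = (P\<^sup>2 + Q\<^sup>2) / 4"
    by (simp add: field_simps)
  have "complex_of_real (a\<^sup>2 / 3 - A) * complex_of_real (b\<^sup>2 / 3 - B) = of_real ((P\<^sup>2 + Q\<^sup>2) / 4)"
    unfolding of_real_mult[symmetric] pq ..
  also have "\<dots> = Complex (P / 2) (- Q / 2) * Complex (P / 2) (Q / 2)"
    by (simp add: complex_eq_iff power2_eq_square field_simps)
  finally have eq: "(\<integral>\<theta>. exp (complex_of_real (a\<^sup>2 / 3 - A) * cis \<theta> + complex_of_real (b\<^sup>2 / 3 - B) * cis (- \<theta>)) \<partial>lborel_on (-pi) pi) =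
    (\<integral>\<theta>. exp (Complex (P / 2) (- Q / 2) * cis \<theta> + Complex (P / 2) (Q / 2) * cis (- \<theta>)) \<partial>lborel_on (-pi) pi)"
    by (rule integral_circle_exp_cong)
  have c: "sqrt (pi / 3) / 4 = 1 / (4 * pi * sqrt 3) * (pi * sqrt pi)"
    by (simp add: real_sqrt_divide)
  have "time_form (\<lambda>i. coherent (of_real (s i))) = of_real (sqrt (pi / 3) / 4 * exp (2 * a * b / 3)) *
    (\<integral>\<theta>. exp (Complex (P / 2) (- Q / 2) * cis \<theta> + Complex (P / 2) (Q / 2) * cis (- \<theta>)) \<partial>lborel_on (-pi) pi)"
    using time_form_coherent[of s] unfolding a_def[symmetric] b_def[symmetric] A_def[symmetric] B_def[symmetric] eq .
  also have "\<dots> = of_real (1 / (4 * pi * sqrt 3)) * rot_form (\<lambda>i. coherent (of_real (s i)))"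
    using rot_form_coherent[of s]
    unfolding m0_def[symmetric] m1_def[symmetric] m2_def[symmetric] P_def[symmetric] Q_def[symmetric] a_def[symmetric] b_def[symmetric]
    unfolding c by (simp only: of_real_mult mult.assoc)
  finally show ?thesis by (simp add: form_diff_def)
qed

section \<open>The Strichartz estimate\<close>

lemma time_density_const: "time_density (\<lambda>_. f) p = of_real ((norm (flow f (fst p) (snd p))) ^ 6)"
proof -
  let ?z = "flow f (fst p) (snd p)"
  have "time_density (\<lambda>_. f) p = ?z * ?z * ?z * cnj ?z * cnj ?z * cnj ?z"
    by (simp add: time_density_def prod_lessThan_6 cnj_slot_def)
  also have "\<dots> = (?z * cnj ?z) * (?z * cnj ?z) * (?z * cnj ?z)" by (simp only: mult_ac)
  also have "?z * cnj ?z = of_real ((norm ?z)\<^sup>2)" by (simp only: complex_norm_square)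
  also have "complex_of_real ((norm ?z)\<^sup>2) * of_real ((norm ?z)\<^sup>2) * of_real ((norm ?z)\<^sup>2) = of_real ((norm ?z) ^ 6)"
    by (simp flip: of_real_mult power_add)
  finally show ?thesis .
qed

text \<open>With six equal slots the space-time form is the sixth power of the L^6 norm, and the
  rotation form has an elementary bound.\<close>

lemma strichartz_bounded_flow:
  assumes f: "bounded_flow f"
  shows "(\<integral>\<^sup>+p. ennreal ((norm (flow f (fst p) (snd p))) ^ 6) \<partial>time_space) \<le> ennreal (sqnorm f ^ 3)"
proof -
  let ?F = "\<lambda>_ :: nat. f" and ?u = "\<lambda>p. (norm (flow f (fst p) (snd p))) ^ 6"
  have sq: "square_integrable lborel f" using f by (simp add: bounded_flow_def)
  have zero: "form_diff ?F = 0"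
  proof (rule form_diff_extend[where N="Collect bounded_flow"])
    show "\<exists>C\<ge>0. \<forall>f. square_integrable lborel f \<longrightarrow> sqnorm f \<le> R \<longrightarrow>
         (\<integral>\<^sup>+p. ennreal (norm (time_density (F(k := f)) p)) \<partial>time_space) \<le> ennreal C"
      if "k < 6" "\<And>i. i < 6 \<Longrightarrow> F i \<in> Collect bounded_flow" for F k R
      using bounded_flow_slot_bound[of k F R] that by simp
  qed (use f in \<open>auto simp: bounded_flow_coherent form_diff_coherent\<close>, simp add: bounded_flow_def)
  have int: "integrable time_space (time_density ?F)"
    by (rule integrable_time_density) (rule f)
  then have int': "integrable time_space ?u"
    unfolding time_density_const[abs_def] by (simp only: complex_of_real_integrable_eq)
  have r: "norm (rot_form ?F) \<le> 2 * pi * (sqnorm f * (sqnorm f * sqnorm f) + sqnorm f * (sqnorm f * sqnorm f))"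
    by (rule rot_form_bound(2)) (rule sq)
  have "complex_of_real (integral\<^sup>L time_space ?u) = time_form ?F"
    unfolding time_form_def time_density_const[abs_def] by (rule integral_of_real[OF int', symmetric])
  also have "\<dots> = of_real (1 / (4 * pi * sqrt 3)) * rot_form ?F"
    using zero by (simp add: form_diff_def)
  finally have eq: "complex_of_real (integral\<^sup>L time_space ?u) = of_real (1 / (4 * pi * sqrt 3)) * rot_form ?F" .
  have "norm (complex_of_real (1 / (4 * pi * sqrt 3))) = 1 / (4 * pi * sqrt 3)"
    by (simp only: norm_of_real) simp
  then have "norm (complex_of_real (integral\<^sup>L time_space ?u)) = 1 / (4 * pi * sqrt 3) * norm (rot_form ?F)"
    unfolding eq norm_mult by simp
  then have "integral\<^sup>L time_space ?u \<le> 1 / (4 * pi * sqrt 3) * (2 * pi * (sqnorm f * (sqnorm f * sqnorm f) + sqnorm f * (sqnorm f * sqnorm f)))"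
    using mult_left_mono[OF r, of "1 / (4 * pi * sqrt 3)"] by (simp add: Bochner_Integration.integral_nonneg)
  \<comment> \<open>The constants combine to 4 pi / (4 pi sqrt 3), which is below 1.\<close>
  also have "\<dots> = sqnorm f ^ 3 / sqrt 3"
    by (simp add: power3_eq_cube field_simps)
  also have "\<dots> \<le> sqnorm f ^ 3 / 1"
    by (intro divide_left_mono) auto
  finally have le: "integral\<^sup>L time_space ?u \<le> sqnorm f ^ 3" by simp
  have "(\<integral>\<^sup>+p. ennreal (?u p) \<partial>time_space) = ennreal (integral\<^sup>L time_space ?u)"
    using int' by (intro nn_integral_eq_integral) auto
  also have "\<dots> \<le> ennreal (sqnorm f ^ 3)" by (rule ennreal_leI[OF le])
  finally show ?thesis .
qed

text \<open>Fatou's lemma for the partial sums along the subsequence, which are finite Hermite sums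
  and so covered by the bounded case.\<close>

lemma strichartz:
  assumes f: "square_integrable lborel f"
  shows "(\<integral>\<^sup>+p. ennreal ((norm (flow f (fst p) (snd p))) ^ 6) \<partial>time_space) \<le> ennreal (sqnorm f ^ 3)"
proof -
  note s = summable_coef(1)[OF f]
  define g where "g k p = hermite_sum (coef f) {..<subseq_of (coef f) k} (fst p) (snd p)" for k p
  have [measurable]: "g k \<in> borel_measurable (borel \<Otimes>\<^sub>M borel)" for k
    using measurable_hermite_sum(1)[of "coef f" "{..<subseq_of (coef f) k}"] by (simp add: g_def[abs_def] split_beta')
  have ae: "AE p in time_space. (\<lambda>k. g k p) \<longlonglongrightarrow> flow f (fst p) (snd p)"
  proof -
    \<comment> \<open>The Cauchy property is a measurable predicate of p, as
      \<open>AE_time_space\<close> demands; the limit is the flow by definition of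
      \<open>flowc\<close>.\<close>
    have "AE p in time_space. Cauchy (\<lambda>k. g k p)"
    proof (rule AE_time_space)
      show "AE x in lborel. Cauchy (\<lambda>k. g k (t, x))" for t
        using hermite_sum_convergent_AE[OF s, of t] by eventually_elim (auto simp: g_def intro: LIMSEQ_imp_Cauchy)
    qed measurable
    then show ?thesis
    proof eventually_elim
      fix p assume "Cauchy (\<lambda>k. g k p)"
      then have "(\<lambda>k. g k p) \<longlonglongrightarrow> lim (\<lambda>k. g k p)"
        by (simp add: Cauchy_convergent convergent_LIMSEQ_iff[symmetric])
      then show "(\<lambda>k. g k p) \<longlonglongrightarrow> flow f (fst p) (snd p)"
        by (simp add: g_def flow_def flowc_def)
    qed
  qed
  have gb: "(\<integral>\<^sup>+p. ennreal (norm (g k p) ^ 6) \<partial>time_space) \<le> ennreal (sqnorm f ^ 3)" for k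
  proof -
    let ?h = "hermite_sum (coef f) {..<subseq_of (coef f) k} 0"
    have "sqnorm ?h \<le> sqnorm f"
    proof -
      have "sqnorm ?h \<le> (\<Sum>n. (norm (coef f n))\<^sup>2)"
        unfolding norm_hermite_sum[OF finite_lessThan] by (intro sum_le_suminf s) auto
      then show ?thesis using summable_coef(2)[OF f] by linarith
    qed
    then have "ennreal (sqnorm ?h ^ 3) \<le> ennreal (sqnorm f ^ 3)"
      by (intro ennreal_leI power_mono) auto
    then show ?thesis
      using strichartz_bounded_flow[OF bounded_flow_hermite_sum[of "coef f" "subseq_of (coef f) k"]]
      unfolding flow_hermite_sum g_def by (rule order.trans[rotated])
  qed
  have "(\<integral>\<^sup>+p. ennreal ((norm (flow f (fst p) (snd p))) ^ 6) \<partial>time_space) \<le> (\<integral>\<^sup>+p. liminf (\<lambda>k. ennreal (norm (g k p) ^ 6)) \<partial>time_space)"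
  proof (rule nn_integral_mono_AE)
    show "AE p in time_space. ennreal ((norm (flow f (fst p) (snd p))) ^ 6) \<le> liminf (\<lambda>k. ennreal (norm (g k p) ^ 6))"
      using ae
    proof eventually_elim
      fix p assume "(\<lambda>k. g k p) \<longlonglongrightarrow> flow f (fst p) (snd p)"
      then have "(\<lambda>k. ennreal (norm (g k p) ^ 6)) \<longlonglongrightarrow> ennreal ((norm (flow f (fst p) (snd p))) ^ 6)"
        by (intro tendsto_ennrealI tendsto_power tendsto_norm)
      then have "liminf (\<lambda>k. ennreal (norm (g k p) ^ 6)) = ennreal ((norm (flow f (fst p) (snd p))) ^ 6)"
        by (intro lim_imp_Liminf) auto
      then show "ennreal ((norm (flow f (fst p) (snd p))) ^ 6) \<le> liminf (\<lambda>k. ennreal (norm (g k p) ^ 6))" by simp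
    qed
  qed
  also have "\<dots> \<le> liminf (\<lambda>k. \<integral>\<^sup>+p. ennreal (norm (g k p) ^ 6) \<partial>time_space)"
    by (rule nn_integral_liminf) measurable
  also have "\<dots> \<le> ennreal (sqnorm f ^ 3)"
    by (rule Liminf_le) (auto intro!: always_eventually gb)
  finally show ?thesis .
qed

lemma prod_le_sum_power_card:
  fixes a :: "nat \<Rightarrow> real"
  assumes "\<And>i. i < n \<Longrightarrow> 0 \<le> a i" "n > 0"
  shows "(\<Prod>i<n. a i) \<le> (\<Sum>i<n. a i ^ n)"
proof -
  have "Max (a ` {..<n}) \<in> a ` {..<n}"
    using assms(2) by (intro Max_in) auto
  then obtain j where j: "j < n" "Max (a ` {..<n}) = a j" by auto
  have le: "a i \<le> a j" if "i < n" for i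
    using that unfolding j(2)[symmetric] by (intro Max_ge) auto
  have "(\<Prod>i<n. a i) \<le> (\<Prod>i<n. a j)"
    using assms le by (intro prod_mono) auto
  also have "\<dots> = a j ^ n" by simp
  also have "\<dots> \<le> (\<Sum>i<n. a i ^ n)"
    using assms j(1) by (intro member_le_sum) auto
  finally show ?thesis .
qed

lemma time_density_nn_bound:
  assumes F: "\<And>i. i < 6 \<Longrightarrow> square_integrable lborel (F i)"
  shows "(\<integral>\<^sup>+p. ennreal (norm (time_density F p)) \<partial>time_space) \<le> ennreal (\<Sum>i<6. sqnorm (F i) ^ 3)"
proof -
  have "(\<integral>\<^sup>+p. ennreal (norm (time_density F p)) \<partial>time_space) \<le>
     (\<integral>\<^sup>+p. (\<Sum>i<6. ennreal ((norm (flow (F i) (fst p) (snd p))) ^ 6)) \<partial>time_space)"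
  proof (rule nn_integral_mono)
    fix p
    have "norm (time_density F p) = (\<Prod>i<6. norm (flow (F i) (fst p) (snd p)))"
      by (simp add: time_density_def prod_norm[symmetric])
    also have "\<dots> \<le> (\<Sum>i<6. (norm (flow (F i) (fst p) (snd p))) ^ 6)"
      by (rule prod_le_sum_power_card) auto
    finally have "ennreal (norm (time_density F p)) \<le> ennreal (\<Sum>i<6. (norm (flow (F i) (fst p) (snd p))) ^ 6)"
      by (rule ennreal_leI)
    then show "ennreal (norm (time_density F p)) \<le> (\<Sum>i<6. ennreal ((norm (flow (F i) (fst p) (snd p))) ^ 6))"
      by (simp add: sum_ennreal)
  qed
  also have "\<dots> = (\<Sum>i<6. \<integral>\<^sup>+p. ennreal ((norm (flow (F i) (fst p) (snd p))) ^ 6) \<partial>time_space)"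
    by (intro nn_integral_sum) measurable
  also have "\<dots> \<le> (\<Sum>i<6. ennreal (sqnorm (F i) ^ 3))"
    by (intro sum_mono strichartz F) auto
  also have "\<dots> = ennreal (\<Sum>i<6. sqnorm (F i) ^ 3)"
    by (intro sum_ennreal) auto
  finally show ?thesis .
qed

text \<open>The second run of \<open>form_diff_extend\<close>, now with all of L^2: the Strichartz
  estimate supplies the bound in each slot.\<close>

theorem time_form_eq_rot_form:
  assumes F: "\<And>i. i < 6 \<Longrightarrow> square_integrable lborel (F i)"
  shows "integrable time_space (time_density F)"
    and "time_form F = of_real (1 / (4 * pi * sqrt 3)) * rot_form F"
proof -
  have "(\<integral>\<^sup>+p. ennreal (norm (time_density F p)) \<partial>time_space) < \<infinity>"
    by (rule order_le_less_trans[OF time_density_nn_bound[of F]]) (use F in auto)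
  then show "integrable time_space (time_density F)"
    by (intro integrableI_bounded) auto
  have "form_diff F = 0"
  proof (rule form_diff_extend[where N="Collect (square_integrable lborel)"])
    fix G :: "nat \<Rightarrow> real \<Rightarrow> complex" and k :: nat and R :: real
    assume k: "k < 6" and G: "\<And>i. i < 6 \<Longrightarrow> G i \<in> Collect (square_integrable lborel)"
    define C where "C = (\<Sum>i<6. (max R (sqnorm (G i))) ^ 3)"
    have "(\<integral>\<^sup>+p. ennreal (norm (time_density (G(k := f)) p)) \<partial>time_space) \<le> ennreal C"
      if f: "square_integrable lborel f" "sqnorm f \<le> R" for f
    proof -
      have "(\<integral>\<^sup>+p. ennreal (norm (time_density (G(k := f)) p)) \<partial>time_space) \<le> ennreal (\<Sum>i<6. sqnorm ((G(k := f)) i) ^ 3)"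
        by (rule time_density_nn_bound) (use G f in auto)
      also have "\<dots> \<le> ennreal C"
        unfolding C_def using f by (intro ennreal_leI sum_mono power_mono) auto
      finally show ?thesis .
    qed
    moreover have "0 \<le> C" unfolding C_def
      by (intro sum_nonneg zero_le_power) (simp add: max.coboundedI2)
    ultimately show "\<exists>C\<ge>0. \<forall>f. square_integrable lborel f \<longrightarrow> sqnorm f \<le> R \<longrightarrow>
         (\<integral>\<^sup>+p. ennreal (norm (time_density (G(k := f)) p)) \<partial>time_space) \<le> ennreal C" by blast
  qed (use F in \<open>auto simp: square_integrable_coherent form_diff_coherent\<close>)
  then show "time_form F = of_real (1 / (4 * pi * sqrt 3)) * rot_form F"
    by (simp add: form_diff_def)
qed

section \<open>The weight inequality\<close>

lemma japanese_ge_1: "1 \<le> japanese x"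
  by (simp add: japanese_def)

lemma japanese_pos [simp]: "0 < japanese x"
  using japanese_ge_1[of x] by linarith

lemma japanese_nonzero [simp]: "japanese x \<noteq> 0"
  using japanese_pos[of x] by linarith

lemma japanese_nonneg [simp]: "0 \<le> japanese x"
  using japanese_pos[of x] by linarith

lemma japanese_square: "(japanese x)\<^sup>2 = 1 + x\<^sup>2"
  by (simp add: japanese_def)

lemma abs_le_japanese: "\<bar>x\<bar> \<le> japanese x"
  by (simp add: abs_le_square_iff[of x "japanese x", simplified] japanese_square)

lemma measurable_japanese [measurable]: "japanese \<in> borel_measurable borel"
  unfolding japanese_def[abs_def] by measurable

text \<open>A shift by 2 pi / 3 permutes the entries of the circulant matrix cyclically, so slot
  \<open>j\<close> is reduced to slot 0 by shifting the angle.\<close>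

definition tau :: "nat \<Rightarrow> real" where
  "tau j = (if j = 0 then 0 else if j = 1 then 2 * pi / 3 else - (2 * pi / 3))"

lemma rot_shift:
  "rot_b (\<theta> + 2 * pi / 3) = rot_a \<theta>" "rot_c (\<theta> + 2 * pi / 3) = rot_b \<theta>"
  "rot_b (\<theta> + - (2 * pi / 3)) = rot_c \<theta>" "rot_c (\<theta> + - (2 * pi / 3)) = rot_a \<theta>"
  unfolding rot_a_def rot_b_def rot_c_def cos_add sin_add cos_minus sin_minus cos_120 sin_120
  by (simp_all add: field_simps)

text \<open>The two quantities are the coefficients of the j-th rotated variable when y1 and y2 are
  expressed through the rotated variables.\<close>

definition near :: "nat \<Rightarrow> real \<Rightarrow> real set" where
  "near j e = {\<theta>. \<bar>rot_b (\<theta> + tau j)\<bar> \<le> e \<and> \<bar>rot_c (\<theta> + tau j)\<bar> \<le> e}"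

section \<open>Measure of the angles that nearly align two axes\<close>

lemma abs_le_2_abs_sin:
  assumes "cos x \<ge> 1 / 2" "\<bar>x\<bar> \<le> pi"
  shows "\<bar>x\<bar> \<le> 2 * \<bar>sin x\<bar>"
proof -
  define y where "y = \<bar>x\<bar>"
  have y: "0 \<le> y" "y \<le> pi" "cos y \<ge> 1 / 2" using assms by (auto simp: y_def)
  have "2 * sin 0 - 0 \<le> 2 * sin y - y"
  proof (rule DERIV_nonneg_imp_nondecreasing[OF y(1)])
    fix z assume z: "0 \<le> z" "z \<le> y"
    have "cos y \<le> cos z" using z y by (intro cos_monotone_0_pi_le) auto
    moreover have "((\<lambda>z. 2 * sin z - z) has_real_derivative 2 * cos z - 1) (at z)"
      by (auto intro!: derivative_eq_intros)
    ultimately show "\<exists>d. ((\<lambda>z. 2 * sin z - z) has_real_derivative d) (at z) \<and> 0 \<le> d"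
      using y(3) by (intro exI[of _ "2 * cos z - 1"]) auto
  qed
  moreover have "sin y \<le> \<bar>sin x\<bar>" by (auto simp: y_def abs_if)
  ultimately show ?thesis by (simp add: y_def)
qed

text \<open>The sum of the two entries is 2 (1 - cos \<phi>) / 3, their difference 2 sin \<phi> /
  sqrt 3. The first, with e \<le> 1/6, gives cos \<phi> \<ge> 1/2; the second bounds |sin \<phi>| by
  2 e. The alternatives are the multiples of 2 pi within reach of |\<phi>| \<le> 2 pi.\<close>

lemma near_angle:
  assumes b: "\<bar>rot_b \<phi>\<bar> \<le> e" and c: "\<bar>rot_c \<phi>\<bar> \<le> e" and e: "e \<le> 1 / 6" and \<phi>: "\<bar>\<phi>\<bar> \<le> 2 * pi"
  shows "\<bar>\<phi>\<bar> \<le> 4 * e \<or> \<bar>\<phi> - 2 * pi\<bar> \<le> 4 * e \<or> \<bar>\<phi> + 2 * pi\<bar> \<le> 4 * e"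
proof -
  have "2 * (1 - cos \<phi>) = 3 * (rot_b \<phi> + rot_c \<phi>)"
    by (simp add: rot_b_def rot_c_def field_simps)
  moreover have "rot_b \<phi> \<le> e" "rot_c \<phi> \<le> e" using b c by (auto simp: abs_le_iff)
  ultimately have "2 * (1 - cos \<phi>) \<le> 1" using e by simp
  then have cos: "cos \<phi> \<ge> 1 / 2" by simp
  have "3 * (rot_b \<phi> - rot_c \<phi>) = 2 * sqrt 3 * sin \<phi>"
    by (simp add: rot_b_def rot_c_def field_simps)
  then have "2 * sqrt 3 * \<bar>sin \<phi>\<bar> = 3 * \<bar>rot_b \<phi> - rot_c \<phi>\<bar>"
    by (metis abs_mult abs_numeral abs_of_nonneg real_sqrt_ge_zero zero_le_numeral)
  also have "\<dots> \<le> 3 * (e + e)"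
    by (intro mult_left_mono order.trans[OF abs_triangle_ineq4] add_mono b c) simp
  also have "\<dots> = 6 * e" by simp
  finally have s: "2 * sqrt 3 * \<bar>sin \<phi>\<bar> \<le> 6 * e" .
  have "sqrt 3 \<ge> 3 / 2" by (rule real_le_rsqrt) (simp add: power2_eq_square)
  then have "2 * (3 / 2) * \<bar>sin \<phi>\<bar> \<le> 2 * sqrt 3 * \<bar>sin \<phi>\<bar>"
    by (intro mult_right_mono mult_left_mono) auto
  then have sin: "\<bar>sin \<phi>\<bar> \<le> 2 * e" using s by linarith
  have main: "\<bar>\<psi>\<bar> \<le> 4 * e" if "cos \<psi> = cos \<phi>" "sin \<psi> = sin \<phi>" "\<bar>\<psi>\<bar> \<le> pi" for \<psi>
    using abs_le_2_abs_sin[of \<psi>] that cos sin by simp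
  consider "\<bar>\<phi>\<bar> \<le> pi" | "\<phi> > pi" | "\<phi> < - pi" by linarith
  then show ?thesis
  proof cases
    case 1
    then show ?thesis using main[of \<phi>] by simp
  next
    case 2
    then show ?thesis using main[of "\<phi> - 2 * pi"] \<phi> by (simp add: cos_diff sin_diff)
  next
    case 3
    then show ?thesis using main[of "\<phi> + 2 * pi"] \<phi> by simp
  qed
qed

lemma tau_bound: "\<bar>tau j\<bar> \<le> pi"
  by (auto simp: tau_def)

lemma measurable_near [measurable]: "near j e \<in> sets borel"
  unfolding near_def by measurable

text \<open>Three intervals of length 8 e have total length 24 e. The larger constant 48 also covers
  e > 1/6, where 48 e > 8 exceeds the length 2 pi of the circle.\<close>

lemma emeasure_near:
  assumes "0 \<le> e"
  shows "emeasure (lborel_on (-pi) pi) (near j e) \<le> ennreal (48 * e)"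
proof (cases "e \<le> 1 / 6")
  case True
  let ?I = "\<lambda>k. {2 * pi * k - tau j - 4 * e .. 2 * pi * k - tau j + 4 * e}"
  have "{-pi..pi} \<inter> near j e \<subseteq> ?I 0 \<union> (?I 1 \<union> ?I (-1))"
  proof
    fix \<theta> assume \<theta>: "\<theta> \<in> {-pi..pi} \<inter> near j e"
    then have "\<bar>\<theta> + tau j\<bar> \<le> 2 * pi" using tau_bound[of j] by (auto simp: abs_le_iff)
    then have "\<bar>\<theta> + tau j\<bar> \<le> 4 * e \<or> \<bar>\<theta> + tau j - 2 * pi\<bar> \<le> 4 * e \<or> \<bar>\<theta> + tau j + 2 * pi\<bar> \<le> 4 * e"
      using \<theta> by (intro near_angle True) (auto simp: near_def)
    then show "\<theta> \<in> ?I 0 \<union> (?I 1 \<union> ?I (-1))"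
      by (auto simp: abs_le_iff)
  qed
  then have "emeasure lborel ({-pi..pi} \<inter> near j e) \<le> emeasure lborel (?I 0 \<union> (?I 1 \<union> ?I (-1)))"
    by (intro emeasure_mono) auto
  also have "\<dots> \<le> emeasure lborel (?I 0) + (emeasure lborel (?I 1) + emeasure lborel (?I (-1)))"
    by (intro order.trans[OF emeasure_subadditive] add_left_mono emeasure_subadditive) auto
  also have "\<dots> = ennreal (24 * e)"
    using assms by (simp add: ennreal_plus[symmetric] del: ennreal_plus)
  also have "\<dots> \<le> ennreal (48 * e)" using assms by (intro ennreal_leI) auto
  finally show ?thesis
    by (simp add: lborel_on_def emeasure_density Int_commute flip: indicator_inter_arith)
next
  case False
  have "emeasure (lborel_on (-pi) pi) (near j e) \<le> emeasure (lborel_on (-pi) pi) UNIV"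
    by (intro emeasure_mono) auto
  also have "\<dots> = ennreal (2 * pi)" by (simp add: emeasure_lborel_on)
  also have "\<dots> \<le> ennreal (48 * e)"
    using False pi_less_4 by (intro ennreal_leI) linarith
  finally show ?thesis .
qed

text \<open>
  The part of the kernel that is not bounded pointwise lives where \<open>rot \<theta>\<close> nearly maps the \<open>z\<close>-axis
  to the \<open>j\<close>-th axis. The constants below are \<open>1152 = 48 * 24\<close> and \<open>4608 = 4 * 1152\<close>.
\<close>

definition peak :: "real \<Rightarrow> nat \<Rightarrow> real \<Rightarrow> real \<Rightarrow> real" where
  "peak \<delta> j \<theta> x = (if \<bar>rot_b (\<theta> + tau j)\<bar> \<le> 24 * japanese x powr - \<delta> \<and> \<bar>rot_c (\<theta> + tau j)\<bar> \<le> 24 * japanese x powr - \<delta>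
     then japanese x powr (\<delta> / 2) else 0)"

lemma peak_nonneg: "0 \<le> peak \<delta> j \<theta> x"
  by (simp add: peak_def)

lemma measurable_peak [measurable]: "(\<lambda>p. peak \<delta> j (fst p) (snd p)) \<in> borel_measurable (borel \<Otimes>\<^sub>M borel)"
  unfolding peak_def[abs_def] by measurable

text \<open>The threshold in \<open>peak\<close> is, up to the factor 24, the reciprocal of its
  squared height, so height and measure cancel uniformly in x.\<close>

lemma integral_peak_square: "(\<integral>\<^sup>+\<theta>. ennreal ((peak \<delta> j \<theta> x)\<^sup>2) \<partial>lborel_on (-pi) pi) \<le> ennreal 1152"
proof -
  let ?N = "near j (24 * japanese x powr - \<delta>)"
  have "ennreal ((peak \<delta> j \<theta> x)\<^sup>2) = ennreal (japanese x powr \<delta>) * indicator ?N \<theta>" for \<theta>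
    by (auto simp: peak_def near_def power2_eq_square powr_add[symmetric])
  then have "(\<integral>\<^sup>+\<theta>. ennreal ((peak \<delta> j \<theta> x)\<^sup>2) \<partial>lborel_on (-pi) pi) = ennreal (japanese x powr \<delta>) * emeasure (lborel_on (-pi) pi) ?N"
    by (simp add: nn_integral_cmult)
  also have "\<dots> \<le> ennreal (japanese x powr \<delta>) * ennreal (48 * (24 * japanese x powr - \<delta>))"
    by (intro mult_left_mono emeasure_near) auto
  also have "\<dots> = ennreal (japanese x powr \<delta> * (48 * (24 * japanese x powr - \<delta>)))"
    by (simp add: ennreal_mult)
  also have "japanese x powr \<delta> * (48 * (24 * japanese x powr - \<delta>)) = 1152 * (japanese x powr \<delta> * japanese x powr - \<delta>)"
    by simp
  also have "japanese x powr \<delta> * japanese x powr - \<delta> = 1"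
    using japanese_pos[of x] by (simp flip: powr_add)
  finally show ?thesis by simp
qed

text \<open>Expressing y1 through x, u1, u2 gives |m1 x| \<le> 3 M, while |x| \<ge> M D / 4; the
  quotient is 12 / D. That \<langle>z\<rangle> is at least 4 allows the passage from
  \<langle>x\<rangle> to |x|. The last claim comes from x^2 \<le> z^2 + y1^2 + y2^2.\<close>

lemma rotation_forces_small_entries:
  fixes x z y1 y2 u1 u2 m1 m2 n1 n2 n3 n4 M D :: real
  assumes norm: "x\<^sup>2 + u1\<^sup>2 + u2\<^sup>2 = z\<^sup>2 + y1\<^sup>2 + y2\<^sup>2"
    and y1: "y1 = m1 * x + n1 * u1 + n2 * u2" and y2: "y2 = m2 * x + n3 * u1 + n4 * u2"
    and n: "\<bar>n1\<bar> \<le> 1" "\<bar>n2\<bar> \<le> 1" "\<bar>n3\<bar> \<le> 1" "\<bar>n4\<bar> \<le> 1"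
    and small: "\<bar>u1\<bar> \<le> M" "\<bar>u2\<bar> \<le> M" "\<bar>y1\<bar> \<le> M" "\<bar>y2\<bar> \<le> M"
    and N: "japanese z = M * D" "M > 0" "D \<ge> 1" "japanese z \<ge> 4" "japanese z \<le> 2 * japanese x"
  shows "\<bar>m1\<bar> \<le> 12 / D" "\<bar>m2\<bar> \<le> 12 / D" "japanese x \<le> 2 * japanese z"
proof -
  let ?N = "japanese z"
  have "?N\<^sup>2 \<le> (2 * japanese x)\<^sup>2" using N by (intro power_mono) auto
  then have "?N\<^sup>2 \<le> 4 + 4 * x\<^sup>2" by (simp add: power_mult_distrib japanese_square)
  moreover have "16 \<le> ?N\<^sup>2" using power_mono[OF N(4), of 2] by simp
  ultimately have "?N\<^sup>2 \<le> (4 * \<bar>x\<bar>)\<^sup>2" by (simp add: power_mult_distrib)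
  then have x: "?N \<le> 4 * \<bar>x\<bar>" by (rule power2_le_imp_le) simp
  have x0: "\<bar>x\<bar> > 0" using x N(4) by linarith
  have coef: "\<bar>m\<bar> \<le> 12 / D" if "y = m * x + k * u1 + l * u2" "\<bar>y\<bar> \<le> M" "\<bar>k\<bar> \<le> 1" "\<bar>l\<bar> \<le> 1" for y m k l
  proof -
    have "\<bar>k * u1\<bar> \<le> 1 * M" "\<bar>l * u2\<bar> \<le> 1 * M"
      using mult_mono[OF that(3) small(1)] mult_mono[OF that(4) small(2)] N(2) by (simp_all add: abs_mult)
    then have "\<bar>m * x\<bar> \<le> 3 * M" using that(1,2) by linarith
    then have "\<bar>m\<bar> * (M * D) \<le> \<bar>m\<bar> * (4 * \<bar>x\<bar>)" "\<bar>m\<bar> * (4 * \<bar>x\<bar>) \<le> 12 * M"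
      using x N(1) by (auto simp: abs_mult intro!: mult_left_mono)
    then have "\<bar>m\<bar> * D * M \<le> 12 * M" by (simp add: mult_ac)
    then have "\<bar>m\<bar> * D \<le> 12" using N(2) by simp
    then show ?thesis using N(3) by (simp add: field_simps)
  qed
  show "\<bar>m1\<bar> \<le> 12 / D" by (rule coef[OF y1 small(3) n(1,2)])
  show "\<bar>m2\<bar> \<le> 12 / D" by (rule coef[OF y2 small(4) n(3,4)])
  have "M \<le> ?N" using N mult_left_mono[OF N(3), of M] by simp
  then have "\<bar>y1\<bar> \<le> ?N" "\<bar>y2\<bar> \<le> ?N" using small by auto
  then have "y1\<^sup>2 \<le> ?N\<^sup>2" "y2\<^sup>2 \<le> ?N\<^sup>2" by (simp_all add: abs_le_square_iff[symmetric])
  moreover have "x\<^sup>2 \<le> z\<^sup>2 + y1\<^sup>2 + y2\<^sup>2" unfolding norm[symmetric] by simp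
  ultimately have "x\<^sup>2 \<le> 3 + 4 * z\<^sup>2"
    using zero_le_power2[of z] unfolding japanese_square by linarith
  then have "(japanese x)\<^sup>2 \<le> (2 * ?N)\<^sup>2"
    by (simp add: japanese_square power_mult_distrib)
  then show "japanese x \<le> 2 * ?N" by (rule power2_le_imp_le) simp
qed

lemma powr_half_mult: "0 < x \<Longrightarrow> x powr (d / 2) * x powr (d / 2) = (x :: real) powr d"
  by (simp flip: powr_add)

text \<open>The factor \<langle>z\<rangle>^\<sigma> costs 2^\<sigma> \<langle>x\<rangle>^\<sigma>,
  so what remains is \<langle>z\<rangle>^\<delta> \<le> 4 W (1 + J), with W the product of the four
  other weights and J that of the two peaks. When none of the four variables pays,
  \<open>rotation_forces_small_entries\<close> applies with M = \<langle>z\<rangle>^\<alpha> and D =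
  \<langle>z\<rangle>^\<delta>.\<close>

lemma weight_le_slot:
  fixes \<sigma> \<delta> x z y1 y2 u1 u2 :: real
  assumes \<sigma>: "\<sigma> > 0" and \<delta>: "\<delta> = \<sigma> / (1 + \<sigma>)"
    and norm: "x\<^sup>2 + u1\<^sup>2 + u2\<^sup>2 = z\<^sup>2 + y1\<^sup>2 + y2\<^sup>2"
    and y1: "y1 = rot_b (\<theta> + tau j) * x + n1 * u1 + n2 * u2" and y2: "y2 = rot_c (\<theta> + tau j) * x + n3 * u1 + n4 * u2"
    and n: "\<bar>n1\<bar> \<le> 1" "\<bar>n2\<bar> \<le> 1" "\<bar>n3\<bar> \<le> 1" "\<bar>n4\<bar> \<le> 1"
    and N: "japanese z \<le> 2 * japanese x"
  shows "japanese z powr (\<sigma> + \<delta>) \<le> 4 * 2 powr \<sigma> *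
     (japanese x powr \<sigma> * (japanese u1 powr \<sigma> * japanese u2 powr \<sigma> * (japanese y1 powr \<sigma> * japanese y2 powr \<sigma>))) *
     (1 + peak \<delta> j \<theta> x * peak \<delta> j \<theta> z)"
proof -
  let ?N = "japanese z" and ?X = "japanese x"
  let ?W = "japanese u1 powr \<sigma> * japanese u2 powr \<sigma> * (japanese y1 powr \<sigma> * japanese y2 powr \<sigma>)"
  let ?J = "peak \<delta> j \<theta> x * peak \<delta> j \<theta> z"
  define \<alpha> where "\<alpha> = 1 / (1 + \<sigma>)"
  have d: "0 < \<delta>" "\<delta> < 1" "\<alpha> * \<sigma> = \<delta>" "\<alpha> + \<delta> = 1"
    using \<sigma> by (auto simp: \<delta> \<alpha>_def field_simps)
  have J0: "0 \<le> ?J" by (simp add: peak_nonneg)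
  have ge1: "1 \<le> japanese v powr \<sigma>" for v
    using \<sigma> japanese_ge_1[of v] by (simp add: ge_one_powr_ge_zero)
  have NX: "?N powr \<sigma> \<le> 2 powr \<sigma> * ?X powr \<sigma>"
    using powr_mono2[OF less_imp_le[OF \<sigma>] _ N] by (simp add: powr_mult)
  have W1: "1 \<le> ?W"
    using ge1 by (intro mult_ge1_I mult_nonneg_nonneg) auto
  have split: "?N powr (\<sigma> + \<delta>) = ?N powr \<sigma> * ?N powr \<delta>" by (rule powr_add)
  have reduce: "?N powr (\<sigma> + \<delta>) \<le> 4 * 2 powr \<sigma> * (?X powr \<sigma> * ?W) * (1 + ?J)" if "?N powr \<delta> \<le> 4 * (?W * (1 + ?J))"
  proof -
    have "?N powr (\<sigma> + \<delta>) \<le> (2 powr \<sigma> * ?X powr \<sigma>) * (4 * (?W * (1 + ?J)))"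
      unfolding split by (intro mult_mono NX that) auto
    then show ?thesis by (simp only: mult_ac)
  qed
  show ?thesis
  proof (cases "\<exists>v\<in>{u1, u2, y1, y2}. ?N powr \<alpha> \<le> japanese v")
    case True
    then obtain v where v: "v \<in> {u1, u2, y1, y2}" "?N powr \<alpha> \<le> japanese v" by blast
    have "?N powr \<delta> = (?N powr \<alpha>) powr \<sigma>" by (simp add: powr_powr d(3))
    also have "\<dots> \<le> japanese v powr \<sigma>"
      using v(2) \<sigma> by (intro powr_mono2) auto
    also have "\<dots> \<le> ?W"
    proof -
      have g: "a \<le> a * (b * (c * d))" if "1 \<le> a" "1 \<le> b" "1 \<le> c" "1 \<le> d" for a b c d :: real
      proof -
        have "1 \<le> b * (c * d)" using that by (intro mult_ge1_I) auto
        then show ?thesis using mult_left_mono[of 1 "b * (c * d)" a] that by simp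
      qed
      consider "v = u1" | "v = u2" | "v = y1" | "v = y2" using v(1) by blast
      then show ?thesis
      proof cases
        case 1
        then show ?thesis using g[OF ge1[of u1] ge1[of u2] ge1[of y1] ge1[of y2]] by (simp only: mult_ac)
      next
        case 2
        then show ?thesis using g[OF ge1[of u2] ge1[of u1] ge1[of y1] ge1[of y2]] by (simp only: mult_ac)
      next
        case 3
        then show ?thesis using g[OF ge1[of y1] ge1[of u1] ge1[of u2] ge1[of y2]] by (simp only: mult_ac)
      next
        case 4
        then show ?thesis using g[OF ge1[of y2] ge1[of u1] ge1[of u2] ge1[of y1]] by (simp only: mult_ac)
      qed
    qed
    also have "\<dots> \<le> 4 * (?W * (1 + ?J))"
    proof -
      have "?W * 1 \<le> ?W * (1 + ?J)" using W1 J0 by (intro mult_left_mono) auto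
      then show ?thesis using W1 by linarith
    qed
    finally show ?thesis by (rule reduce)
  next
    case False
    then have small: "\<bar>u1\<bar> \<le> ?N powr \<alpha>" "\<bar>u2\<bar> \<le> ?N powr \<alpha>" "\<bar>y1\<bar> \<le> ?N powr \<alpha>" "\<bar>y2\<bar> \<le> ?N powr \<alpha>"
      using abs_le_japanese[of u1] abs_le_japanese[of u2] abs_le_japanese[of y1] abs_le_japanese[of y2] by auto
    have WJ: "1 + ?J \<le> ?W * (1 + ?J)"
      using mult_right_mono[OF W1, of "1 + ?J"] J0 by simp
    have N1: "1 \<le> ?N" by (rule japanese_ge_1)
    have "?N powr \<delta> \<le> 4 * (1 + ?J)"
    proof (cases "?N \<ge> 4")
      case False
      \<comment> \<open>For bounded \<langle>z\<rangle> the constant 4 suffices because \<delta> <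
        1.\<close>
      have "?N powr \<delta> \<le> ?N powr 1" using d N1 by (intro powr_mono) auto
      also have "\<dots> \<le> 4" using False by simp
      finally show ?thesis using J0 by simp
    next
      case True
      have ND: "?N = ?N powr \<alpha> * ?N powr \<delta>"
        by (simp add: d(4) flip: powr_add)
      have D1: "1 \<le> ?N powr \<delta>" using N1 d by (simp add: ge_one_powr_ge_zero)
      note geo = rotation_forces_small_entries[OF norm y1 y2 n small ND _ D1 True N]
      have X2: "?X \<le> 2 * ?N" by (rule geo(3)) simp
      have pm: "?X powr e \<le> 2 * ?N powr e" if "0 \<le> e" "e \<le> 1" for e
      proof -
        have "?X powr e \<le> (2 * ?N) powr e" using X2 that by (intro powr_mono2) auto
        also have "\<dots> = 2 powr e * ?N powr e" by (rule powr_mult)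
        also have "\<dots> \<le> 2 powr 1 * ?N powr e" using that by (intro mult_right_mono powr_mono) auto
        finally show ?thesis by simp
      qed
      have pm': "?N powr e \<le> 2 * ?X powr e" if "0 \<le> e" "e \<le> 1" for e
      proof -
        have "?N powr e \<le> (2 * ?X) powr e" using N that by (intro powr_mono2) auto
        also have "\<dots> = 2 powr e * ?X powr e" by (rule powr_mult)
        also have "\<dots> \<le> 2 powr 1 * ?X powr e" using that by (intro mult_right_mono powr_mono) auto
        finally show ?thesis by simp
      qed
      have e1: "12 / ?N powr \<delta> \<le> 24 * ?N powr - \<delta>" by (simp add: powr_minus divide_inverse)
      \<comment> \<open>The origin of 24: rewriting the threshold 12 / \<langle>z\<rangle>^\<delta>
        in terms of x costs a factor 2, since \<langle>x\<rangle> \<le> 2 \<langle>z\<rangle>. With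
        both thresholds met, both peaks are active.\<close>
      have e2: "12 / ?N powr \<delta> \<le> 24 * ?X powr - \<delta>"
        using pm[of \<delta>] d by (simp add: powr_minus field_simps)
      have "\<bar>rot_b (\<theta> + tau j)\<bar> \<le> 12 / ?N powr \<delta>" "\<bar>rot_c (\<theta> + tau j)\<bar> \<le> 12 / ?N powr \<delta>"
        using geo(1,2) by simp_all
      then have "?J = ?X powr (\<delta> / 2) * ?N powr (\<delta> / 2)"
        using e1 e2 by (simp add: peak_def)
      \<comment> \<open>One half power of \<langle>z\<rangle> is exchanged for the comparable power
        of \<langle>x\<rangle>, so that each triple carries its own peak.\<close>
      moreover have "?N powr (\<delta> / 2) * ?N powr (\<delta> / 2) \<le> 2 * ?X powr (\<delta> / 2) * ?N powr (\<delta> / 2)"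
        using pm'[of "\<delta> / 2"] d by (intro mult_right_mono) auto
      ultimately have "?N powr \<delta> \<le> 2 * ?J"
        by (simp add: powr_half_mult)
      then show ?thesis using J0 by simp
    qed
    also have "\<dots> \<le> 4 * (?W * (1 + ?J))" using WJ by simp
    finally show ?thesis by (rule reduce)
  qed
qed

text \<open>The rotation preserves length, so \<langle>z\<rangle>^2 is at most the sum of the three
  squared weights of the rotated variables, and one of these weights is at least half of
  \<langle>z\<rangle>. Which one depends on the point, hence the sum over j.\<close>

lemma weight_le:
  fixes \<sigma> \<delta> :: real
  assumes \<sigma>: "\<sigma> > 0" and \<delta>: "\<delta> = \<sigma> / (1 + \<sigma>)"
  shows "japanese (coord 5 p) powr (\<sigma> + \<delta>) \<le> 4 * 2 powr \<sigma> * (\<Prod>i<5. japanese (coord i p) powr \<sigma>) *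
     (1 + (\<Sum>j<3. peak \<delta> j (fst (snd p)) (coord j p) * peak \<delta> j (fst (snd p)) (coord 5 p)))"
proof -
  obtain z \<theta> y1 y2 where p: "p = (z, \<theta>, y1, y2)" by (cases p) auto
  let ?a = "rot_a \<theta>" and ?b = "rot_b \<theta>" and ?c = "rot_c \<theta>"
  define x0 where "x0 = ?a * z + ?b * y1 + ?c * y2"
  define x1 where "x1 = ?c * z + ?a * y1 + ?b * y2"
  define x2 where "x2 = ?b * z + ?c * y1 + ?a * y2"
  note sq = rot_square_sum[of \<theta>] rot_product_sum[of \<theta>]
  have norm: "x0\<^sup>2 + x1\<^sup>2 + x2\<^sup>2 = z\<^sup>2 + y1\<^sup>2 + y2\<^sup>2"
    unfolding x0_def x1_def x2_def by (rule rot_transpose[OF sq])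
  \<comment> \<open>The inverse rotation is the transpose. The coefficients of each rotated variable
    in these two equations are \<open>rot_b\<close> and \<open>rot_c\<close> at the angle shifted by
    \<open>tau\<close>.\<close>
  have inv: "y1 = ?b * x0 + ?a * x1 + ?c * x2" "y2 = ?c * x0 + ?b * x1 + ?a * x2"
  proof -
    have "?b * x0 + ?a * x1 + ?c * x2 = (?a * ?a + ?b * ?b + ?c * ?c) * y1 + (?a * ?b + ?b * ?c + ?c * ?a) * z + (?a * ?b + ?b * ?c + ?c * ?a) * y2"
      unfolding x0_def x1_def x2_def by (simp add: algebra_simps)
    then show "y1 = ?b * x0 + ?a * x1 + ?c * x2" by (simp add: sq)
    have "?c * x0 + ?b * x1 + ?a * x2 = (?a * ?a + ?b * ?b + ?c * ?c) * y2 + (?a * ?b + ?b * ?c + ?c * ?a) * z + (?a * ?b + ?b * ?c + ?c * ?a) * y1"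
      unfolding x0_def x1_def x2_def by (simp add: algebra_simps)
    then show "y2 = ?c * x0 + ?b * x1 + ?a * x2" by (simp add: sq)
  qed
  let ?J = "\<lambda>j x. peak \<delta> j \<theta> x * peak \<delta> j \<theta> z"
  let ?P = "japanese x0 powr \<sigma> * japanese x1 powr \<sigma> * japanese x2 powr \<sigma> * japanese y1 powr \<sigma> * japanese y2 powr \<sigma>"
  have J0: "0 \<le> ?J j x" for j x by (simp add: peak_nonneg)
  have P0: "0 \<le> ?P" by simp
  have tot: "japanese z powr (\<sigma> + \<delta>) \<le> 4 * 2 powr \<sigma> * ?P * (1 + (?J 0 x0 + ?J 1 x1 + ?J 2 x2))"
    if "japanese z powr (\<sigma> + \<delta>) \<le> 4 * 2 powr \<sigma> * ?P * (1 + k)" "k \<le> ?J 0 x0 + ?J 1 x1 + ?J 2 x2" for k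
  proof -
    have "4 * 2 powr \<sigma> * ?P * (1 + k) \<le> 4 * 2 powr \<sigma> * ?P * (1 + (?J 0 x0 + ?J 1 x1 + ?J 2 x2))"
      using that(2) P0 by (intro mult_left_mono) auto
    then show ?thesis using that(1) by linarith
  qed
  have "(japanese z)\<^sup>2 \<le> (japanese x0)\<^sup>2 + (japanese x1)\<^sup>2 + (japanese x2)\<^sup>2"
    using norm zero_le_power2[of y1] zero_le_power2[of y2] unfolding japanese_square by linarith
  then have "(japanese z)\<^sup>2 \<le> 4 * (japanese x0)\<^sup>2 \<or> (japanese z)\<^sup>2 \<le> 4 * (japanese x1)\<^sup>2 \<or> (japanese z)\<^sup>2 \<le> 4 * (japanese x2)\<^sup>2"
    by (smt (verit) zero_le_power2)
  then have "(japanese z)\<^sup>2 \<le> (2 * japanese x0)\<^sup>2 \<or> (japanese z)\<^sup>2 \<le> (2 * japanese x1)\<^sup>2 \<or> (japanese z)\<^sup>2 \<le> (2 * japanese x2)\<^sup>2"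
    by (simp add: power_mult_distrib)
  then consider "japanese z \<le> 2 * japanese x0" | "japanese z \<le> 2 * japanese x1" | "japanese z \<le> 2 * japanese x2"
    using power2_le_imp_le[of "japanese z"] by (metis japanese_nonneg mult_nonneg_nonneg zero_le_numeral)
  then have "japanese z powr (\<sigma> + \<delta>) \<le> 4 * 2 powr \<sigma> * ?P * (1 + (?J 0 x0 + ?J 1 x1 + ?J 2 x2))"
  proof cases
    case 1
    have "japanese z powr (\<sigma> + \<delta>) \<le> 4 * 2 powr \<sigma> *
       (japanese x0 powr \<sigma> * (japanese x1 powr \<sigma> * japanese x2 powr \<sigma> * (japanese y1 powr \<sigma> * japanese y2 powr \<sigma>))) * (1 + ?J 0 x0)"
      by (rule weight_le_slot[OF \<sigma> \<delta> _ _ _ rot_bound(1) rot_bound(3) rot_bound(2) rot_bound(1) 1])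
        (use norm inv in \<open>simp_all add: tau_def\<close>)
    then show ?thesis using J0 by (intro tot[of "?J 0 x0"]) (simp_all add: mult_ac)
  next
    case 2
    have "japanese z powr (\<sigma> + \<delta>) \<le> 4 * 2 powr \<sigma> *
       (japanese x1 powr \<sigma> * (japanese x0 powr \<sigma> * japanese x2 powr \<sigma> * (japanese y1 powr \<sigma> * japanese y2 powr \<sigma>))) * (1 + ?J 1 x1)"
      by (rule weight_le_slot[OF \<sigma> \<delta> _ _ _ rot_bound(2) rot_bound(3) rot_bound(3) rot_bound(1) 2])
        (use norm inv in \<open>simp_all add: tau_def rot_shift\<close>)
    then show ?thesis using J0 by (intro tot[of "?J 1 x1"]) (simp_all add: mult_ac)
  next
    case 3
    have "japanese z powr (\<sigma> + \<delta>) \<le> 4 * 2 powr \<sigma> *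
       (japanese x2 powr \<sigma> * (japanese x0 powr \<sigma> * japanese x1 powr \<sigma> * (japanese y1 powr \<sigma> * japanese y2 powr \<sigma>))) * (1 + ?J 2 x2)"
      by (rule weight_le_slot[OF \<sigma> \<delta> _ _ _ rot_bound(2) rot_bound(1) rot_bound(3) rot_bound(2) 3])
        (use norm inv rot_shift(3,4)[of \<theta>] in \<open>simp_all add: tau_def\<close>)
    then show ?thesis using J0 by (intro tot[of "?J 2 x2"]) (simp_all add: mult_ac)
  qed
  moreover have "(\<Prod>i<5. japanese (coord i p) powr \<sigma>) = ?P"
    by (simp add: eval_nat_numeral) (simp add: numeral_eq_Suc[symmetric] p coord_def rot_def x0_def x1_def x2_def)
  moreover have "(\<Sum>j<3. peak \<delta> j (fst (snd p)) (coord j p) * peak \<delta> j (fst (snd p)) (coord 5 p)) = ?J 0 x0 + ?J 1 x1 + ?J 2 x2"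
    by (simp add: eval_nat_numeral) (simp add: p coord_def rot_def x0_def x1_def x2_def numeral_2_eq_2)
  ultimately show ?thesis by (simp add: p coord_simps)
qed

section \<open>Duality\<close>

lemma ennreal_square_le:
  fixes x :: ennreal
  assumes "x\<^sup>2 \<le> ennreal (y\<^sup>2)" "0 \<le> y"
  shows "x \<le> ennreal y"
proof (cases x)
  case (real r)
  then have "ennreal (r\<^sup>2) \<le> ennreal (y\<^sup>2)" using assms(1) by (simp add: ennreal_power)
  then have "r\<^sup>2 \<le> y\<^sup>2" by simp
  then have "r \<le> y" using assms(2) by (rule power2_le_imp_le)
  then show ?thesis using real by (simp add: ennreal_leI)
next
  case top
  then show ?thesis using assms(1) by (simp add: power2_eq_square top_unique)
qed

text \<open>The factors are grouped so that each square contains one triple and one kernel whose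
  coordinate belongs to that triple; the two slot lemmas then integrate the kernel over the
  angle.\<close>

lemma peak_Cauchy_Schwarz:
  fixes G :: "nat \<Rightarrow> real \<Rightarrow> ennreal" and I :: "nat \<Rightarrow> real"
  assumes mk [measurable]: "k \<in> borel_measurable (borel \<Otimes>\<^sub>M borel)"
    and mG: "\<And>i. i < 6 \<Longrightarrow> G i \<in> borel_measurable borel"
    and k: "\<And>x. (\<integral>\<^sup>+\<theta>. (k (\<theta>, x))\<^sup>2 \<partial>lborel_on (-pi) pi) \<le> ennreal 1152" and j: "j < 3"
    and I: "\<And>i. i < 6 \<Longrightarrow> (\<integral>\<^sup>+x. (G i x)\<^sup>2 \<partial>lborel) = ennreal (I i)" "\<And>i. 0 \<le> I i"
  shows "(\<integral>\<^sup>+p. (k (fst (snd p), coord j p) * (G 0 (coord 0 p) * (G 1 (coord 1 p) * G 2 (coord 2 p)))) *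
       (k (fst (snd p), coord 5 p) * (G 5 (coord 5 p) * (G 3 (coord 3 p) * G 4 (coord 4 p)))) \<partial>rot_space)
    \<le> ennreal (1152 * sqrt (I 0 * (I 1 * I 2) * (I 5 * (I 3 * I 4))))"
    (is "nn_integral _ (\<lambda>p. ?P p * ?Q p) \<le> _")
proof (rule ennreal_square_le)
  define g0 g1 g2 g3 g4 g5 where g_def: "g0 = G 0" "g1 = G 1" "g2 = G 2" "g3 = G 3" "g4 = G 4" "g5 = G 5"
  have [measurable]: "g0 \<in> borel_measurable borel" "g1 \<in> borel_measurable borel" "g2 \<in> borel_measurable borel"
    "g3 \<in> borel_measurable borel" "g4 \<in> borel_measurable borel" "g5 \<in> borel_measurable borel"
    using mG by (auto simp: g_def)
  have Ig: "(\<integral>\<^sup>+x. (g0 x)\<^sup>2 \<partial>lborel) = ennreal (I 0)" "(\<integral>\<^sup>+x. (g1 x)\<^sup>2 \<partial>lborel) = ennreal (I 1)"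
    "(\<integral>\<^sup>+x. (g2 x)\<^sup>2 \<partial>lborel) = ennreal (I 2)" "(\<integral>\<^sup>+x. (g3 x)\<^sup>2 \<partial>lborel) = ennreal (I 3)"
    "(\<integral>\<^sup>+x. (g4 x)\<^sup>2 \<partial>lborel) = ennreal (I 4)" "(\<integral>\<^sup>+x. (g5 x)\<^sup>2 \<partial>lborel) = ennreal (I 5)"
    unfolding g_def by (rule I(1); simp)+
  have mP: "?P \<in> borel_measurable rot_space" and mQ: "?Q \<in> borel_measurable rot_space"
    unfolding g_def[symmetric] by measurable
  have k2: "(\<lambda>p. (k p)\<^sup>2) \<in> borel_measurable (borel \<Otimes>\<^sub>M borel)" by measurable
  have P: "(\<integral>\<^sup>+p. (?P p)\<^sup>2 \<partial>rot_space) \<le> ennreal 1152 * (ennreal (I 0) * (ennreal (I 1) * ennreal (I 2)))"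
    using nn_integral_rot_slots[of "\<lambda>x. (g0 x)\<^sup>2" "\<lambda>x. (g1 x)\<^sup>2" "\<lambda>x. (g2 x)\<^sup>2" "\<lambda>p. (k p)\<^sup>2" "ennreal 1152" j] k2 k j
    unfolding Ig g_def[symmetric] power_mult_distrib by simp
  have Q: "(\<integral>\<^sup>+p. (?Q p)\<^sup>2 \<partial>rot_space) \<le> ennreal 1152 * (ennreal (I 5) * (ennreal (I 3) * ennreal (I 4)))"
    using nn_integral_base_slots[of "\<lambda>x. (g5 x)\<^sup>2" "\<lambda>x. (g3 x)\<^sup>2" "\<lambda>x. (g4 x)\<^sup>2" "\<lambda>p. (k p)\<^sup>2" "ennreal 1152"] k2 k
    unfolding Ig g_def[symmetric] power_mult_distrib by simp
  have "(\<integral>\<^sup>+p. ?P p * ?Q p \<partial>rot_space)\<^sup>2 \<le> (\<integral>\<^sup>+p. (?P p)\<^sup>2 \<partial>rot_space) * (\<integral>\<^sup>+p. (?Q p)\<^sup>2 \<partial>rot_space)"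
    by (rule Cauchy_Schwarz_nn_integral[OF mP mQ])
  also have "\<dots> \<le> (ennreal 1152 * (ennreal (I 0) * (ennreal (I 1) * ennreal (I 2)))) *
      (ennreal 1152 * (ennreal (I 5) * (ennreal (I 3) * ennreal (I 4))))"
    by (intro mult_mono P Q) auto
  also have "\<dots> = ennreal ((1152 * (I 0 * (I 1 * I 2))) * (1152 * (I 5 * (I 3 * I 4))))"
    using I(2) by (simp only: ennreal_mult mult_nonneg_nonneg zero_le_numeral)
  also have "(1152 * (I 0 * (I 1 * I 2))) * (1152 * (I 5 * (I 3 * I 4))) = (1152 * sqrt (I 0 * (I 1 * I 2) * (I 5 * (I 3 * I 4))))\<^sup>2"
    using I(2) by (simp add: power_mult_distrib)
  finally show "(\<integral>\<^sup>+p. ?P p * ?Q p \<partial>rot_space)\<^sup>2 \<le> ennreal ((1152 * sqrt (I 0 * (I 1 * I 2) * (I 5 * (I 3 * I 4))))\<^sup>2)" .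
qed (use I(2) in simp)

definition five_slots :: "(nat \<Rightarrow> real \<Rightarrow> complex) \<Rightarrow> real \<times> real \<times> real \<times> real \<Rightarrow> complex" where
  "five_slots F p = (\<Prod>i<5. cnj_slot i (F i (coord i p)))"

lemma measurable_five_slots:
  assumes "\<And>i. i < 5 \<Longrightarrow> F i \<in> borel_measurable borel"
  shows "five_slots F \<in> borel_measurable (borel \<Otimes>\<^sub>M (borel \<Otimes>\<^sub>M (borel \<Otimes>\<^sub>M borel)))"
  unfolding five_slots_def[abs_def]
proof (rule borel_measurable_prod)
  fix i :: nat assume "i \<in> {..<5}"
  then have [measurable]: "F i \<in> borel_measurable borel" using assms by simp
  show "(\<lambda>p. cnj_slot i (F i (coord i p))) \<in> borel_measurable (borel \<Otimes>\<^sub>M (borel \<Otimes>\<^sub>M (borel \<Otimes>\<^sub>M borel)))"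
    by measurable
qed

lemma rot_density_five_slots: "rot_density F p = five_slots F p * cnj (F 5 (coord 5 p))"
proof -
  have "{..<6::nat} = insert 5 {..<5}" by auto
  then show ?thesis by (simp add: rot_density_def five_slots_def cnj_slot_def mult.commute)
qed

lemma prod_lessThan_5: "(\<Prod>i<5. f i) = f 0 * f 1 * f 2 * f 3 * (f (4::nat) :: 'a :: comm_monoid_mult)"
  by (simp add: eval_nat_numeral mult.assoc)

lemma norm_weighted: "norm (weighted \<sigma> f x) = japanese x powr \<sigma> * norm (f x)"
  by (simp add: weighted_def norm_mult)

text \<open>The weight inequality leaves four terms, three with peaks and one without. The last is
  treated as a kernel equal to 1, whose angular integral 2 pi is below 1152, so
  \<open>peak_Cauchy_Schwarz\<close> covers all four.\<close>

lemma weighted_five_slots_bound: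
  fixes \<sigma> \<delta> :: real
  assumes \<sigma>: "\<sigma> > 0" and \<delta>: "\<delta> = \<sigma> / (1 + \<sigma>)"
    and mF: "\<And>i. i < 5 \<Longrightarrow> F i \<in> borel_measurable borel"
    and F: "\<And>i. i < 5 \<Longrightarrow> square_integrable lborel (weighted \<sigma> (F i))" and g: "square_integrable lborel g"
  shows "(\<integral>\<^sup>+p. ennreal (norm (five_slots F p)) * ennreal (japanese (coord 5 p) powr (\<sigma> + \<delta>)) * ennreal (norm (g (coord 5 p))) \<partial>rot_space)
    \<le> ennreal (4 * 2 powr \<sigma> * 4608 * sqrt ((\<Prod>i<5. sqnorm (weighted \<sigma> (F i))) * sqnorm g))"
proof -
  define f where "f i = (if i < 5 then weighted \<sigma> (F i) else g)" for i :: nat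
  define G where "G i x = ennreal (norm (f i x))" for i x
  define I where "I i = sqnorm (f i)" for i
  have f: "square_integrable lborel (f i)" if "i < 6" for i
    using that F g by (simp add: f_def)
  have mG: "G i \<in> borel_measurable borel" if "i < 6" for i
  proof -
    have [measurable]: "f i \<in> borel_measurable borel" using f[OF that] by (simp add: square_integrable_def)
    show ?thesis unfolding G_def[abs_def] by measurable
  qed
  have GI: "(\<integral>\<^sup>+x. (G i x)\<^sup>2 \<partial>lborel) = ennreal (I i)" if "i < 6" for i
    unfolding G_def I_def by (simp add: ennreal_power nn_integral_square[OF f[OF that]])
  have I0: "0 \<le> I i" for i by (simp add: I_def)
  define K where "K j q = (if j < 3 then ennreal (peak \<delta> j (fst q) (snd q)) else 1)" for j :: nat and q :: "real \<times> real"
  \<comment> \<open>For j = 3 the kernel is constant, and coordinate 0 is an arbitrary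
    choice.\<close>
  define s where "s j = (if j < 3 then j else 0)" for j :: nat
  have mK: "K j \<in> borel_measurable (borel \<Otimes>\<^sub>M borel)" for j
    unfolding K_def[abs_def] by (cases "j < 3") auto
  have Kint: "(\<integral>\<^sup>+\<theta>. (K j (\<theta>, x))\<^sup>2 \<partial>lborel_on (-pi) pi) \<le> ennreal 1152" for j x
  proof (cases "j < 3")
    case True
    then show ?thesis using integral_peak_square[of \<delta> j x] by (simp add: K_def ennreal_power peak_nonneg)
  next
    case False
    have "ennreal (pi * 2) \<le> ennreal 1152" using pi_less_4 by (intro ennreal_leI) simp
    then show ?thesis using False by (simp add: K_def emeasure_lborel_on mult.commute)
  qed
  define T where "T j p = (K j (fst (snd p), coord (s j) p) * (G 0 (coord 0 p) * (G 1 (coord 1 p) * G 2 (coord 2 p)))) *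
       (K j (fst (snd p), coord 5 p) * (G 5 (coord 5 p) * (G 3 (coord 3 p) * G 4 (coord 4 p))))" for j p
  have mT: "T j \<in> borel_measurable rot_space" for j
  proof -
    define g0 g1 g2 g3 g4 g5 where g_def: "g0 = G 0" "g1 = G 1" "g2 = G 2" "g3 = G 3" "g4 = G 4" "g5 = G 5"
    have [measurable]: "g0 \<in> borel_measurable borel" "g1 \<in> borel_measurable borel" "g2 \<in> borel_measurable borel"
      "g3 \<in> borel_measurable borel" "g4 \<in> borel_measurable borel" "g5 \<in> borel_measurable borel"
      using mG by (auto simp: g_def)
    define k where "k = K j"
    have [measurable]: "k \<in> borel_measurable (borel \<Otimes>\<^sub>M borel)" unfolding k_def by (rule mK)
    show ?thesis unfolding T_def[abs_def] g_def[symmetric] k_def[symmetric] by measurable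
  qed
  have Tint: "(\<integral>\<^sup>+p. T j p \<partial>rot_space) \<le> ennreal (1152 * sqrt (I 0 * (I 1 * I 2) * (I 5 * (I 3 * I 4))))" for j
    unfolding T_def by (rule peak_Cauchy_Schwarz[OF mK mG Kint _ GI I0]) (auto simp: s_def)
  have pt: "ennreal (norm (five_slots F p)) * ennreal (japanese (coord 5 p) powr (\<sigma> + \<delta>)) * ennreal (norm (g (coord 5 p)))
     \<le> ennreal (4 * 2 powr \<sigma>) * (\<Sum>j<4. T j p)" for p
  proof -
    define n where "n i = norm (f i (coord i p))" for i
    define J where "J j = (if j < 3 then peak \<delta> j (fst (snd p)) (coord j p) * peak \<delta> j (fst (snd p)) (coord 5 p) else 1)" for j :: nat
    have n0: "0 \<le> n i" and J0: "0 \<le> J j" for i j by (auto simp: n_def J_def peak_nonneg)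
    define S where "S = (\<Sum>j<3. peak \<delta> j (fst (snd p)) (coord j p) * peak \<delta> j (fst (snd p)) (coord 5 p))"
    have S: "(\<Sum>j<4. J j) = 1 + S"
    proof -
      have "{..<4::nat} = insert 3 {..<3}" by auto
      then show ?thesis by (simp add: J_def S_def)
    qed
    have five: "norm (five_slots F p) * (\<Prod>i<5. japanese (coord i p) powr \<sigma>) = (\<Prod>i<5. n i)"
      unfolding five_slots_def prod_norm[symmetric] prod.distrib[symmetric]
      by (intro prod.cong) (auto simp: n_def f_def norm_weighted)
    have T: "T j p = ennreal (J j * ((\<Prod>i<5. n i) * n 5))" for j
    proof -
      have "T j p = ennreal ((if j < 3 then peak \<delta> j (fst (snd p)) (coord j p) else 1) * (n 0 * (n 1 * n 2)) *
         ((if j < 3 then peak \<delta> j (fst (snd p)) (coord 5 p) else 1) * (n 5 * (n 3 * n 4))))"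
        by (cases "j < 3") (simp_all add: T_def K_def s_def G_def n_def ennreal_mult peak_nonneg)
      also have "(if j < 3 then peak \<delta> j (fst (snd p)) (coord j p) else 1) * (n 0 * (n 1 * n 2)) *
         ((if j < 3 then peak \<delta> j (fst (snd p)) (coord 5 p) else 1) * (n 5 * (n 3 * n 4))) = J j * ((\<Prod>i<5. n i) * n 5)"
        by (simp add: J_def prod_lessThan_5 mult_ac)
      finally show ?thesis .
    qed
    have "norm (five_slots F p) * japanese (coord 5 p) powr (\<sigma> + \<delta>) * norm (g (coord 5 p)) \<le>
       norm (five_slots F p) * (4 * 2 powr \<sigma> * (\<Prod>i<5. japanese (coord i p) powr \<sigma>) * (1 + S)) * norm (g (coord 5 p))"
      unfolding S_def by (intro mult_right_mono mult_left_mono weight_le[OF \<sigma> \<delta>]) auto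
    also have "\<dots> = 4 * 2 powr \<sigma> * ((norm (five_slots F p) * (\<Prod>i<5. japanese (coord i p) powr \<sigma>)) * n 5 * (1 + S))"
      by (simp add: n_def f_def mult_ac)
    also have "\<dots> = 4 * 2 powr \<sigma> * (\<Sum>j<4. J j * ((\<Prod>i<5. n i) * n 5))"
      unfolding five sum_distrib_right[symmetric] S by (simp add: mult_ac)
    finally have "ennreal (norm (five_slots F p) * japanese (coord 5 p) powr (\<sigma> + \<delta>) * norm (g (coord 5 p))) \<le>
       ennreal (4 * 2 powr \<sigma> * (\<Sum>j<4. J j * ((\<Prod>i<5. n i) * n 5)))"
      by (rule ennreal_leI)
    also have "\<dots> = ennreal (4 * 2 powr \<sigma>) * (\<Sum>j<4. T j p)"
    proof -
      have nn: "0 \<le> J j * ((\<Prod>i<5. n i) * n 5)" for j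
        by (intro mult_nonneg_nonneg prod_nonneg n0 J0 ballI)
      have "(\<Sum>j<4. T j p) = ennreal (\<Sum>j<4. J j * ((\<Prod>i<5. n i) * n 5))"
        unfolding T by (intro sum_ennreal nn)
      then show ?thesis using nn by (simp add: ennreal_mult sum_nonneg)
    qed
    finally show ?thesis by (simp add: ennreal_mult)
  qed
  have "(\<integral>\<^sup>+p. ennreal (norm (five_slots F p)) * ennreal (japanese (coord 5 p) powr (\<sigma> + \<delta>)) * ennreal (norm (g (coord 5 p))) \<partial>rot_space)
    \<le> (\<integral>\<^sup>+p. ennreal (4 * 2 powr \<sigma>) * (\<Sum>j<4. T j p) \<partial>rot_space)"
    by (intro nn_integral_mono pt)
  also have "\<dots> = ennreal (4 * 2 powr \<sigma>) * (\<integral>\<^sup>+p. (\<Sum>j<4. T j p) \<partial>rot_space)"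
    by (intro nn_integral_cmult borel_measurable_sum mT)
  also have "(\<integral>\<^sup>+p. (\<Sum>j<4. T j p) \<partial>rot_space) = (\<Sum>j<4. \<integral>\<^sup>+p. T j p \<partial>rot_space)"
    by (intro nn_integral_sum mT)
  also have "\<dots> \<le> (\<Sum>j<4::nat. ennreal (1152 * sqrt (I 0 * (I 1 * I 2) * (I 5 * (I 3 * I 4)))))"
    by (intro sum_mono Tint)
  also have "\<dots> = ennreal (4608 * sqrt (I 0 * (I 1 * I 2) * (I 5 * (I 3 * I 4))))"
    using I0 by (subst sum_ennreal) auto
  also have "ennreal (4 * 2 powr \<sigma>) * \<dots> = ennreal (4 * 2 powr \<sigma> * 4608 * sqrt (I 0 * (I 1 * I 2) * (I 5 * (I 3 * I 4))))"
    using I0 by (subst ennreal_mult[symmetric]) (auto simp: mult_ac)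
  also have "I 0 * (I 1 * I 2) * (I 5 * (I 3 * I 4)) = (\<Prod>i<5. sqnorm (weighted \<sigma> (F i))) * sqnorm g"
    by (simp add: I_def f_def prod_lessThan_5 mult_ac)
  finally show ?thesis by (simp add: mult_left_mono)
qed

text \<open>Testing with truncations of \<open>u\<close> itself bounds their norms by C, and Fatou's
  lemma passes to \<open>u\<close>. A priori \<open>u\<close> may be infinite; testing with
  indicators of bounded intervals excludes this almost everywhere.\<close>

lemma square_integral_le_by_duality:
  fixes u :: "real \<Rightarrow> ennreal"
  assumes [measurable]: "u \<in> borel_measurable borel" and C: "0 \<le> C"
    and dual: "\<And>g. square_integrable lborel g \<Longrightarrow> (\<integral>\<^sup>+x. u x * ennreal (norm (g x)) \<partial>lborel) \<le> ennreal (C * sqrt (sqnorm g))"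
  shows "(\<integral>\<^sup>+x. (u x)\<^sup>2 \<partial>lborel) \<le> ennreal (C\<^sup>2)"
proof -
  have ind: "integrable lborel (\<lambda>x. c * indicator {-real n..real n} x :: real)" for c n
    by (intro integrable_mult_right integrable_real_indicator) auto
  have "AE x in lborel. \<forall>n. u x * ennreal (norm (complex_of_real (indicator {-real n..real n} x))) \<noteq> \<infinity>"
  proof (subst AE_all_countable, intro allI nn_integral_noteq_infinite)
    fix n
    have "square_integrable lborel (\<lambda>x. complex_of_real (indicator {-real n..real n} x))"
      by (rule square_integrable_bound[OF ind[of 1 n]]) (auto simp: indicator_def)
    from dual[OF this] show "(\<integral>\<^sup>+x. u x * ennreal (norm (complex_of_real (indicator {-real n..real n} x))) \<partial>lborel) \<noteq> \<infinity>"
      by (auto simp: top_unique)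
  qed measurable
  then have fin: "AE x in lborel. u x \<noteq> \<infinity>"
  proof eventually_elim
    fix x assume *: "\<forall>n. u x * ennreal (norm (complex_of_real (indicator {-real n..real n} x))) \<noteq> \<infinity>"
    obtain n where "\<bar>x\<bar> \<le> real n" using real_arch_simple by blast
    then have "indicator {-real n..real n} x = (1::real)" by (auto simp: abs_le_iff)
    then show "u x \<noteq> \<infinity>" using *[rule_format, of n] by simp
  qed
  define r where "r x = enn2real (u x)" for x
  have [measurable]: "r \<in> borel_measurable borel" unfolding r_def[abs_def] by measurable
  have r0: "0 \<le> r x" for x by (simp add: r_def)
  have ur: "AE x in lborel. u x = ennreal (r x)"
    using fin by eventually_elim (simp add: r_def less_top)
  \<comment> \<open>Cut off in height and in support, so that it is square-integrable and may serve
    as a test function.\<close>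
  define g where "g n x = (if \<bar>x\<bar> \<le> real n \<and> r x \<le> real n then r x else 0)" for n x
  have [measurable]: "g n \<in> borel_measurable borel" for n unfolding g_def[abs_def] by measurable
  have g0: "0 \<le> g n x" for n x by (simp add: g_def r0)
  have sg: "square_integrable lborel (\<lambda>x. complex_of_real (g n x))" for n
    by (rule square_integrable_bound[OF ind[of "(real n)\<^sup>2" n]]) (auto simp: g_def indicator_def r0 abs_le_iff intro!: power_mono)
  have gb: "(\<integral>\<^sup>+x. ennreal ((g n x)\<^sup>2) \<partial>lborel) \<le> ennreal (C\<^sup>2)" for n
  proof -
    define I where "I = sqnorm (\<lambda>x. complex_of_real (g n x))"
    have I0: "0 \<le> I" by (simp add: I_def)
    have eq: "(\<integral>\<^sup>+x. ennreal ((g n x)\<^sup>2) \<partial>lborel) = ennreal I"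
      using nn_integral_square[OF sg[of n]] by (simp add: I_def)
    have "(\<integral>\<^sup>+x. u x * ennreal (norm (complex_of_real (g n x))) \<partial>lborel) = (\<integral>\<^sup>+x. ennreal ((g n x)\<^sup>2) \<partial>lborel)"
      using ur by (intro nn_integral_cong_AE, eventually_elim) (auto simp: g_def ennreal_mult[symmetric] r0 power2_eq_square)
    then have "ennreal I \<le> ennreal (C * sqrt I)"
      using dual[OF sg[of n]] by (simp add: eq I_def)
    then have "I \<le> C * sqrt I" using C I0 by simp
    then have "sqrt I * sqrt I \<le> C * sqrt I" using I0 by simp
    then have "sqrt I \<le> C"
    proof (cases "I = 0")
      case False
      assume "sqrt I * sqrt I \<le> C * sqrt I"
      then show ?thesis by (rule mult_right_le_imp_le) (use False I0 in simp)
    qed (use C in simp)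
    then have "(sqrt I)\<^sup>2 \<le> C\<^sup>2" using I0 by (intro power_mono) auto
    then show ?thesis unfolding eq using I0 by (simp add: ennreal_leI)
  qed
  have "(\<integral>\<^sup>+x. (u x)\<^sup>2 \<partial>lborel) \<le> (\<integral>\<^sup>+x. liminf (\<lambda>n. ennreal ((g n x)\<^sup>2)) \<partial>lborel)"
  proof (rule nn_integral_mono_AE)
    show "AE x in lborel. (u x)\<^sup>2 \<le> liminf (\<lambda>n. ennreal ((g n x)\<^sup>2))"
      using ur
    proof eventually_elim
      fix x assume ux: "u x = ennreal (r x)"
      obtain n where n: "max \<bar>x\<bar> (r x) \<le> real n" using real_arch_simple by blast
      have "\<forall>\<^sub>F m in sequentially. ennreal ((g m x)\<^sup>2) = (u x)\<^sup>2"
      proof (rule eventually_sequentiallyI[of n])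
        fix m assume "n \<le> m"
        then have "real n \<le> real m" by simp
        then have "\<bar>x\<bar> \<le> real m" "r x \<le> real m" using n by auto
        then show "ennreal ((g m x)\<^sup>2) = (u x)\<^sup>2" by (simp add: g_def ux ennreal_power r0)
      qed
      then have "(\<lambda>m. ennreal ((g m x)\<^sup>2)) \<longlonglongrightarrow> (u x)\<^sup>2" by (rule tendsto_eventually)
      then show "(u x)\<^sup>2 \<le> liminf (\<lambda>n. ennreal ((g n x)\<^sup>2))"
        using lim_imp_Liminf[of sequentially "\<lambda>m. ennreal ((g m x)\<^sup>2)"] by simp
    qed
  qed
  also have "\<dots> \<le> liminf (\<lambda>n. \<integral>\<^sup>+x. ennreal ((g n x)\<^sup>2) \<partial>lborel)"
    by (rule nn_integral_liminf) measurable
  also have "\<dots> \<le> ennreal (C\<^sup>2)"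
    by (rule Liminf_le) (auto intro!: always_eventually gb)
  finally show ?thesis .
qed

section \<open>The function that represents the rotation form in its last slot\<close>

definition slot_space :: "(real \<times> real \<times> real) measure" where
  "slot_space = lborel_on (-pi) pi \<Otimes>\<^sub>M (lborel \<Otimes>\<^sub>M lborel)"

lemma sets_slot_space [simp, measurable_cong]: "sets slot_space = sets (borel \<Otimes>\<^sub>M (borel \<Otimes>\<^sub>M borel))"
  unfolding slot_space_def by (intro sets_pair_measure_cong) auto

lemma sigma_finite_slot_space: "sigma_finite_measure slot_space"
  unfolding slot_space_def by (rule sigma_finite_pair_measure[OF sigma_finite_lborel_on sigma_finite_lborel2])

lemma pair_sigma_finite_rot: "pair_sigma_finite (lborel :: real measure) slot_space"
  by (simp add: pair_sigma_finite_def sigma_finite_lborel sigma_finite_slot_space)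

lemma rot_space_eq: "rot_space = lborel \<Otimes>\<^sub>M slot_space"
  by (simp add: rot_space_def slot_space_def)

text \<open>The integral over everything but z. By Fubini's theorem the rotation form is its inner
  product with the last function, so a constant multiple of it is the candidate for the
  operator.\<close>

definition rot_dual :: "(nat \<Rightarrow> real \<Rightarrow> complex) \<Rightarrow> real \<Rightarrow> complex" where
  "rot_dual F z = (\<integral>q. five_slots F (z, q) \<partial>slot_space)"

lemma coord_5: "coord 5 (z, q) = z"
  by (cases q) (simp add: coord_simps)

lemma measurable_rot_dual:
  assumes "\<And>i. i < 5 \<Longrightarrow> F i \<in> borel_measurable borel"
  shows "rot_dual F \<in> borel_measurable borel"
proof -
  interpret P: pair_sigma_finite "lborel :: real measure" slot_space by (rule pair_sigma_finite_rot)
  have [measurable]: "five_slots F \<in> borel_measurable (borel \<Otimes>\<^sub>M (borel \<Otimes>\<^sub>M (borel \<Otimes>\<^sub>M borel)))"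
    by (rule measurable_five_slots) (rule assms)
  show ?thesis unfolding rot_dual_def[abs_def] by measurable
qed

text \<open>Duality is applied to the integral of the absolute value times the weight, which is well
  defined before any integrability is known and dominates the weighted
  \<open>rot_dual\<close>.\<close>

lemma rot_dual_weighted:
  fixes \<sigma> \<delta> :: real
  assumes \<sigma>: "\<sigma> > 0" and \<delta>: "\<delta> = \<sigma> / (1 + \<sigma>)"
    and mF: "\<And>i. i < 5 \<Longrightarrow> F i \<in> borel_measurable borel"
    and F: "\<And>i. i < 5 \<Longrightarrow> square_integrable lborel (weighted \<sigma> (F i))"
  shows "square_integrable lborel (weighted (\<sigma> + \<delta>) (rot_dual F))"
    and "sqnorm (weighted (\<sigma> + \<delta>) (rot_dual F)) \<le> (4 * 2 powr \<sigma> * 4608)\<^sup>2 * (\<Prod>i<5. sqnorm (weighted \<sigma> (F i)))"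
proof -
  interpret P: pair_sigma_finite "lborel :: real measure" slot_space by (rule pair_sigma_finite_rot)
  have [measurable]: "five_slots F \<in> borel_measurable (borel \<Otimes>\<^sub>M (borel \<Otimes>\<^sub>M (borel \<Otimes>\<^sub>M borel)))"
    by (rule measurable_five_slots) (rule mF)
  have [measurable]: "rot_dual F \<in> borel_measurable borel"
    by (rule measurable_rot_dual) (rule mF)
  define A where "A = (\<Prod>i<5. sqnorm (weighted \<sigma> (F i)))"
  have A0: "0 \<le> A" unfolding A_def by (intro prod_nonneg) auto
  define C where "C = 4 * 2 powr \<sigma> * 4608 * sqrt A"
  have C0: "0 \<le> C" by (simp add: C_def A0)
  define u where "u z = (\<integral>\<^sup>+q. ennreal (norm (five_slots F (z, q))) \<partial>slot_space) * ennreal (japanese z powr (\<sigma> + \<delta>))" for z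
  have mu [measurable]: "u \<in> borel_measurable borel"
    unfolding u_def[abs_def] by measurable
  have "(\<integral>\<^sup>+z. (u z)\<^sup>2 \<partial>lborel) \<le> ennreal (C\<^sup>2)"
  proof (rule square_integral_le_by_duality[OF mu C0])
    fix g :: "real \<Rightarrow> complex" assume g: "square_integrable lborel g"
    then have [measurable]: "g \<in> borel_measurable borel" by (simp add: square_integrable_def)
    have "(\<integral>\<^sup>+z. u z * ennreal (norm (g z)) \<partial>lborel) =
      (\<integral>\<^sup>+z. (\<integral>\<^sup>+q. ennreal (norm (five_slots F (z, q))) * ennreal (japanese (coord 5 (z, q)) powr (\<sigma> + \<delta>)) * ennreal (norm (g (coord 5 (z, q)))) \<partial>slot_space) \<partial>lborel)"
      unfolding u_def coord_5 by (intro nn_integral_cong) (simp add: nn_integral_multc)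
    also have "\<dots> = (\<integral>\<^sup>+p. ennreal (norm (five_slots F p)) * ennreal (japanese (coord 5 p) powr (\<sigma> + \<delta>)) * ennreal (norm (g (coord 5 p))) \<partial>rot_space)"
      unfolding rot_space_eq
      using sigma_finite_measure.nn_integral_fst[OF sigma_finite_slot_space, of "\<lambda>p. ennreal (norm (five_slots F p)) * ennreal (japanese (coord 5 p) powr (\<sigma> + \<delta>)) * ennreal (norm (g (coord 5 p)))" lborel]
      by simp
    also have "\<dots> \<le> ennreal (4 * 2 powr \<sigma> * 4608 * sqrt ((\<Prod>i<5. sqnorm (weighted \<sigma> (F i))) * sqnorm g))"
      by (rule weighted_five_slots_bound[OF \<sigma> \<delta> mF F g])
    also have "4 * 2 powr \<sigma> * 4608 * sqrt ((\<Prod>i<5. sqnorm (weighted \<sigma> (F i))) * sqnorm g) = C * sqrt (sqnorm g)"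
      unfolding C_def A_def[symmetric] real_sqrt_mult by simp
    finally show "(\<integral>\<^sup>+z. u z * ennreal (norm (g z)) \<partial>lborel) \<le> ennreal (C * sqrt (sqnorm g))" .
  qed
  moreover have "ennreal ((norm (weighted (\<sigma> + \<delta>) (rot_dual F) z))\<^sup>2) \<le> (u z)\<^sup>2" for z
  proof -
    have "ennreal (norm (rot_dual F z)) \<le> (\<integral>\<^sup>+q. ennreal (norm (five_slots F (z, q))) \<partial>slot_space)"
    proof (cases "integrable slot_space (\<lambda>q. five_slots F (z, q))")
      case True
      then show ?thesis unfolding rot_dual_def by (rule integral_norm_bound_ennreal)
    \<comment> \<open>Where the inner integral diverges, \<open>rot_dual\<close> is 0 by convention
      and the bound is trivial.\<close>
    qed (simp add: rot_dual_def not_integrable_integral_eq)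
    then have "ennreal (norm (weighted (\<sigma> + \<delta>) (rot_dual F) z)) \<le> u z"
      unfolding norm_weighted u_def by (simp add: ennreal_mult mult.commute[of "ennreal (japanese z powr _)"] mult_right_mono)
    then show ?thesis by (simp add: power_mono flip: ennreal_power)
  qed
  ultimately have le: "(\<integral>\<^sup>+z. ennreal ((norm (weighted (\<sigma> + \<delta>) (rot_dual F) z))\<^sup>2) \<partial>lborel) \<le> ennreal (C\<^sup>2)"
    by (meson nn_integral_mono order.trans)
  show sq: "square_integrable lborel (weighted (\<sigma> + \<delta>) (rot_dual F))"
  proof (rule square_integrable_nn)
    show "weighted (\<sigma> + \<delta>) (rot_dual F) \<in> borel_measurable lborel"
      unfolding weighted_def by measurable
    show "(\<integral>\<^sup>+z. ennreal ((norm (weighted (\<sigma> + \<delta>) (rot_dual F) z))\<^sup>2) \<partial>lborel) < \<infinity>"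
      using le by (rule order_le_less_trans) simp
  qed
  have "C\<^sup>2 = (4 * 2 powr \<sigma> * 4608)\<^sup>2 * A"
    unfolding C_def power_mult_distrib[of _ "sqrt A"] using A0 by simp
  moreover have "sqnorm (weighted (\<sigma> + \<delta>) (rot_dual F)) \<le> C\<^sup>2"
    using le unfolding nn_integral_square[OF sq] by (subst (asm) ennreal_le_iff) auto
  ultimately show "sqnorm (weighted (\<sigma> + \<delta>) (rot_dual F)) \<le> (4 * 2 powr \<sigma> * 4608)\<^sup>2 * (\<Prod>i<5. sqnorm (weighted \<sigma> (F i)))"
    by (simp only: A_def)
qed

lemma rot_form_eq_inner:
  assumes F: "\<And>i. i < 6 \<Longrightarrow> square_integrable lborel (F i)"
  shows "rot_form F = (\<integral>z. rot_dual F z * cnj (F 5 z) \<partial>lborel)"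
proof -
  interpret P: pair_sigma_finite "lborel :: real measure" slot_space by (rule pair_sigma_finite_rot)
  have "integrable (lborel \<Otimes>\<^sub>M slot_space) (rot_density F)"
    unfolding rot_space_eq[symmetric] by (rule rot_form_bound(1)) (rule F)
  from P.integral_fst'[OF this] show ?thesis
    by (simp add: rot_form_def rot_space_eq rot_density_five_slots coord_5 rot_dual_def)
qed

section \<open>The operator\<close>

lemma borel_representative_exists:
  fixes f :: "real \<Rightarrow> complex"
  assumes [measurable]: "f \<in> borel_measurable lebesgue"
  shows "\<exists>f'\<in>borel_measurable borel. AE x in lebesgue. f x = f' x"
proof -
  have "(\<lambda>x. Re (f x)) \<in> borel_measurable lebesgue" "(\<lambda>x. Im (f x)) \<in> borel_measurable lebesgue"
    by measurable
  from this[THEN completion_ex_borel_measurable_real]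
  obtain u v where uv: "u \<in> borel_measurable lborel" "AE x in lborel. Re (f x) = u x"
    "v \<in> borel_measurable lborel" "AE x in lborel. Im (f x) = v x"
    by blast
  have "AE x in lborel. f x = Complex (u x) (v x)"
    using uv(2,4) by eventually_elim (simp add: complex_eq_iff)
  moreover have "(\<lambda>x. Complex (u x) (v x)) \<in> borel_measurable borel"
    unfolding Complex_eq using uv(1,3) by measurable
  ultimately show ?thesis
    by (intro bexI[of _ "\<lambda>x. Complex (u x) (v x)"]) (auto intro: AE_completion)
qed

text \<open>\<open>L2\<close> consists of Lebesgue measurable functions; a Borel representative
  gives access to product measures and changes no integral.\<close>

definition borel_rep :: "(real \<Rightarrow> complex) \<Rightarrow> real \<Rightarrow> complex" where
  "borel_rep f = (SOME f'. f' \<in> borel_measurable borel \<and> (AE x in lebesgue. f x = f' x))"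

lemma borel_rep:
  assumes "f \<in> borel_measurable lebesgue"
  shows "borel_rep f \<in> borel_measurable borel" "AE x in lebesgue. f x = borel_rep f x"
proof -
  have "\<exists>f'. f' \<in> borel_measurable borel \<and> (AE x in lebesgue. f x = f' x)"
    using borel_representative_exists[OF assms] by blast
  from someI_ex[OF this] show "borel_rep f \<in> borel_measurable borel" "AE x in lebesgue. f x = borel_rep f x"
    unfolding borel_rep_def by auto
qed

lemma lebesgue_measurable [simp]: "f \<in> borel_measurable borel \<Longrightarrow> f \<in> borel_measurable lebesgue"
  by (rule measurable_completion) simp

lemma integral_lebesgue_eq:
  fixes f f' :: "real \<Rightarrow> 'a::{banach, second_countable_topology}"
  assumes "f \<in> borel_measurable lebesgue" "f' \<in> borel_measurable borel" "AE x in lebesgue. f x = f' x"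
  shows "integral\<^sup>L lebesgue f = integral\<^sup>L lborel f'" "integrable lebesgue f \<longleftrightarrow> integrable lborel f'"
proof -
  have "integral\<^sup>L lebesgue f = integral\<^sup>L lebesgue f'"
    using assms by (intro integral_cong_AE) auto
  also have "\<dots> = integral\<^sup>L lborel f'" using assms by (intro integral_completion) simp
  finally show "integral\<^sup>L lebesgue f = integral\<^sup>L lborel f'" .
  have "integrable lebesgue f \<longleftrightarrow> integrable lebesgue f'"
    using assms by (intro integrable_cong_AE) auto
  also have "\<dots> \<longleftrightarrow> integrable lborel f'" using assms by (intro integrable_completion) simp
  finally show "integrable lebesgue f \<longleftrightarrow> integrable lborel f'" .
qed

lemma L2_eq_rep:
  assumes f: "f \<in> borel_measurable lebesgue" and f': "f' \<in> borel_measurable borel" and ae: "AE x in lebesgue. f x = f' x"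
  shows "f \<in> L2 \<longleftrightarrow> square_integrable lborel f'" "L2_norm f = sqrt (sqnorm f')"
proof -
  note [measurable] = f f'
  have 1: "(\<lambda>x. (norm (f x))\<^sup>2) \<in> borel_measurable lebesgue" "(\<lambda>x. (norm (f' x))\<^sup>2) \<in> borel_measurable borel"
    by measurable
  have 2: "AE x in lebesgue. (norm (f x))\<^sup>2 = (norm (f' x))\<^sup>2"
    using ae by eventually_elim simp
  show "f \<in> L2 \<longleftrightarrow> square_integrable lborel f'" "L2_norm f = sqrt (sqnorm f')"
    using integral_lebesgue_eq[OF 1 2] f f' by (auto simp: L2_def L2_norm_def square_integrable_def)
qed

lemma L2_measurable: "f \<in> L2 \<Longrightarrow> f \<in> borel_measurable lebesgue"
  by (simp add: L2_def)

lemma L2_rep: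
  assumes "f \<in> L2"
  shows "square_integrable lborel (borel_rep f)" "AE x in lebesgue. f x = borel_rep f x"
    "borel_rep f \<in> borel_measurable borel"
  using L2_eq_rep(1)[OF L2_measurable[OF assms] borel_rep[OF L2_measurable[OF assms]]]
    borel_rep[OF L2_measurable[OF assms]] assms by auto

lemma L2_square_integrable:
  assumes "square_integrable lborel f"
  shows "f \<in> L2" "L2_norm f = sqrt (sqnorm f)"
proof -
  have f: "f \<in> borel_measurable borel" using assms by (simp add: square_integrable_def)
  show "f \<in> L2" "L2_norm f = sqrt (sqnorm f)"
    using L2_eq_rep[OF lebesgue_measurable[OF f] f] assms by auto
qed

lemma L2_inner_eq_rep:
  assumes f: "f \<in> borel_measurable lebesgue" "f' \<in> borel_measurable borel" "AE x in lebesgue. f x = f' x"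
    and g: "g \<in> borel_measurable lebesgue" "g' \<in> borel_measurable borel" "AE x in lebesgue. g x = g' x"
  shows "L2_inner f g = (\<integral>x. f' x * cnj (g' x) \<partial>lborel)"
proof -
  note [measurable] = f(1,2) g(1,2)
  have "AE x in lebesgue. f x * cnj (g x) = f' x * cnj (g' x)"
    using f(3) g(3) by eventually_elim simp
  then show ?thesis
    unfolding L2_inner_def by (intro integral_lebesgue_eq(1)) auto
qed

lemma L2_inner_hermite:
  assumes "f \<in> L2"
  shows "L2_inner f (\<lambda>y. complex_of_real (hermite_fun n y)) = coef (borel_rep f) n"
proof -
  have m: "(\<lambda>y. complex_of_real (hermite_fun n y)) \<in> borel_measurable borel" by measurable
  show ?thesis
    using L2_inner_eq_rep[OF L2_measurable[OF assms] L2_rep(3,2)[OF assms] lebesgue_measurable[OF m] m]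
    by (simp add: coef_def)
qed

text \<open>The function chosen at time t and the flow are L^2-limits of the same partial sums, so
  they agree almost everywhere in x. Joint measurability comes from \<open>flow\<close>
  alone.\<close>

lemma propagator_flow:
  assumes f: "f \<in> L2"
  shows "propagator t f \<in> L2" "AE x in lebesgue. propagator t f x = flow (borel_rep f) t x"
proof -
  let ?f = "borel_rep f"
  let ?S = "\<lambda>N. hermite_sum (coef ?f) {..<N} t"
  define P where "P u \<longleftrightarrow> u \<in> L2 \<and> (\<lambda>N. L2_norm (\<lambda>x. u x - ?S N x)) \<longlonglongrightarrow> 0" for u
  note rep = L2_rep[OF f]
  note s = summable_coef(1)[OF rep(1)]
  have propag: "propagator t f = (SOME u. P u)"
    unfolding propagator_def P_def hermite_sum_def L2_inner_hermite[OF f] ..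
  have "P (flow ?f t)"
  proof -
    have le: "norm (L2_norm (\<lambda>x. flow ?f t x - ?S N x)) \<le> sqrt (tail (coef ?f) N)" for N
    proof -
      have "square_integrable lborel (\<lambda>x. flow ?f t x - ?S N x)"
        by (intro square_integrable_diff square_integrable_flow rep square_integrable_hermite_sum)
      then show ?thesis
        using flowc_error'[OF s, of t N] by (simp add: L2_square_integrable(2) flow_def)
    qed
    have lim: "(\<lambda>N. sqrt (tail (coef ?f) N)) \<longlonglongrightarrow> 0"
      using tendsto_real_sqrt[OF tail_tendsto_0[OF s]] by simp
    have "(\<lambda>N. L2_norm (\<lambda>x. flow ?f t x - ?S N x)) \<longlonglongrightarrow> 0"
      by (rule Lim_null_comparison[OF always_eventually lim]) (rule allI, rule le)
    then show ?thesis
      unfolding P_def using L2_square_integrable(1)[OF square_integrable_flow(1)[OF rep(1)]] by blast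
  qed
  then have Pp: "P (propagator t f)" unfolding propag by (rule someI[where P=P])
  then show u: "propagator t f \<in> L2" by (simp add: P_def)
  let ?u = "borel_rep (propagator t f)"
  note urep = L2_rep[OF u]
  have "L2_norm (\<lambda>x. propagator t f x - ?S N x) = sqrt (\<integral>x. (norm (?u x - ?S N x))\<^sup>2 \<partial>lborel)" for N
  proof (rule L2_eq_rep(2))
    show "AE x in lebesgue. propagator t f x - ?S N x = ?u x - ?S N x"
      using urep(2) by eventually_elim simp
  qed (use L2_measurable[OF u] urep(3) in \<open>auto intro!: borel_measurable_diff\<close>)
  then have "(\<lambda>N. sqrt (\<integral>x. (norm (?u x - ?S N x))\<^sup>2 \<partial>lborel)) \<longlonglongrightarrow> 0"
    using Pp by (simp add: P_def)
  then have "(\<lambda>N. (sqrt (\<integral>x. (norm (?u x - ?S N x))\<^sup>2 \<partial>lborel))\<^sup>2) \<longlonglongrightarrow> 0\<^sup>2"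
    by (intro tendsto_power)
  then have "(\<lambda>N. \<integral>x. (norm (?u x - ?S N x))\<^sup>2 \<partial>lborel) \<longlonglongrightarrow> 0" by simp
  then have "AE x in lborel. ?u x = flow ?f t x"
    unfolding flow_def by (intro flowc_unique s urep)
  then have "AE x in lebesgue. ?u x = flow ?f t x" by (rule AE_completion)
  with urep(2) show "AE x in lebesgue. propagator t f x = flow ?f t x"
    by eventually_elim simp
qed

lemma lborel_on_eq: "lborel_on a b = density lborel (\<lambda>x. ennreal (indicator {a..b} x))"
  by (simp add: lborel_on_def ennreal_indicator)

lemma lebesgue_on_eq:
  fixes f :: "real \<Rightarrow> complex"
  assumes f [measurable]: "f \<in> borel_measurable borel"
  shows "integral\<^sup>L (lebesgue_on {a..b}) f = integral\<^sup>L (lborel_on a b) f"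
    and "integrable (lebesgue_on {a..b}) f \<longleftrightarrow> integrable (lborel_on a b) f"
proof -
  have m: "(\<lambda>x. indicator {a..b} x *\<^sub>R f x) \<in> borel_measurable lborel" by measurable
  show "integral\<^sup>L (lebesgue_on {a..b}) f = integral\<^sup>L (lborel_on a b) f"
    using integral_completion[OF m] by (simp add: integral_restrict_space integral_lborel_on)
  show "integrable (lebesgue_on {a..b}) f \<longleftrightarrow> integrable (lborel_on a b) f"
    using integrable_completion[OF m] by (simp add: integrable_restrict_space lborel_on_eq integrable_density)
qed

lemma AE_lebesgue_on:
  assumes "AE t in lborel_on a b. P t"
  shows "AE t in lebesgue_on {a..b}. P t"
proof -
  have "AE t in lborel. 0 < (indicator {a..b} t :: ennreal) \<longrightarrow> P t"
    using assms unfolding lborel_on_def by (simp add: AE_density)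
  then have "AE t in lborel. t \<in> {a..b} \<longrightarrow> P t"
    by eventually_elim (auto simp: indicator_def)
  then have "AE t in lebesgue. t \<in> {a..b} \<longrightarrow> P t" by (rule AE_completion)
  then show ?thesis by (simp add: AE_restrict_space_iff)
qed

section \<open>The weak definition of the operator\<close>

lemma T6_density_flow:
  assumes f: "f1 \<in> L2" "f2 \<in> L2" "f3 \<in> L2" "f4 \<in> L2" "f5 \<in> L2" and g: "g \<in> L2"
  defines "F \<equiv> (\<lambda>i. borel_rep ([f1, f2, f3, f4, f5, g] ! i))"
  shows "T6_density f1 f2 f3 f4 f5 g t \<in> borel_measurable lebesgue"
    and "AE x in lebesgue. T6_density f1 f2 f3 f4 f5 g t x = time_density F (t, x)"
proof -
  have [measurable]: "propagator t f1 \<in> borel_measurable lebesgue" "propagator t f2 \<in> borel_measurable lebesgue"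
    "propagator t f3 \<in> borel_measurable lebesgue" "propagator t f4 \<in> borel_measurable lebesgue"
    "propagator t f5 \<in> borel_measurable lebesgue" "propagator t g \<in> borel_measurable lebesgue"
    using f g by (auto intro!: L2_measurable propagator_flow)
  show "T6_density f1 f2 f3 f4 f5 g t \<in> borel_measurable lebesgue"
    unfolding T6_density_def[abs_def] by measurable
  show "AE x in lebesgue. T6_density f1 f2 f3 f4 f5 g t x = time_density F (t, x)"
    using f[THEN propagator_flow(2), of t] propagator_flow(2)[OF g, of t]
    by eventually_elim (simp add: T6_density_def time_density_def prod_lessThan_6 cnj_slot_def F_def mult.assoc)
qed

text \<open>At each time the density equals \<open>time_density\<close> almost everywhere in x, so
  the iterated integral is \<open>time_form\<close>, and the identity of the two forms turns it into
  an inner product with \<open>rot_dual\<close>. The constant is the factor 12 / pi of the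
  definition times the ratio of the two forms.\<close>

lemma is_T6_rot_dual:
  assumes f: "f1 \<in> L2" "f2 \<in> L2" "f3 \<in> L2" "f4 \<in> L2" "f5 \<in> L2"
  defines "F \<equiv> (\<lambda>i. borel_rep ([f1, f2, f3, f4, f5] ! i))"
  defines "h \<equiv> (\<lambda>z. complex_of_real (12 / pi * (1 / (4 * pi * sqrt 3))) * rot_dual F z)"
  assumes h: "square_integrable lborel h"
  shows "is_T6 f1 f2 f3 f4 f5 h"
  unfolding is_T6_def
proof (intro conjI ballI)
  show "h \<in> L2" by (rule L2_square_integrable(1)[OF h])
next
  fix g assume g: "g \<in> L2"
  define G where "G = (\<lambda>i. borel_rep ([f1, f2, f3, f4, f5, g] ! i))"
  have sG: "square_integrable lborel (G i)" if "i < 6" for i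
  proof -
    have "i \<in> {0, 1, 2, 3, 4, 5}" using that by auto
    then show ?thesis using f g by (auto simp: G_def intro: L2_rep)
  qed
  have FG: "rot_dual F = rot_dual G"
  proof -
    have "F i = G i" if "i < 5" for i
    proof -
      have "i \<in> {0, 1, 2, 3, 4}" using that by auto
      then show ?thesis by (auto simp: F_def G_def)
    qed
    then have "five_slots F = five_slots G"
      unfolding five_slots_def[abs_def] by (auto intro!: prod.cong ext)
    then show ?thesis by (simp add: rot_dual_def[abs_def])
  qed
  interpret C: sigma_finite_measure "lborel_on (-pi/4) (pi/4)" by (rule sigma_finite_lborel_on)
  interpret P: pair_sigma_finite "lborel_on (-pi/4) (pi/4)" "lborel :: real measure" ..
  have int: "integrable (lborel_on (-pi/4) (pi/4) \<Otimes>\<^sub>M lborel) (time_density G)"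
    using time_form_eq_rot_form(1)[of G] sG by (simp add: time_space_def)
  have mt: "(\<lambda>x. time_density G (t, x)) \<in> borel_measurable borel" for t by measurable
  note T6 = T6_density_flow[OF f g, folded G_def]
  note conv = integral_lebesgue_eq[OF T6(1) mt T6(2)]
  have mI: "(\<lambda>t. \<integral>x. time_density G (t, x) \<partial>lborel) \<in> borel_measurable borel"
    by measurable
  have "AE t in lborel_on (-pi/4) (pi/4). integrable lborel (\<lambda>x. time_density G (t, x))"
    by (rule P.AE_integrable_fst'[OF int])
  then show "AE t in lebesgue_on {- pi / 4..pi / 4}. integrable lebesgue (T6_density f1 f2 f3 f4 f5 g t)"
    unfolding conv(2) by (rule AE_lebesgue_on)
  show "integrable (lebesgue_on {- pi / 4..pi / 4}) (\<lambda>t. \<integral>x. T6_density f1 f2 f3 f4 f5 g t x \<partial>lebesgue)"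
    unfolding conv(1) lebesgue_on_eq(2)[OF mI] by (rule P.integrable_fst'[OF int])
  have "(\<integral>t. (\<integral>x. T6_density f1 f2 f3 f4 f5 g t x \<partial>lebesgue) \<partial>lebesgue_on {- pi / 4..pi / 4}) = time_form G"
    unfolding conv(1) lebesgue_on_eq(1)[OF mI] time_form_def time_space_def by (rule P.integral_fst'[OF int])
  also have "\<dots> = of_real (1 / (4 * pi * sqrt 3)) * rot_form G"
    using time_form_eq_rot_form(2)[of G] sG by blast
  also have "rot_form G = (\<integral>z. rot_dual F z * cnj (borel_rep g z) \<partial>lborel)"
    using rot_form_eq_inner[of G] sG by (simp add: FG) (simp add: G_def)
  finally have "complex_of_real (12 / pi) * (\<integral>t. (\<integral>x. T6_density f1 f2 f3 f4 f5 g t x \<partial>lebesgue) \<partial>lebesgue_on {- pi / 4..pi / 4}) =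
     complex_of_real (12 / pi * (1 / (4 * pi * sqrt 3))) * (\<integral>z. rot_dual F z * cnj (borel_rep g z) \<partial>lborel)"
    by (simp only: of_real_mult mult.assoc)
  also have "\<dots> = (\<integral>z. h z * cnj (borel_rep g z) \<partial>lborel)"
    unfolding h_def mult.assoc by (rule integral_mult_right_zero[symmetric])
  also have "\<dots> = L2_inner h g"
  proof -
    have mh: "h \<in> borel_measurable borel" using h by (simp add: square_integrable_def)
    show ?thesis
      using L2_inner_eq_rep[OF lebesgue_measurable[OF mh] mh _ L2_measurable[OF g] L2_rep(3,2)[OF g]] by simp
  qed
  finally show "L2_inner h g = complex_of_real (12 / pi) *
     (\<integral>t. (\<integral>x. T6_density f1 f2 f3 f4 f5 g t x \<partial>lebesgue) \<partial>lebesgue_on {- pi / 4..pi / 4})" ..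
qed

text \<open>Testing with the difference of the two functions shows that its norm vanishes. This
  transfers the estimate from an explicit function to the one chosen in \<open>T6\<close>.\<close>

lemma is_T6_unique:
  assumes "is_T6 f1 f2 f3 f4 f5 h" "is_T6 f1 f2 f3 f4 f5 k"
  shows "AE x in lebesgue. h x = k x"
proof -
  have h: "h \<in> L2" and k: "k \<in> L2" and eq: "\<And>g. g \<in> L2 \<Longrightarrow> L2_inner h g = L2_inner k g"
    using assms by (auto simp: is_T6_def)
  note rh = L2_rep[OF h] and rk = L2_rep[OF k]
  define d where "d x = borel_rep h x - borel_rep k x" for x
  have d: "square_integrable lborel d"
    unfolding d_def[abs_def] by (intro square_integrable_diff rh rk)
  have md: "d \<in> borel_measurable borel" using d by (simp add: square_integrable_def)
  have "(\<integral>x. borel_rep h x * cnj (d x) \<partial>lborel) = (\<integral>x. borel_rep k x * cnj (d x) \<partial>lborel)"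
    using eq[OF L2_square_integrable(1)[OF d]]
      L2_inner_eq_rep[OF L2_measurable[OF h] rh(3,2) lebesgue_measurable[OF md] md]
      L2_inner_eq_rep[OF L2_measurable[OF k] rk(3,2) lebesgue_measurable[OF md] md] by simp
  then have "(\<integral>x. d x * cnj (d x) \<partial>lborel) = 0"
    using square_integrable_product[OF rh(1) square_integrable_cnj[OF d]] square_integrable_product[OF rk(1) square_integrable_cnj[OF d]]
    by (simp add: d_def[of "_"] left_diff_distrib)
  then have "complex_of_real (sqnorm d) = 0"
    unfolding square_integral_cnj .
  then have "AE x in lborel. d x = 0"
    by (intro square_integral_eq_0[OF d]) simp
  then have "AE x in lebesgue. d x = 0" by (rule AE_completion)
  with rh(2) rk(2) show ?thesis
    by eventually_elim (simp add: d_def)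
qed

text \<open>Multiplication by the inverse weight recovers measurability of \<open>f\<close>, and for
  \<sigma> \<ge> 0 the weight is at least 1, so the weighted norm controls the plain one.\<close>

lemma wL2_rep:
  assumes \<sigma>: "0 \<le> \<sigma>" and f: "f \<in> wL2 \<sigma>"
  shows "f \<in> L2" "square_integrable lborel (weighted \<sigma> (borel_rep f))" "wL2_norm \<sigma> f = sqrt (sqnorm (weighted \<sigma> (borel_rep f)))"
proof -
  have w: "weighted \<sigma> f \<in> L2" using f by (simp add: wL2_def)
  have mj: "(\<lambda>x. complex_of_real (japanese x powr a)) \<in> borel_measurable lebesgue" for a
    by (rule lebesgue_measurable) measurable
  have "f = (\<lambda>x. complex_of_real (japanese x powr - \<sigma>) * weighted \<sigma> f x)"
    by (auto simp: weighted_def powr_minus)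
  then have mf: "f \<in> borel_measurable lebesgue"
    using borel_measurable_times[OF mj[of "- \<sigma>"] L2_measurable[OF w]] by metis
  note rep = borel_rep[OF mf]
  have mw: "weighted \<sigma> (borel_rep f) \<in> borel_measurable borel"
    unfolding weighted_def using rep(1) by measurable
  have ae: "AE x in lebesgue. weighted \<sigma> f x = weighted \<sigma> (borel_rep f) x"
    using rep(2) by eventually_elim (simp add: weighted_def)
  show sw: "square_integrable lborel (weighted \<sigma> (borel_rep f))" "wL2_norm \<sigma> f = sqrt (sqnorm (weighted \<sigma> (borel_rep f)))"
    using L2_eq_rep[OF L2_measurable[OF w] mw ae] w by (auto simp: wL2_norm_def)
  have "square_integrable lborel (borel_rep f)"
  proof (rule square_integrable_bound)
    show "integrable lborel (\<lambda>x. (norm (weighted \<sigma> (borel_rep f) x))\<^sup>2)" using sw(1) by auto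
    show "(norm (borel_rep f x))\<^sup>2 \<le> (norm (weighted \<sigma> (borel_rep f) x))\<^sup>2" for x
    proof (rule power_mono)
      have "1 * norm (borel_rep f x) \<le> japanese x powr \<sigma> * norm (borel_rep f x)"
        using \<sigma> japanese_ge_1[of x] by (intro mult_right_mono ge_one_powr_ge_zero) auto
      then show "norm (borel_rep f x) \<le> norm (weighted \<sigma> (borel_rep f) x)" by (simp add: norm_weighted)
    qed simp
  qed (use rep(1) in simp)
  then show "f \<in> L2" using L2_eq_rep(1)[OF mf rep] by simp
qed

theorem theorem3p19:
  fixes \<sigma> \<delta> :: real
  assumes "\<sigma> > 0" and "\<delta> = \<sigma> / (1 + \<sigma>)"
  shows "\<delta> > 0 \<and>
    (\<exists>C::real. \<forall>f1 f2 f3 f4 f5.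
       f1 \<in> wL2 \<sigma> \<longrightarrow> f2 \<in> wL2 \<sigma> \<longrightarrow> f3 \<in> wL2 \<sigma> \<longrightarrow> f4 \<in> wL2 \<sigma> \<longrightarrow> f5 \<in> wL2 \<sigma> \<longrightarrow>
         is_T6 f1 f2 f3 f4 f5 (T6 f1 f2 f3 f4 f5) \<and>
         T6 f1 f2 f3 f4 f5 \<in> wL2 (\<sigma> + \<delta>) \<and>
         wL2_norm (\<sigma> + \<delta>) (T6 f1 f2 f3 f4 f5)
           \<le> C * (wL2_norm \<sigma> f1 * wL2_norm \<sigma> f2 * wL2_norm \<sigma> f3 * wL2_norm \<sigma> f4 * wL2_norm \<sigma> f5))"
proof (intro conjI exI allI impI)
  show \<delta>0: "\<delta> > 0" using assms by simp
  let ?\<kappa> = "12 / pi * (1 / (4 * pi * sqrt 3))" and ?C = "4 * 2 powr \<sigma> * 4608"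
  fix f1 f2 f3 f4 f5
  assume w: "f1 \<in> wL2 \<sigma>" "f2 \<in> wL2 \<sigma>" "f3 \<in> wL2 \<sigma>" "f4 \<in> wL2 \<sigma>" "f5 \<in> wL2 \<sigma>"
  have \<sigma>0: "0 \<le> \<sigma>" using assms(1) by simp
  note f = w[THEN wL2_rep(1)[OF \<sigma>0]]
  define F where "F = (\<lambda>i. borel_rep ([f1, f2, f3, f4, f5] ! i))"
  have F: "F i \<in> borel_measurable borel \<and> square_integrable lborel (weighted \<sigma> (F i))" if "i < 5" for i
  proof -
    have "i \<in> {0, 1, 2, 3, 4}" using that by auto
    then show ?thesis using f w by (auto simp: F_def intro: L2_rep wL2_rep(2)[OF \<sigma>0])
  qed
  \<comment> \<open>The explicit candidate for the operator.\<close>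
  define h where "h = (\<lambda>z. complex_of_real ?\<kappa> * rot_dual F z)"
  have mF: "\<And>i. i < 5 \<Longrightarrow> F i \<in> borel_measurable borel"
    and sF: "\<And>i. i < 5 \<Longrightarrow> square_integrable lborel (weighted \<sigma> (F i))"
    using F by blast+
  note dual = rot_dual_weighted[of \<sigma> \<delta> F, OF assms mF sF]
  have mH: "h \<in> borel_measurable borel"
    unfolding h_def using measurable_rot_dual[OF mF] by measurable
  have wh: "weighted (\<sigma> + \<delta>) h = (\<lambda>z. complex_of_real ?\<kappa> * weighted (\<sigma> + \<delta>) (rot_dual F) z)"
    by (auto simp: weighted_def h_def)
  have sw: "square_integrable lborel (weighted (\<sigma> + \<delta>) h)"
    unfolding wh by (rule square_integrable_mult) (rule dual(1), assumption+)
  \<comment> \<open>The condition \<open>is_T6\<close> asks for membership in \<open>L2\<close>,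
    which the weighted bound implies because the weight is at least 1.\<close>
  have sh: "square_integrable lborel h"
  proof (rule square_integrable_bound)
    show "integrable lborel (\<lambda>x. (norm (weighted (\<sigma> + \<delta>) h x))\<^sup>2)" using sw by auto
    show "(norm (h x))\<^sup>2 \<le> (norm (weighted (\<sigma> + \<delta>) h x))\<^sup>2" for x
    proof (rule power_mono)
      have "1 * norm (h x) \<le> japanese x powr (\<sigma> + \<delta>) * norm (h x)"
        using \<sigma>0 \<delta>0 japanese_ge_1[of x] by (intro mult_right_mono ge_one_powr_ge_zero) auto
      then show "norm (h x) \<le> norm (weighted (\<sigma> + \<delta>) h x)" by (simp add: norm_weighted)
    qed simp
  qed (use mH in simp)
  have ish: "is_T6 f1 f2 f3 f4 f5 h"
    unfolding h_def F_def by (rule is_T6_rot_dual[OF f]) (use sh in \<open>simp add: h_def F_def\<close>)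
  then show isT: "is_T6 f1 f2 f3 f4 f5 (T6 f1 f2 f3 f4 f5)"
    unfolding T6_def by (rule someI[where P="is_T6 f1 f2 f3 f4 f5"])
  let ?T = "T6 f1 f2 f3 f4 f5"
  have T: "?T \<in> L2" using isT by (simp add: is_T6_def)
  have mT: "weighted (\<sigma> + \<delta>) ?T \<in> borel_measurable lebesgue"
  proof -
    have "(\<lambda>x. complex_of_real (japanese x powr (\<sigma> + \<delta>))) \<in> borel_measurable lebesgue"
      by (rule lebesgue_measurable) measurable
    then show ?thesis unfolding weighted_def using L2_measurable[OF T] by measurable
  qed
  have mwh: "weighted (\<sigma> + \<delta>) h \<in> borel_measurable borel" using sw by (simp add: square_integrable_def)
  \<comment> \<open>The chosen function equals the candidate almost everywhere, so it inherits the
    weighted membership and norm.\<close>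
  have ae: "AE x in lebesgue. weighted (\<sigma> + \<delta>) ?T x = weighted (\<sigma> + \<delta>) h x"
    using is_T6_unique[OF isT ish] by eventually_elim (simp add: weighted_def)
  note norm = L2_eq_rep[OF mT mwh ae]
  show "?T \<in> wL2 (\<sigma> + \<delta>)" using norm(1) sw by (simp add: wL2_def)
  have "sqnorm (weighted (\<sigma> + \<delta>) h) = ?\<kappa>\<^sup>2 * sqnorm (weighted (\<sigma> + \<delta>) (rot_dual F))"
    unfolding wh by (simp only: norm_mult power_mult_distrib norm_of_real power2_abs integral_mult_right_zero)
  also have "\<dots> \<le> ?\<kappa>\<^sup>2 * (?C\<^sup>2 * (\<Prod>i<5. sqnorm (weighted \<sigma> (F i))))"
    by (rule mult_left_mono[OF dual(2)]) simp_all
  finally have le: "sqnorm (weighted (\<sigma> + \<delta>) h) \<le> (?\<kappa> * ?C)\<^sup>2 * (\<Prod>i<5. sqnorm (weighted \<sigma> (F i)))"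
    by (simp only: power_mult_distrib mult.assoc)
  have "sqrt (sqnorm (weighted (\<sigma> + \<delta>) h)) \<le> sqrt ((?\<kappa> * ?C)\<^sup>2 * (\<Prod>i<5. sqnorm (weighted \<sigma> (F i))))"
    by (rule real_sqrt_le_mono[OF le])
  also have "\<dots> = ?\<kappa> * ?C * sqrt (\<Prod>i<5. sqnorm (weighted \<sigma> (F i)))"
    unfolding real_sqrt_mult real_sqrt_abs by (simp add: abs_mult)
  also have "sqrt (\<Prod>i<5. sqnorm (weighted \<sigma> (F i))) = wL2_norm \<sigma> f1 * wL2_norm \<sigma> f2 * wL2_norm \<sigma> f3 * wL2_norm \<sigma> f4 * wL2_norm \<sigma> f5"
    unfolding w[THEN wL2_rep(3)[OF \<sigma>0]] prod_lessThan_5 real_sqrt_mult by (simp add: F_def)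
  finally show "wL2_norm (\<sigma> + \<delta>) ?T \<le> (?\<kappa> * ?C) *
     (wL2_norm \<sigma> f1 * wL2_norm \<sigma> f2 * wL2_norm \<sigma> f3 * wL2_norm \<sigma> f4 * wL2_norm \<sigma> f5)"
    using norm(2) by (simp only: wL2_norm_def)
qed

end
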